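(* Assume the setting of the time-inhomogeneous theorem: $G$ is a generator matrix on the discrete space $\mathcal X$ with no zero rows; $\theta>0$ and $M\in\mathbb N$ exceed $\inf\{r>0:I+r^{-1}G\text{ non-negative}\}$; $Q=I+G/\theta$; $\pi$ is a probability vector and $\mu$ a stationary distribution of $Q$ with $\pi^tQ^n\to\mu^t$ entrywise; $\mathbf T$ is the inhomogeneous Markov chain with initial law $\pi$ and kernels $K_n=I+\frac Gn\mathbb 1(n>M)$ (from time $n$ to $n+1$); $G'_{i,j}=\frac{\mu_j}{\mu_i}G_{j,i}\mathbb 1(\mu_i\ne0)$; $(\mathbf P',\mathbf Y')$ has MCcGEM$(G')$ distribution with respect to $\mu$. Then $\mu$ is a stationary distribution of $Q'=I+G'/\theta$. Let $\mathbf T'$ be the stationary homogeneous Markov chain with kernel $Q'$ and initial distribution $\mu$, and $\mathbf P^+$ a GEM$(\theta)$ sequence independent of $\mathbf T'$. Then, as $n\to\infty$, $\nu_n=\langle\frac1n\sum_{j=1}^n\delta_{T_j}(l):l\in\mathcal X\rangle$ converges in distribution to a random probability vector $\nu$ with $$\nu\overset d=\Big\langle\sum_{j=1}^\infty P'_j\delta_{Y'_j}(l):l\in\mathcal X\Big\rangle\overset d=\Big\langle\sum_{j=1}^\infty P^+_j\delta_{T'_j}(l):l\in\mathcal X\Big\rangle.$$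
   Context: Generator matrix: $G_{i,j}\ge0$ for $i\ne j$, $G_{i,i}=-\sum_{j\ne i}G_{i,j}$, $\sup_i|G_{i,i}|<\infty$. $K_G(w,z)=G_{w,z}/(-G_{w,w})$ if $w\ne z$ and $G_{w,w}\ne0$; $=1$ if $w=z$, $G_{w,w}=0$; $=0$ otherwise. GEM$(\theta)$: $P_j=X_j\prod_{i<j}(1-X_i)$, $X_j$ i.i.d. Beta$(1,\theta)$. MCcGEM$(G)$ with respect to $\mu$: law of $(\mathbf P,\mathbf Y)$ where $\mathbf Y$ is a Markov chain with kernel $K_G$ and initial law $\mu$, and given $\mathbf Y=\mathbf y$, $P_j=X_j\prod_{i<j}(1-X_i)$ with independent $X_j\sim$ Beta$(1,-G_{y_j,y_j})$ (Beta$(1,0)\equiv1$). Convergence in distribution of $\nu_n$ is for random elements of the space of probability vectors on $\mathcal X$ with the product (coordinatewise) topology. *)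

theory Defs
  imports "HOL-Probability.Probability"
begin

definition idm :: "'a \<Rightarrow> 'a \<Rightarrow> real" where
  "idm i j = (if i = j then 1 else 0)"

definition generator :: "('a \<Rightarrow> 'a \<Rightarrow> real) \<Rightarrow> bool" where
  "generator G \<longleftrightarrow>
     (\<forall>i j. i \<noteq> j \<longrightarrow> G i j \<ge> 0) \<and>
     (\<forall>i. ((\<lambda>j. G i j) has_sum (- G i i)) (UNIV - {i})) \<and>
     bdd_above (range (\<lambda>i. \<bar>G i i\<bar>))"

definition unif_rate :: "('a \<Rightarrow> 'a \<Rightarrow> real) \<Rightarrow> real" where
  "unif_rate G = Inf {r. r > 0 \<and> (\<forall>i j. idm i j + G i j / r \<ge> 0)}"

definition prob_vec :: "('a \<Rightarrow> real) \<Rightarrow> bool" where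
  "prob_vec p \<longleftrightarrow> (\<forall>l. p l \<ge> 0) \<and> (p has_sum 1) UNIV"

definition prob_vecs :: "('a \<Rightarrow> real) set" where
  "prob_vecs = {p. prob_vec p}"

definition vecmat :: "('a \<Rightarrow> real) \<Rightarrow> ('a \<Rightarrow> 'a \<Rightarrow> real) \<Rightarrow> 'a \<Rightarrow> real" where
  "vecmat v A = (\<lambda>j. infsum (\<lambda>i. v i * A i j) UNIV)"

definition stationary_dist :: "('a \<Rightarrow> 'a \<Rightarrow> real) \<Rightarrow> ('a \<Rightarrow> real) \<Rightarrow> bool" where
  "stationary_dist Q mu \<longleftrightarrow> prob_vec mu \<and> (\<forall>j. ((\<lambda>i. mu i * Q i j) has_sum mu j) UNIV)"

definition jump_kernel :: "('a \<Rightarrow> 'a \<Rightarrow> real) \<Rightarrow> 'a \<Rightarrow> 'a \<Rightarrow> real" where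
  "jump_kernel G w z =
     (if w \<noteq> z \<and> G w w \<noteq> 0 then G w z / (- G w w)
      else if w = z \<and> G w w = 0 then 1 else 0)"

definition beta1 :: "real \<Rightarrow> real measure" where
  "beta1 c = (if c = 0 then return borel 1
     else density lborel (\<lambda>x. ennreal (indicator {0<..<1} x * c * (1 - x) powr (c - 1))))"

definition stick :: "(nat \<Rightarrow> real) \<Rightarrow> nat \<Rightarrow> real" where
  "stick X j = X j * (\<Prod>i\<in>{1..<j}. (1 - X i))"

(* Markov chain (time index 1,2,...) with initial law ini and kernels K n (from n to n+1),
   together with a sequence of stick variables X_1, X_2, ... that, given the chain,
   are independent with X_j ~ Beta(1, c(T_j)).  Characterised by the joint finite-dimensional
   distributions. *)
definition chain_with_sticks ::
  "'m measure \<Rightarrow> ('a \<Rightarrow> real) \<Rightarrow> (nat \<Rightarrow> 'a \<Rightarrow> 'a \<Rightarrow> real) \<Rightarrow> ('a \<Rightarrow> real)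
     \<Rightarrow> (nat \<Rightarrow> 'm \<Rightarrow> 'a) \<Rightarrow> (nat \<Rightarrow> 'm \<Rightarrow> real) \<Rightarrow> bool" where
  "chain_with_sticks M ini K c T X \<longleftrightarrow>
     prob_space M \<and>
     (\<forall>j. T j \<in> measurable M (count_space UNIV)) \<and>
     (\<forall>j. X j \<in> borel_measurable M) \<and>
     (\<forall>n\<ge>1. \<forall>x :: nat \<Rightarrow> 'a. \<forall>B :: nat \<Rightarrow> real set. (\<forall>k. B k \<in> sets borel) \<longrightarrow>
        measure M {\<omega>\<in>space M. \<forall>k\<in>{1..n}. T k \<omega> = x k \<and> X k \<omega> \<in> B k}
        = ini (x 1) * (\<Prod>k\<in>{1..<n}. K k (x k) (x (k + 1)))
            * (\<Prod>k\<in>{1..n}. measure (beta1 (c (x k))) (B k)))"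

definition markov_chain ::
  "'m measure \<Rightarrow> ('a \<Rightarrow> real) \<Rightarrow> (nat \<Rightarrow> 'a \<Rightarrow> 'a \<Rightarrow> real) \<Rightarrow> (nat \<Rightarrow> 'm \<Rightarrow> 'a) \<Rightarrow> bool" where
  "markov_chain M ini K T \<longleftrightarrow>
     prob_space M \<and>
     (\<forall>j. T j \<in> measurable M (count_space UNIV)) \<and>
     (\<forall>n\<ge>1. \<forall>x :: nat \<Rightarrow> 'a.
        measure M {\<omega>\<in>space M. \<forall>k\<in>{1..n}. T k \<omega> = x k}
        = ini (x 1) * (\<Prod>k\<in>{1..<n}. K k (x k) (x (k + 1))))"

definition atom_vec :: "(nat \<Rightarrow> real) \<Rightarrow> (nat \<Rightarrow> 'a) \<Rightarrow> 'a \<Rightarrow> real" where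
  "atom_vec P Y = (\<lambda>l. infsum (\<lambda>j. P j * of_bool (Y j = l)) {1..})"

definition occupation :: "(nat \<Rightarrow> 'a) \<Rightarrow> nat \<Rightarrow> 'a \<Rightarrow> real" where
  "occupation T n = (\<lambda>l. (1 / real n) * (\<Sum>j\<in>{1..n}. of_bool (T j = l)))"

(* Convergence in distribution of random probability vectors Y n (on M) to Z (on N),
   for the product (coordinatewise) topology on the space of probability vectors:
   expectations of bounded continuous functions on that space converge.  (Test functions
   are taken Borel measurable on the ambient space, which is no restriction since every
   bounded continuous function on prob_vecs extends e.g. by 0.) *)
definition conv_distr ::
  "'m measure \<Rightarrow> (nat \<Rightarrow> 'm \<Rightarrow> ('a \<Rightarrow> real)) \<Rightarrow> 'n measure \<Rightarrow> ('n \<Rightarrow> ('a \<Rightarrow> real)) \<Rightarrow> bool" where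
  "conv_distr M Y N Z \<longleftrightarrow>
     (\<forall>f :: ('a \<Rightarrow> real) \<Rightarrow> real.
        f \<in> borel_measurable borel \<and> continuous_on prob_vecs f \<and> bounded (f ` prob_vecs) \<longrightarrow>
        (\<lambda>n. \<integral>\<omega>. f (Y n \<omega>) \<partial>M) \<longlonglongrightarrow> (\<integral>\<omega>. f (Z \<omega>) \<partial>N))"

end

theory Submission
  imports Defs
begin

text \<open>
  Everything is reduced to moments. Let \<open>h\<close> take values in \<open>[0, 1]\<close> and let \<open>m k y\<close> be the bounded
  solution of \<open>k m k = k h (m (k - 1)) + G' (m k)\<close> with \<open>m 0 = 1\<close>; it exists because
  \<open>G' = \<theta> (Q' - I)\<close>. As also \<open>G' y z = c y (K\<^bsub>G'\<^esub> - I) y z\<close> with \<open>c y = - G' y y\<close>, integrating by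
  parts against the Beta(\<open>1, c\<close>) density shows, for both stick-breaking chains at once, that the \<open>k\<close>-th
  conditional moment of \<open>\<Sum>\<^sub>l h l * \<nu> l\<close> given the first \<open>n\<close> sticks is a martingale built from \<open>m\<close>, so
  that its \<open>k\<close>-th moment is \<open>\<mu> (m k)\<close>.

  For the inhomogeneous chain, the functional \<open>f \<mapsto> E ((\<Sum>\<^sub>l h l * \<nu>\<^sub>n l)\<^sup>k f (T n))\<close> satisfies a recursion
  whose fixed point, by duality between \<open>G\<close> and \<open>G'\<close> with respect to \<open>\<mu>\<close>, is \<open>f \<mapsto> \<mu> (m k * f)\<close>. The
  recursion contracts with rate \<open>k / n\<close>, which has a divergent sum; for \<open>k = 0\<close> there is no
  contraction, and convergence comes from \<open>\<pi>\<^sup>t Q\<^sup>n \<rightarrow> \<mu>\<^sup>t\<close> instead.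

  Moments determine the Laplace transforms, and the functions \<open>p \<mapsto> exp (\<Sum>\<^sub>l a l * p l)\<close> span a dense
  algebra on the cube by the Stone-Weierstrass theorem.
\<close>

subsection \<open>Real sequences and powers\<close>

text \<open>Behind the three random vectors stands one object: the integral over s \<ge> 0 of
  exp(-s) h(Y_s), where Y is the continuous-time chain with generator \<open>G'\<close>. Splitting
  off a short initial time interval yields the equation for \<open>m\<close>. Cutting the time axis
  at the jumps of Y gives the MCcGEM sticks: a holding time of rate c leaves the fraction
  exp(-holding time) of the stick, so the piece broken off is Beta(1, c). Cutting it along a Poisson
  clock of rate \<open>\<theta>\<close> that runs through all jumps gives the GEM sticks with
  \<open>Q'\<close>. On a logarithmic time scale, the occupation measure seen backwards from its
  last state is the same integral, hence the reversed generator and the test function of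
  \<open>T n\<close>.

  Two obstacles shape the rest. Ergodicity is given entrywise, but the recursions need errors
  uniform over test functions, so it is first upgraded to total variation. And probability vectors
  are not compact if the state space is infinite: Stone-Weierstrass is applied on the cube, and the
  way back relies on the limit being a probability vector almost surely.\<close>

lemma eventually_le_of_averaging_recursion:
  fixes x y p :: "nat \<Rightarrow> real"
  assumes step: "\<forall>\<^sub>F n in sequentially. x (Suc n) \<le> (1 - p n) * x n + p n * y n"
    and p: "\<forall>\<^sub>F n in sequentially. 0 \<le> p n \<and> p n \<le> 1"
    and div: "\<not> summable p"
    and y: "\<forall>\<^sub>F n in sequentially. y n \<le> b" and "e > 0"
  shows "\<forall>\<^sub>F n in sequentially. x n \<le> b + e"
proof -
  obtain N where N: "\<And>n. n \<ge> N \<Longrightarrow> x (Suc n) \<le> (1 - p n) * x n + p n * y n"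
      "\<And>n. n \<ge> N \<Longrightarrow> 0 \<le> p n" "\<And>n. n \<ge> N \<Longrightarrow> p n \<le> 1" "\<And>n. n \<ge> N \<Longrightarrow> y n \<le> b"
    using eventually_conj[OF step eventually_conj[OF p y]] unfolding eventually_sequentially by blast
  \<comment> \<open>\<open>z\<close> is the positive part of the excess over \<open>b\<close>.
    Truncation at 0 makes it nonnegative, so that \<open>1 - p \<le> exp (- p)\<close> may be
    multiplied into the recursion; the divergent sum of \<open>p\<close> then drives
    \<open>z\<close> to 0.\<close>
  define z where "z n = max 0 (x (n + N) - b)" for n
  have z_step: "z (Suc n) \<le> (1 - p (n + N)) * z n" for n
  proof -
    have "x (Suc n + N) - b \<le> (1 - p (n + N)) * (x (n + N) - b)"
      using N(1)[of "n + N"] mult_left_mono[OF N(4) N(2), of "n + N" "n + N"] by (simp add: algebra_simps)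
    also have "\<dots> \<le> (1 - p (n + N)) * z n"
      unfolding z_def using N(3)[of "n + N"] by (intro mult_left_mono) auto
    finally have "x (Suc n + N) - b \<le> (1 - p (n + N)) * z n" .
    moreover have "0 \<le> (1 - p (n + N)) * z n"
      unfolding z_def using N(3)[of "n + N"] by (intro mult_nonneg_nonneg) auto
    ultimately show ?thesis unfolding z_def[of "Suc n"] by simp
  qed
  have z_bound: "z n \<le> z 0 * exp (- (\<Sum>i<n. p (i + N)))" for n
  proof (induction n)
    case (Suc n)
    have "z (Suc n) \<le> (1 - p (n + N)) * z n" by (rule z_step)
    also have "\<dots> \<le> exp (- p (n + N)) * z n"
      using exp_ge_add_one_self[of "- p (n + N)"] by (intro mult_right_mono) (auto simp: z_def)
    also have "\<dots> \<le> exp (- p (n + N)) * (z 0 * exp (- (\<Sum>i<n. p (i + N))))"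
      using Suc by (intro mult_left_mono) auto
    finally show ?case by (simp add: exp_add[symmetric] exp_minus field_simps exp_diff)
  qed simp
  have "filterlim (\<lambda>n. \<Sum>i<n. p (i + N)) at_top sequentially"
  proof -
    have nn: "\<And>i. 0 \<le> p (i + N)" using N(2) by simp
    have inc: "incseq (\<lambda>n. \<Sum>i<n. p (i + N))" by (rule incseq_SucI) (simp add: nn)
    have "\<exists>n. B \<le> (\<Sum>i<n. p (i + N))" for B
    proof (rule ccontr)
      assume "\<nexists>n. B \<le> (\<Sum>i<n. p (i + N))"
      then have "summable (\<lambda>i. p (i + N))"
        using nn by (intro summableI_nonneg_bounded[where x=B]) (auto simp: not_le less_imp_le)
      then show False using div by (simp add: summable_iff_shift)
    qed
    then have "\<forall>\<^sub>F n in sequentially. B \<le> (\<Sum>i<n. p (i + N))" for B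
    proof -
      obtain n0 where "B \<le> (\<Sum>i<n0. p (i + N))" using \<open>\<And>B. \<exists>n. B \<le> (\<Sum>i<n. p (i + N))\<close> by blast
      then show ?thesis using incseqD[OF inc, of n0] order_trans by (intro eventually_sequentiallyI[of n0]) fast
    qed
    then show ?thesis unfolding filterlim_at_top by blast
  qed
  then have "(\<lambda>n. z 0 * exp (- (\<Sum>i<n. p (i + N)))) \<longlonglongrightarrow> z 0 * 0"
    by (intro tendsto_mult tendsto_const filterlim_compose[OF exp_at_bot] filterlim_uminus_at_bot_at_top filterlim_compose[OF filterlim_uminus_at_bot_at_top])
  then have "\<forall>\<^sub>F n in sequentially. z 0 * exp (- (\<Sum>i<n. p (i + N))) < e"
    using \<open>e > 0\<close> by (auto dest: order_tendstoD(2))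
  then have "\<forall>\<^sub>F n in sequentially. x (n + N) \<le> b + e"
  proof eventually_elim
    case (elim n)
    then have "z n \<le> e" using z_bound[of n] by linarith
    then show ?case by (simp add: z_def)
  qed
  then show ?thesis using eventually_sequentially_seg[of "\<lambda>n. x n \<le> b + e" N] by blast
qed

text \<open>Taylor expansion with an explicit quadratic remainder, obtained by multiplying the
  remainder of the previous power by \<open>u + d\<close>. With \<open>d\<close> of size 1/n the
  remainder is of size 1/n^2, negligible in a recursion of rate 1/n.\<close>

lemma power_add_first_order:
  fixes u d :: real
  assumes "\<bar>u\<bar> \<le> 1" "\<bar>u + d\<bar> \<le> 1"
  shows "\<bar>(u + d) ^ Suc k - u ^ Suc k - (1 + real k) * u ^ k * d\<bar> \<le> (1 + real k)\<^sup>2 * d\<^sup>2"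
proof (induction k)
  case (Suc k)
  let ?r = "(u + d) ^ Suc k - u ^ Suc k - (1 + real k) * u ^ k * d"
  have eq: "(u + d) ^ Suc (Suc k) - u ^ Suc (Suc k) - (1 + real (Suc k)) * u ^ Suc k * d
      = (u + d) * ?r + (1 + real k) * u ^ k * d\<^sup>2"
    by (simp add: algebra_simps power2_eq_square)
  have "\<bar>(u + d) * ?r\<bar> \<le> 1 * ((1 + real k)\<^sup>2 * d\<^sup>2)"
    unfolding abs_mult using assms Suc by (intro mult_mono) auto
  moreover have "\<bar>(1 + real k) * u ^ k * d\<^sup>2\<bar> \<le> (1 + real k) * 1 * d\<^sup>2"
    unfolding abs_mult using assms by (intro mult_mono) (auto simp: power_abs intro: power_le_one)
  ultimately have "\<bar>(u + d) * ?r + (1 + real k) * u ^ k * d\<^sup>2\<bar> \<le> (1 + real k)\<^sup>2 * d\<^sup>2 + (1 + real k) * d\<^sup>2"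
    by linarith
  also have "\<dots> = ((1 + real k)\<^sup>2 + (1 + real k)) * d\<^sup>2" by (simp add: algebra_simps)
  also have "\<dots> \<le> (1 + real (Suc k))\<^sup>2 * d\<^sup>2"
    by (intro mult_right_mono) (auto simp: power2_eq_square algebra_simps)
  finally show ?case unfolding eq .
qed simp

lemma not_summable_const_div_Suc:
  assumes "c \<noteq> (0::real)" shows "\<not> summable (\<lambda>n. c / real (Suc n))"
proof
  assume "summable (\<lambda>n. c / real (Suc n))"
  then have "summable (\<lambda>n. inverse c * (c / real (Suc n)))" by (rule summable_mult)
  then have "summable (\<lambda>n. inverse (real (Suc n)))" using assms by (simp add: field_simps)
  then show False using not_summable_harmonic[where 'a=real] summable_Suc_iff[of "\<lambda>n. inverse (real n)"] by blast
qed

subsection \<open>Kernels\<close>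

text \<open>The kernel as an operator on functions; the dual action on laws is
  \<open>bind_pmf\<close>.\<close>

definition kexp :: "('a \<Rightarrow> 'a pmf) \<Rightarrow> ('a \<Rightarrow> real) \<Rightarrow> 'a \<Rightarrow> real" where
  "kexp \<kappa> f y = measure_pmf.expectation (\<kappa> y) f"

lemma integrable_pmf_bounded:
  fixes f :: "'a \<Rightarrow> real"
  assumes "\<And>x. \<bar>f x\<bar> \<le> B" shows "integrable (measure_pmf p) f"
  using assms by (intro measure_pmf.integrable_const_bound[where B=B]) auto

lemma integrable_pmf_01:
  fixes f :: "'a \<Rightarrow> real"
  assumes "\<And>x. f x \<in> {0..1}" shows "integrable (measure_pmf p) f"
  using assms by (intro integrable_pmf_bounded[where B=1]) (auto simp: abs_le_iff intro: order_trans[of _ 0])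

lemma expectation_pmf_01:
  assumes "\<And>x. f x \<in> {0..1::real}" shows "measure_pmf.expectation p f \<in> {0..1}"
proof -
  have "measure_pmf.expectation p f \<le> measure_pmf.expectation p (\<lambda>_. 1)"
    using assms by (intro integral_mono integrable_pmf_01) auto
  then show ?thesis using assms by (auto intro!: integral_nonneg)
qed

lemma kexp_01: "(\<And>x. f x \<in> {0..1::real}) \<Longrightarrow> kexp \<kappa> f y \<in> {0..1}"
  unfolding kexp_def by (rule expectation_pmf_01)

lemma expectation_pmf_count_space:
  "measure_pmf.expectation p f = (\<integral>x. pmf p x * f x \<partial>count_space UNIV)" for f :: "'a \<Rightarrow> real"
  unfolding measure_pmf_eq_density by (subst integral_density) simp_all

lemma expectation_pmf_mixture:
  fixes f :: "'a \<Rightarrow> real"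
  assumes pmf: "\<And>z. pmf p z = (1 - t) * pmf q z + t * pmf r z" and f: "\<And>x. \<bar>f x\<bar> \<le> B"
  shows "measure_pmf.expectation p f = (1 - t) * measure_pmf.expectation q f + t * measure_pmf.expectation r f"
proof -
  have i: "integrable (count_space UNIV) (\<lambda>x. pmf s x * f x)" for s :: "'a pmf"
    using integrable_pmf_bounded[OF f, of s] unfolding measure_pmf_eq_density
    by (subst (asm) integrable_density) simp_all
  have "measure_pmf.expectation p f = (\<integral>x. (1 - t) * (pmf q x * f x) + t * (pmf r x * f x) \<partial>count_space UNIV)"
    unfolding expectation_pmf_count_space pmf by (simp add: algebra_simps)
  also have "\<dots> = (1 - t) * measure_pmf.expectation q f + t * measure_pmf.expectation r f"
    unfolding expectation_pmf_count_space using i by simp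
  finally show ?thesis .
qed

lemma expectation_bind_pmf:
  fixes f :: "'b \<Rightarrow> real"
  assumes f: "\<And>x. \<bar>f x\<bar> \<le> B"
  shows "measure_pmf.expectation (bind_pmf p \<kappa>) f = measure_pmf.expectation p (\<lambda>y. measure_pmf.expectation (\<kappa> y) f)"
  unfolding measure_pmf_bind
  by (rule integral_bind[where K="count_space UNIV" and B=B and B'=1])
     (use f in \<open>auto simp: measure_pmf_in_subprob_algebra measure_pmf.emeasure_space_1 intro: measure_pmf.finite_measure\<close>)

lemma prob_vec_pmf: "prob_vec (pmf p)"
proof -
  have "(pmf p) summable_on UNIV"
    using pmf_abs_summable[of p UNIV] abs_summable_equivalent[of "pmf p" UNIV] by simp
  moreover have "infsum (pmf p) UNIV = 1"
    using infsetsum_pmf_eq_1[of p UNIV] infsetsum_infsum[OF pmf_abs_summable, of p UNIV] by simp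
  ultimately show ?thesis by (auto simp: prob_vec_def has_sum_iff)
qed

lemma prob_vec_obtain_pmf:
  assumes "prob_vec p" obtains q where "pmf q = p"
proof -
  have nn: "\<And>x. 0 \<le> p x" and sum: "(p has_sum 1) UNIV" using assms by (auto simp: prob_vec_def)
  have "p summable_on UNIV" using sum by (auto simp: summable_on_def)
  then have as: "Infinite_Set_Sum.abs_summable_on p UNIV"
    unfolding abs_summable_equivalent[symmetric] using nn by simp
  have "(\<integral>\<^sup>+x. ennreal (p x) \<partial>count_space UNIV) = ennreal (infsetsum p UNIV)"
    using as nn by (intro nn_integral_conv_infsetsum) auto
  also have "\<dots> = 1" using infsetsum_infsum[OF as] sum by (simp add: infsumI)
  finally have "pmf (embed_pmf p) = p" using nn by (intro ext pmf_embed_pmf) auto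
  then show ?thesis by (rule that)
qed

subsection \<open>Beta sticks\<close>

text \<open>A Stein-type identity for Beta(1, c): the relation between \<open>g\<close> and
  \<open>p\<close> says that \<open>- ((1 - x) powr c * p x)\<close> is an antiderivative of the
  density times \<open>g\<close>. It vanishes at 1, so the integral is read off at 0.\<close>

lemma nn_integral_beta1:
  assumes c: "0 \<le> c"
    and p: "\<And>x. x \<in> {0..1} \<Longrightarrow> (p has_real_derivative p' x) (at x)"
    and g: "\<And>x. x \<in> {0..1} \<Longrightarrow> c * g x = c * p x - (1 - x) * p' x"
    and nn: "\<And>x. x \<in> {0..1} \<Longrightarrow> 0 \<le> g x"
    and [measurable]: "g \<in> borel_measurable borel"
    and g1: "g 1 = p 1"
  shows "(\<integral>\<^sup>+x. ennreal (g x) \<partial>beta1 c) = ennreal (p 0)"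
proof (cases "c = 0")
  case True
  \<comment> \<open>For \<open>c = 0\<close> the relation reduces to
    \<open>(1 - x) * p' x = 0\<close>, so \<open>p\<close> is constant on the unit interval. The law
    is the point mass at 1, where only \<open>g1\<close> ties \<open>g\<close> to
    \<open>p\<close>.\<close>
  have "p 1 = p 0"
  proof (rule DERIV_isconst_end[of 0 1 p])
    show "continuous_on {0..1} p" using p by (intro DERIV_continuous_on[of _ p p'] DERIV_subset[OF p]) auto
    show "(p has_real_derivative 0) (at x)" if "0 < x" "x < 1" for x
      using p[of x] g[of x] that True by auto
  qed simp
  then show ?thesis using True g1 by (simp add: beta1_def nn_integral_return)
next
  case False
  then have c: "0 < c" using c by simp
  define f where "f x = - ((1 - x) powr c * p x)" for x
  define f' where "f' x = c * (1 - x) powr (c - 1) * g x" for x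
  have cont: "continuous_on {0..1} p" using p by (intro DERIV_continuous_on[of _ p p'] DERIV_subset[OF p]) auto
  have "(f' has_integral (f 1 - f 0)) {0..1}"
  \<comment> \<open>Differentiability is available in the interior only: for \<open>c < 1\<close>
    the derivative of \<open>(1 - x) powr c\<close> blows up at 1.\<close>
  proof (rule fundamental_theorem_of_calculus_interior)
    show "continuous_on {0..1} f"
      unfolding f_def using cont c by (intro continuous_intros continuous_on_powr') auto
    fix x :: real assume "x \<in> {0<..<1}"
    then have x: "x < 1" "x \<in> {0..1}" by auto
    have e: "(1 - x) powr c = (1 - x) * (1 - x) powr (c - 1)"
      using x by (simp add: powr_diff)
    have "((\<lambda>x. 1 - x) has_real_derivative - 1) (at x)" by (auto intro!: derivative_eq_intros)
    then have "((\<lambda>x. (1 - x) powr c) has_real_derivative c * (1 - x) powr (c - 1) * - 1) (at x)"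
      using DERIV_fun_powr[of "\<lambda>x. 1 - x" "- 1" x c] x by simp
    then have "(f has_real_derivative - (- (c * (1 - x) powr (c - 1)) * p x + p' x * (1 - x) powr c)) (at x)"
      unfolding f_def using DERIV_minus[OF DERIV_mult[OF _ p[OF x(2)]]] by fastforce
    also have "- (- (c * (1 - x) powr (c - 1)) * p x + p' x * (1 - x) powr c)
        = (1 - x) powr (c - 1) * (c * p x - (1 - x) * p' x)" unfolding e by (simp add: algebra_simps)
    also have "\<dots> = f' x" using g[OF x(2)] by (simp add: f'_def)
    finally show "(f has_vector_derivative f' x) (at x)"
      by (simp add: has_real_derivative_iff_has_vector_derivative)
  qed simp
  then have "(f' has_integral p 0) {0<..<1}"
    using c by (simp add: f_def has_integral_Icc_iff_Ioo)
  moreover have "\<And>x. x \<in> {0<..<1} \<Longrightarrow> 0 \<le> f' x" using nn c by (simp add: f'_def)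
  ultimately have "(\<integral>\<^sup>+x. ennreal (indicator {0<..<1} x * f' x) \<partial>lborel) = ennreal (p 0)"
    using nn_integral_has_integral_lebesgue[of "{0<..<1}" f' "p 0"] by simp
  moreover have "(\<integral>\<^sup>+x. ennreal (g x) \<partial>beta1 c) = (\<integral>\<^sup>+x. ennreal (indicator {0<..<1} x * f' x) \<partial>lborel)"
    unfolding beta1_def using False c
    by (simp, subst nn_integral_density)
      (auto intro!: nn_integral_cong simp: f'_def ennreal_mult'[symmetric] indicator_def ennreal_mult[symmetric] nn)
  ultimately show ?thesis by simp
qed

lemma sets_beta1 [measurable_cong, simp]: "sets (beta1 c) = sets borel"
  by (simp add: beta1_def)

lemma space_beta1 [simp]: "space (beta1 c) = UNIV"
  using sets_eq_imp_space_eq[OF sets_beta1] by simp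

lemma prob_space_beta1: "0 \<le> c \<Longrightarrow> prob_space (beta1 c)"
  using nn_integral_beta1[of c "\<lambda>_. 1" "\<lambda>_. 0" "\<lambda>_. 1"]
  by (intro prob_spaceI) simp

lemma AE_beta1: "AE x in beta1 c. x \<in> {0..1}"
proof (cases "c = 0")
  case False
  then have "beta1 c = density lborel (\<lambda>x. ennreal (indicator {0<..<1} x * c * (1 - x) powr (c - 1)))"
    by (simp add: beta1_def)
  then show ?thesis
    by (simp only:, subst AE_density) (auto split: split_indicator_asm)
next
  case True
  then have "beta1 c = return borel 1" by (simp add: beta1_def)
  then show ?thesis by (simp only:, subst AE_return) auto
qed

lemma nn_integral_beta1_one_minus:
  assumes "0 \<le> c" shows "(\<integral>\<^sup>+x. ennreal (1 - x) \<partial>beta1 c) = ennreal (c / (1 + c))"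
proof -
  \<comment> \<open>\<open>r\<close> solves \<open>c = r + c * r\<close>, the condition under which
    \<open>p x = r * (1 - x)\<close> fits \<open>nn_integral_beta1\<close>.\<close>
  define r where "r = c / (1 + c)"
  have "(1 + c) * r = c" using assms by (simp add: r_def)
  then have r: "c = r + c * r" by (simp add: algebra_simps)
  have "(\<integral>\<^sup>+x. ennreal (1 - x) \<partial>beta1 c) = ennreal (r * (1 - 0))"
  proof (rule nn_integral_beta1[where p' = "\<lambda>_. - r"])
    show "((\<lambda>x. r * (1 - x)) has_real_derivative - r) (at x)" for x
      by (auto intro!: derivative_eq_intros)
    show "c * (1 - x) = c * (r * (1 - x)) - (1 - x) * - r" for x
      by (subst (1) r) (simp add: algebra_simps)
  qed (use assms in auto)
  then show ?thesis by (simp add: r_def)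
qed

lemma emeasure_density_cmult_indicator:
  assumes [measurable]: "A \<in> sets M" "B \<in> sets M"
  shows "emeasure (density M (\<lambda>\<omega>. p * indicator A \<omega>)) B = p * emeasure M (A \<inter> B)"
proof -
  have "emeasure (density M (\<lambda>\<omega>. p * indicator A \<omega>)) B = (\<integral>\<^sup>+\<omega>. p * indicator (A \<inter> B) \<omega> \<partial>M)"
    by (subst emeasure_density) (auto intro!: nn_integral_cong split: split_indicator)
  then show ?thesis by (simp add: nn_integral_cmult_indicator)
qed

subsection \<open>The Markov property\<close>

text \<open>All three chains are instances: time-dependent kernels for the occupation problem,
  state-dependent stick parameters for MCcGEM, and a constant parameter for GEM, which makes the
  sticks independent of the chain. \<open>c_nonneg\<close> makes every \<open>beta1 (c y)\<close> a
  probability law.\<close>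

locale stick_chain = prob_space M for M :: "'m measure" +
  fixes ini :: "'a::countable pmf" and \<kappa> :: "nat \<Rightarrow> 'a \<Rightarrow> 'a pmf" and c :: "'a \<Rightarrow> real"
    and T :: "nat \<Rightarrow> 'm \<Rightarrow> 'a" and X :: "nat \<Rightarrow> 'm \<Rightarrow> real"
  assumes chain: "chain_with_sticks M (pmf ini) (\<lambda>n y z. pmf (\<kappa> n y) z) c T X"
    and c_nonneg: "0 \<le> c y"
begin

lemma measurable_T [measurable]: "T j \<in> measurable M (count_space UNIV)"
  and measurable_X [measurable]: "X j \<in> borel_measurable M"
  using chain by (auto simp: chain_with_sticks_def)

definition cylinder :: "nat \<Rightarrow> (nat \<Rightarrow> 'a) \<Rightarrow> (nat \<Rightarrow> real set) \<Rightarrow> 'm set" where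
  "cylinder n x B = {\<omega>\<in>space M. \<forall>k\<in>{1..n}. T k \<omega> = x k \<and> X k \<omega> \<in> B k}"

definition cylinders :: "nat \<Rightarrow> 'm set set" where
  "cylinders n = {cylinder n x B | x B. \<forall>k. B k \<in> sets borel}"

text \<open>The natural filtration, generated by exactly those events whose probabilities the chain
  axiom prescribes, so that identities extend from cylinders by a pi-system argument. States and
  sticks of index 0 are never constrained.\<close>

definition past :: "nat \<Rightarrow> 'm measure" where
  "past n = sigma (space M) (cylinders n)"

lemma cylinder_sets [measurable]:
  assumes [measurable]: "\<And>k. B k \<in> sets borel" shows "cylinder n x B \<in> sets M"
  unfolding cylinder_def by measurable

lemma cylinders_subset: "cylinders n \<subseteq> Pow (space M)"
  by (auto simp: cylinders_def cylinder_def)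

lemma space_past [simp]: "space (past n) = space M"
  and sets_past: "sets (past n) = sigma_sets (space M) (cylinders n)"
  using cylinders_subset[of n] by (simp_all add: past_def)

lemma sets_past_subset: "A \<in> sets (past n) \<Longrightarrow> A \<in> sets M"
proof -
  have "sigma_sets (space M) (cylinders n) \<subseteq> sets M"
    by (rule sets.sigma_sets_subset) (auto simp: cylinders_def)
  then show "A \<in> sets (past n) \<Longrightarrow> A \<in> sets M" unfolding sets_past by blast
qed

lemma measurable_past: "f \<in> measurable (past n) N \<Longrightarrow> f \<in> measurable M N"
  by (auto simp: measurable_def sets_past_subset)

lemma emeasure_cylinder:
  assumes "1 \<le> n" "\<And>k. B k \<in> sets borel"
  shows "emeasure M (cylinder n x B) = ennreal (pmf ini (x 1) * (\<Prod>k\<in>{1..<n}. pmf (\<kappa> k (x k)) (x (k + 1)))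
            * (\<Prod>k\<in>{1..n}. measure (beta1 (c (x k))) (B k)))"
  using chain assms unfolding chain_with_sticks_def cylinder_def
  by (simp add: emeasure_eq_measure)

text \<open>Paths are extensional on \<open>{1..n}\<close>: there are only countably many of them,
  and different paths have disjoint cylinders.\<close>

abbreviation paths :: "nat \<Rightarrow> (nat \<Rightarrow> 'a) set" where
  "paths n \<equiv> PiE {1..n} (\<lambda>_. UNIV)"

lemma countable_paths: "countable (paths n)"
  by (intro countable_PiE) auto

lemma cylinder_in_cylinders: "(\<And>k. B k \<in> sets borel) \<Longrightarrow> cylinder n x B \<in> cylinders n"
  by (auto simp: cylinders_def)

lemma cylinder_in_past: "(\<And>k. B k \<in> sets borel) \<Longrightarrow> cylinder n x B \<in> sets (past n)"
  unfolding sets_past by (intro sigma_sets.Basic cylinder_in_cylinders)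

text \<open>Cylinders over paths that differ on \<open>{1..n}\<close> are disjoint, and for
  \<open>1 \<le> n\<close> the empty set is again a cylinder, with all \<open>B k\<close>
  empty.\<close>

lemma Int_stable_cylinders:
  assumes n: "1 \<le> n" shows "Int_stable (cylinders n)"
proof (rule Int_stableI)
  fix A A' assume "A \<in> cylinders n" "A' \<in> cylinders n"
  then obtain x B x' B' where A: "A = cylinder n x B" "A' = cylinder n x' B'"
    and B: "\<And>k. B k \<in> sets borel" "\<And>k. B' k \<in> sets borel" by (auto simp: cylinders_def)
  show "A \<inter> A' \<in> cylinders n"
  proof (cases "\<forall>k\<in>{1..n}. x k = x' k")
    case True
    then have "A \<inter> A' = cylinder n x (\<lambda>k. B k \<inter> B' k)"
      by (auto simp: cylinder_def A)
    then show ?thesis using B by (simp add: cylinder_in_cylinders)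
  next
    case False
    then have "A \<inter> A' = cylinder n x (\<lambda>_. {})"
      using n by (auto simp: cylinder_def A)
    then show ?thesis by (simp add: cylinder_in_cylinders)
  qed
qed

lemma measurable_past_T:
  assumes "k \<in> {1..n}" shows "T k \<in> measurable (past n) (count_space UNIV)"
proof (rule measurable_count_space_eq_countable[THEN iffD2, OF _ conjI])
  show "\<forall>a\<in>UNIV. T k -` {a} \<inter> space (past n) \<in> sets (past n)"
  proof
    fix y :: 'a
    have "T k -` {y} \<inter> space (past n) = (\<Union>x\<in>{x\<in>paths n. x k = y}. cylinder n x (\<lambda>_. UNIV))"
    proof (intro equalityI subsetI)
      fix \<omega> assume \<omega>: "\<omega> \<in> T k -` {y} \<inter> space (past n)"
      show "\<omega> \<in> (\<Union>x\<in>{x\<in>paths n. x k = y}. cylinder n x (\<lambda>_. UNIV))"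
        using \<omega> assms by (intro UN_I[of "\<lambda>i\<in>{1..n}. T i \<omega>"]) (auto simp: cylinder_def)
    qed (use assms in \<open>auto simp: cylinder_def\<close>)
    also have "\<dots> \<in> sets (past n)"
      by (intro sets.countable_UN'' countable_Collect countable_paths cylinder_in_past) auto
    finally show "T k -` {y} \<inter> space (past n) \<in> sets (past n)" .
  qed
qed auto

lemma measurable_past_X:
  assumes "k \<in> {1..n}" shows "X k \<in> borel_measurable (past n)"
proof (rule measurableI)
  fix A :: "real set" assume A: "A \<in> sets borel"
  have "X k -` A \<inter> space (past n) = (\<Union>x\<in>paths n. cylinder n x (\<lambda>i. if i = k then A else UNIV))"
  proof (intro equalityI subsetI)
    fix \<omega> assume \<omega>: "\<omega> \<in> X k -` A \<inter> space (past n)"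
    show "\<omega> \<in> (\<Union>x\<in>paths n. cylinder n x (\<lambda>i. if i = k then A else UNIV))"
      using \<omega> assms by (intro UN_I[of "\<lambda>i\<in>{1..n}. T i \<omega>"]) (auto simp: cylinder_def)
  qed (use assms in \<open>auto simp: cylinder_def dest: bspec[of _ _ k]\<close>)
  also have "\<dots> \<in> sets (past n)"
    by (intro sets.countable_UN'' countable_paths cylinder_in_past) (use A in auto)
  finally show "X k -` A \<inter> space (past n) \<in> sets (past n)" .
qed simp

definition transition :: "nat \<Rightarrow> 'a \<Rightarrow> 'a \<Rightarrow> real set \<Rightarrow> 'm set" where
  "transition n y z B = {\<omega>\<in>space M. T n \<omega> = y \<and> T (Suc n) \<omega> = z \<and> X (Suc n) \<omega> \<in> B}"

lemma transition_sets [measurable]: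
  assumes [measurable]: "B \<in> sets borel" shows "transition n y z B \<in> sets M"
  unfolding transition_def by measurable

lemma emeasure_transition_cylinder:
  assumes n: "1 \<le> n" and B: "B \<in> sets borel" "\<And>k. B' k \<in> sets borel"
  shows "emeasure M (cylinder n x B' \<inter> transition n y z B) =
    ennreal (pmf (\<kappa> n y) z * measure (beta1 (c z)) B) * emeasure M (cylinder n x B' \<inter> {\<omega>\<in>space M. T n \<omega> = y})"
proof (cases "x n = y")
  case True
  have "cylinder n x B' \<inter> transition n y z B = cylinder (Suc n) (x(Suc n := z)) (B'(Suc n := B))"
    using True n by (auto simp: cylinder_def transition_def atLeastAtMostSuc_conv)
  moreover have "cylinder n x B' \<inter> {\<omega>\<in>space M. T n \<omega> = y} = cylinder n x B'"
    using True n by (auto simp: cylinder_def)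
  moreover have "(\<Prod>k\<in>{1..<Suc n}. pmf (\<kappa> k ((x(Suc n := z)) k)) ((x(Suc n := z)) (k + 1)))
      = (\<Prod>k\<in>{1..<n}. pmf (\<kappa> k (x k)) (x (k + 1))) * pmf (\<kappa> n y) z"
    using n True by (simp add: atLeastLessThanSuc)
  moreover have "(\<Prod>k\<in>{1..Suc n}. measure (beta1 (c ((x(Suc n := z)) k))) ((B'(Suc n := B)) k))
      = (\<Prod>k\<in>{1..n}. measure (beta1 (c (x k))) (B' k)) * measure (beta1 (c z)) B"
    by (simp add: atLeastAtMostSuc_conv)
  ultimately show ?thesis
    using n B by (simp add: emeasure_cylinder ennreal_mult[symmetric] prod_nonneg algebra_simps)
next
  case False
  then have "cylinder n x B' \<inter> transition n y z B = {}" "cylinder n x B' \<inter> {\<omega>\<in>space M. T n \<omega> = y} = {}"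
    using n by (auto simp: cylinder_def transition_def)
  then show ?thesis by simp
qed

text \<open>The Markov property as an identity between finite measures in \<open>E\<close>: they
  agree on the generating cylinders, hence on the whole past. Multiplying out instead of
  conditioning avoids a division by the probability of \<open>T n = y\<close>, which may
  vanish.\<close>

lemma emeasure_transition_past:
  assumes n: "1 \<le> n" and B[measurable]: "B \<in> sets borel" and E: "E \<in> sets (past n)"
  shows "emeasure M (E \<inter> transition n y z B) =
    ennreal (pmf (\<kappa> n y) z * measure (beta1 (c z)) B) * emeasure M (E \<inter> {\<omega>\<in>space M. T n \<omega> = y})"
    (is "?l E = ?C * ?r E")
proof -
  \<comment> \<open>Countable additivity in indexed form. It serves the union step of the induction
    and also \<open>space M\<close>, which in general is not a cylinder but a countable disjoint
    union of cylinders.\<close>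
  have countable_union: "?l (\<Union>i\<in>I. A i) = ?C * ?r (\<Union>i\<in>I. A i)"
    if "countable I" "disjoint_family_on A I" "\<And>i. i \<in> I \<Longrightarrow> A i \<in> sets M" "\<And>i. i \<in> I \<Longrightarrow> ?l (A i) = ?C * ?r (A i)"
    for I :: "'i set" and A
  proof -
    have "?l (\<Union>i\<in>I. A i) = emeasure M (\<Union>i\<in>I. A i \<inter> transition n y z B)"
      by (simp add: Int_UN_distrib2)
    also have "\<dots> = (\<integral>\<^sup>+i. ?l (A i) \<partial>count_space I)"
      using that by (intro emeasure_UN_countable) (auto simp: disjoint_family_on_def)
    also have "\<dots> = (\<integral>\<^sup>+i. ?C * ?r (A i) \<partial>count_space I)"
      using that by (intro nn_integral_cong) auto
    also have "\<dots> = ?C * (\<integral>\<^sup>+i. ?r (A i) \<partial>count_space I)" by (rule nn_integral_cmult) simp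
    also have "(\<integral>\<^sup>+i. ?r (A i) \<partial>count_space I) = emeasure M (\<Union>i\<in>I. A i \<inter> {\<omega>\<in>space M. T n \<omega> = y})"
      using that by (intro emeasure_UN_countable[symmetric]) (auto simp: disjoint_family_on_def)
    also have "\<dots> = ?r (\<Union>i\<in>I. A i)" by (simp add: Int_UN_distrib2)
    finally show ?thesis .
  qed
  have space: "?l (space M) = ?C * ?r (space M)"
  proof -
    have "space M = (\<Union>x\<in>paths n. cylinder n x (\<lambda>_. UNIV))"
    proof (intro equalityI subsetI)
      fix \<omega> assume "\<omega> \<in> space M"
      then show "\<omega> \<in> (\<Union>x\<in>paths n. cylinder n x (\<lambda>_. UNIV))"
        by (intro UN_I[of "\<lambda>i\<in>{1..n}. T i \<omega>"]) (auto simp: cylinder_def)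
    qed (auto simp: cylinder_def)
    moreover have "disjoint_family_on (\<lambda>x. cylinder n x (\<lambda>_. UNIV)) (paths n)"
      unfolding disjoint_family_on_def
    proof (intro ballI impI)
      fix x x' assume "x \<in> paths n" "x' \<in> paths n" "x \<noteq> x'"
      then obtain k where "k \<in> {1..n}" "x k \<noteq> x' k" by (meson PiE_ext)
      then show "cylinder n x (\<lambda>_. UNIV) \<inter> cylinder n x' (\<lambda>_. UNIV) = {}"
        by (auto simp: cylinder_def)
    qed
    ultimately show ?thesis
      using countable_union[OF countable_paths, of "\<lambda>x. cylinder n x (\<lambda>_. UNIV)" n] emeasure_transition_cylinder[OF n B]
      by simp
  qed
  have C: "?C < \<top>" by simp
  from E show ?thesis unfolding sets_past
  proof (induction rule: sigma_sets_induct_disjoint[OF Int_stable_cylinders[OF n] cylinders_subset, consumes 1,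
        case_names basic empty compl union])
    case (basic A)
    then show ?case using emeasure_transition_cylinder[OF n B] by (auto simp: cylinders_def)
  next
    case (compl A)
    then have A: "A \<in> sets M" using sets_past_subset[of A n] by (simp add: sets_past)
    have "?l (space M - A) = ?l (space M) - ?l A"
      using A emeasure_Diff[of M "A \<inter> transition n y z B" "space M \<inter> transition n y z B"]
      by (simp add: Diff_Int_distrib2 Int_mono sets.sets_into_space less_top[symmetric])
    also have "\<dots> = ?C * ?r (space M) - ?C * ?r A" using space compl by simp
    also have "\<dots> = ?C * (?r (space M) - ?r A)"
      by (simp add: ennreal_right_diff_distrib)
    also have "?r (space M) - ?r A = ?r (space M - A)"
      using A emeasure_Diff[of M "A \<inter> {\<omega>\<in>space M. T n \<omega> = y}" "space M \<inter> {\<omega>\<in>space M. T n \<omega> = y}"]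
      by (simp add: Diff_Int_distrib2 Int_mono sets.sets_into_space less_top[symmetric])
    finally show ?case .
  next
    case (union A)
    then have "\<And>i. A i \<in> sets M" using sets_past_subset[of _ n] by (auto simp: sets_past)
    then show ?case using union by (intro countable_union) auto
  qed simp
qed

text \<open>Freezes a countable-valued state: under the inner integral it is a constant
  \<open>z\<close>, so that product-measure arguments can be applied to the rest.\<close>

lemma nn_integral_split_state:
  assumes [measurable]: "S \<in> measurable M (count_space UNIV)" "\<And>z. g z \<in> borel_measurable M"
  shows "(\<integral>\<^sup>+\<omega>. g (S \<omega>) \<omega> \<partial>M) = (\<integral>\<^sup>+z. (\<integral>\<^sup>+\<omega>. indicator {\<omega>\<in>space M. S \<omega> = z} \<omega> * g z \<omega> \<partial>M) \<partial>count_space (UNIV :: 'a set))"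
proof -
  have "(\<integral>\<^sup>+\<omega>. g (S \<omega>) \<omega> \<partial>M) = (\<integral>\<^sup>+\<omega>. \<integral>\<^sup>+z. indicator {\<omega>\<in>space M. S \<omega> = z} \<omega> * g z \<omega> \<partial>count_space UNIV \<partial>M)"
  proof (rule nn_integral_cong)
    fix \<omega> assume "\<omega> \<in> space M"
    then have "(\<integral>\<^sup>+z. indicator {\<omega>\<in>space M. S \<omega> = z} \<omega> * g z \<omega> \<partial>count_space UNIV)
        = (\<integral>\<^sup>+z. g (S \<omega>) \<omega> * indicator {S \<omega>} z \<partial>count_space UNIV)"
      by (intro nn_integral_cong) (auto split: split_indicator)
    then show "g (S \<omega>) \<omega> = (\<integral>\<^sup>+z. indicator {\<omega>\<in>space M. S \<omega> = z} \<omega> * g z \<omega> \<partial>count_space UNIV)"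
      by (simp add: nn_integral_cmult_indicator)
  qed
  also have "\<dots> = (\<integral>\<^sup>+z. (\<integral>\<^sup>+\<omega>. indicator {\<omega>\<in>space M. S \<omega> = z} \<omega> * g z \<omega> \<partial>M) \<partial>count_space UNIV)"
    by (rule nn_integral_count_space_nn_integral) auto
  finally show ?thesis .
qed

lemma nn_integral_init:
  assumes [measurable]: "\<And>z. F z \<in> borel_measurable borel"
  shows "(\<integral>\<^sup>+\<omega>. F (T 1 \<omega>) (X 1 \<omega>) \<partial>M) = (\<integral>\<^sup>+z. (\<integral>\<^sup>+x. F z x \<partial>beta1 (c z)) \<partial>ini)"
proof -
  have *: "(\<integral>\<^sup>+\<omega>. indicator {\<omega>\<in>space M. T 1 \<omega> = z} \<omega> * F z (X 1 \<omega>) \<partial>M) = pmf ini z * (\<integral>\<^sup>+x. F z x \<partial>beta1 (c z))" for z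
  proof -
    interpret B: prob_space "beta1 (c z)" by (intro prob_space_beta1 c_nonneg)
    have "distr (density M (indicator {\<omega>\<in>space M. T 1 \<omega> = z})) borel (X 1) = scale_measure (pmf ini z) (beta1 (c z))"
    proof (rule measure_eqI)
      fix B assume "B \<in> sets (distr (density M (indicator {\<omega>\<in>space M. T 1 \<omega> = z})) borel (X 1))"
      then have B[measurable]: "B \<in> sets borel" by simp
      have "emeasure (distr (density M (indicator {\<omega>\<in>space M. T 1 \<omega> = z})) borel (X 1)) B
          = emeasure M ({\<omega>\<in>space M. T 1 \<omega> = z} \<inter> (X 1 -` B \<inter> space M))"
        by (simp add: emeasure_distr emeasure_restricted)
      also have "{\<omega>\<in>space M. T 1 \<omega> = z} \<inter> (X 1 -` B \<inter> space M) = cylinder 1 (\<lambda>_. z) (\<lambda>_. B)"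
        by (auto simp: cylinder_def)
      also have "emeasure M \<dots> = pmf ini z * emeasure (beta1 (c z)) B"
        by (subst emeasure_cylinder) (auto simp: B.emeasure_eq_measure ennreal_mult)
      finally show "emeasure (distr (density M (indicator {\<omega>\<in>space M. T 1 \<omega> = z})) borel (X 1)) B
          = emeasure (scale_measure (pmf ini z) (beta1 (c z))) B" by simp
    qed simp
    then have "(\<integral>\<^sup>+x. F z x \<partial>distr (density M (indicator {\<omega>\<in>space M. T 1 \<omega> = z})) borel (X 1)) = pmf ini z * (\<integral>\<^sup>+x. F z x \<partial>beta1 (c z))"
      by (simp add: nn_integral_scale_measure)
    then show ?thesis by (simp add: nn_integral_distr nn_integral_density)
  qed
  show ?thesis
    unfolding nn_integral_measure_pmf *[symmetric] by (rule nn_integral_split_state) auto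
qed

text \<open>Integral form of the Markov property for functionals \<open>V\<close> of the past. On
  the event that the present and next states are \<open>y\<close> and \<open>z\<close>, the past and
  the next stick have a product law, so Fubini applies.\<close>

lemma nn_integral_step:
  assumes n: "1 \<le> n" and V: "V \<in> measurable (past n) N"
    and F[measurable]: "\<And>z. (\<lambda>(v, x). F v z x) \<in> borel_measurable (N \<Otimes>\<^sub>M borel)"
  shows "(\<integral>\<^sup>+\<omega>. F (V \<omega>) (T (Suc n) \<omega>) (X (Suc n) \<omega>) \<partial>M)
     = (\<integral>\<^sup>+\<omega>. (\<integral>\<^sup>+z. (\<integral>\<^sup>+x. F (V \<omega>) z x \<partial>beta1 (c z)) \<partial>\<kappa> n (T n \<omega>)) \<partial>M)"
proof -
  have VM[measurable]: "V \<in> measurable M N" using V by (rule measurable_past)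
  have Fz[measurable]: "(\<lambda>v. \<integral>\<^sup>+x. F v z x \<partial>beta1 (c z)) \<in> borel_measurable N" for z
  proof -
    interpret B: prob_space "beta1 (c z)" by (intro prob_space_beta1 c_nonneg)
    show ?thesis by measurable
  qed
  have *: "(\<integral>\<^sup>+\<omega>. indicator {\<omega>\<in>space M. T n \<omega> = y} \<omega> * (indicator {\<omega>\<in>space M. T (Suc n) \<omega> = z} \<omega> * F (V \<omega>) z (X (Suc n) \<omega>)) \<partial>M)
      = (\<integral>\<^sup>+\<omega>. indicator {\<omega>\<in>space M. T n \<omega> = y} \<omega> * (pmf (\<kappa> n y) z * (\<integral>\<^sup>+x. F (V \<omega>) z x \<partial>beta1 (c z))) \<partial>M)" for y z
  proof -
    interpret B: prob_space "beta1 (c z)" by (intro prob_space_beta1 c_nonneg)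
    \<comment> \<open>\<open>E\<close> restricts to the transition from \<open>y\<close> to
      \<open>z\<close>, \<open>D\<close> only to the present state \<open>y\<close> but weighted by
      the transition probability. The weight gives \<open>V\<close> the same marginal under both, so
      the product formula needs no normalization.\<close>
    define D where "D = density M (\<lambda>\<omega>. ennreal (pmf (\<kappa> n y) z) * indicator {\<omega>\<in>space M. T n \<omega> = y} \<omega>)"
    define E where "E = density M (indicator (transition n y z UNIV))"
    have sets[measurable_cong, simp]: "sets D = sets M" "sets E = sets M" by (simp_all add: D_def E_def)
    have "emeasure D (space D) = pmf (\<kappa> n y) z * emeasure M {\<omega>\<in>space M. T n \<omega> = y}"
      unfolding D_def by (subst emeasure_density_cmult_indicator) (auto intro!: arg_cong2[where f="(*)"] arg_cong2[where f=emeasure])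
    also have "\<dots> < \<top>" by (simp add: emeasure_eq_measure ennreal_mult[symmetric])
    finally interpret D: finite_measure D by (intro finite_measureI) (auto simp: less_top)
    interpret DV: finite_measure "distr D N V" by (rule D.finite_measure_distr) measurable
    have eq: "distr D N V \<Otimes>\<^sub>M beta1 (c z) = distr E (N \<Otimes>\<^sub>M borel) (\<lambda>\<omega>. (V \<omega>, X (Suc n) \<omega>))"
    proof (rule pair_measure_eqI)
      fix A B assume "A \<in> sets (distr D N V)" "B \<in> sets (beta1 (c z))"
      then have [measurable]: "A \<in> sets N" "B \<in> sets borel" by auto
      have past: "V -` A \<inter> space M \<in> sets (past n)" using measurable_sets[OF V, of A] by simp
      have "emeasure (distr D N V) A = pmf (\<kappa> n y) z * emeasure M ((V -` A \<inter> space M) \<inter> {\<omega>\<in>space M. T n \<omega> = y})"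
        unfolding D_def by (simp add: emeasure_distr emeasure_density_cmult_indicator Int_commute)
      moreover have "emeasure (distr E (N \<Otimes>\<^sub>M borel) (\<lambda>\<omega>. (V \<omega>, X (Suc n) \<omega>))) (A \<times> B) = emeasure M ((V -` A \<inter> space M) \<inter> transition n y z B)"
      proof -
        have "emeasure (distr E (N \<Otimes>\<^sub>M borel) (\<lambda>\<omega>. (V \<omega>, X (Suc n) \<omega>))) (A \<times> B)
            = emeasure E ((\<lambda>\<omega>. (V \<omega>, X (Suc n) \<omega>)) -` (A \<times> B) \<inter> space M)"
          by (subst emeasure_distr) (auto simp: E_def)
        also have "\<dots> = emeasure M (transition n y z UNIV \<inter> ((\<lambda>\<omega>. (V \<omega>, X (Suc n) \<omega>)) -` (A \<times> B) \<inter> space M))"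
          unfolding E_def by (subst emeasure_restricted) auto
        also have "transition n y z UNIV \<inter> ((\<lambda>\<omega>. (V \<omega>, X (Suc n) \<omega>)) -` (A \<times> B) \<inter> space M) = (V -` A \<inter> space M) \<inter> transition n y z B"
          by (auto simp: transition_def)
        finally show ?thesis .
      qed
      ultimately show "emeasure (distr D N V) A * emeasure (beta1 (c z)) B
          = emeasure (distr E (N \<Otimes>\<^sub>M borel) (\<lambda>\<omega>. (V \<omega>, X (Suc n) \<omega>))) (A \<times> B)"
        using emeasure_transition_past[OF n _ past, of B y z]
        by (simp add: B.emeasure_eq_measure ennreal_mult mult_ac)
    qed (auto intro: DV.sigma_finite_measure_axioms B.sigma_finite_measure_axioms simp: sets_pair_measure_cong[OF refl sets_beta1])
    have "(\<integral>\<^sup>+\<omega>. indicator {\<omega>\<in>space M. T n \<omega> = y} \<omega> * (indicator {\<omega>\<in>space M. T (Suc n) \<omega> = z} \<omega> * F (V \<omega>) z (X (Suc n) \<omega>)) \<partial>M)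
        = (\<integral>\<^sup>+\<omega>. (case (V \<omega>, X (Suc n) \<omega>) of (v, x) \<Rightarrow> F v z x) \<partial>E)"
      unfolding E_def by (subst nn_integral_density) (auto intro!: nn_integral_cong simp: transition_def split: split_indicator)
    also have "\<dots> = (\<integral>\<^sup>+(v, x). F v z x \<partial>(distr D N V \<Otimes>\<^sub>M beta1 (c z)))"
      unfolding eq by (subst nn_integral_distr) auto
    also have "\<dots> = (\<integral>\<^sup>+v. \<integral>\<^sup>+x. F v z x \<partial>beta1 (c z) \<partial>distr D N V)"
      by (subst B.nn_integral_fst[symmetric]) (auto simp: case_prod_beta')
    also have "\<dots> = (\<integral>\<^sup>+\<omega>. \<integral>\<^sup>+x. F (V \<omega>) z x \<partial>beta1 (c z) \<partial>D)"
      by (subst nn_integral_distr) auto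
    also have "\<dots> = (\<integral>\<^sup>+\<omega>. indicator {\<omega>\<in>space M. T n \<omega> = y} \<omega> * (pmf (\<kappa> n y) z * (\<integral>\<^sup>+x. F (V \<omega>) z x \<partial>beta1 (c z))) \<partial>M)"
      unfolding D_def by (subst nn_integral_density) (auto simp: mult_ac)
    finally show ?thesis .
  qed
  have "(\<integral>\<^sup>+\<omega>. F (V \<omega>) (T (Suc n) \<omega>) (X (Suc n) \<omega>) \<partial>M)
      = (\<integral>\<^sup>+z. \<integral>\<^sup>+\<omega>. indicator {\<omega>\<in>space M. T (Suc n) \<omega> = z} \<omega> * F (V \<omega>) z (X (Suc n) \<omega>) \<partial>M \<partial>count_space UNIV)"
    by (rule nn_integral_split_state[where g = "\<lambda>z \<omega>. F (V \<omega>) z (X (Suc n) \<omega>)"]) auto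
  \<comment> \<open>The present state is frozen too, because \<open>*\<close> holds for a fixed pair
    of states. Afterwards the sum over \<open>y\<close> is undone and the sum over \<open>z\<close>
    becomes the kernel integral.\<close>
  also have "\<dots> = (\<integral>\<^sup>+z. \<integral>\<^sup>+y. \<integral>\<^sup>+\<omega>. indicator {\<omega>\<in>space M. T n \<omega> = y} \<omega> * (indicator {\<omega>\<in>space M. T (Suc n) \<omega> = z} \<omega> * F (V \<omega>) z (X (Suc n) \<omega>)) \<partial>M \<partial>count_space UNIV \<partial>count_space UNIV)"
    by (intro nn_integral_cong
        nn_integral_split_state[where S="T n" and g = "\<lambda>y \<omega>. indicator {\<omega>\<in>space M. T (Suc n) \<omega> = z} \<omega> * F (V \<omega>) z (X (Suc n) \<omega>)" for z]) auto
  also have "\<dots> = (\<integral>\<^sup>+z. \<integral>\<^sup>+y. \<integral>\<^sup>+\<omega>. indicator {\<omega>\<in>space M. T n \<omega> = y} \<omega> * (pmf (\<kappa> n y) z * (\<integral>\<^sup>+x. F (V \<omega>) z x \<partial>beta1 (c z))) \<partial>M \<partial>count_space UNIV \<partial>count_space UNIV)"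
    unfolding * ..
  also have "\<dots> = (\<integral>\<^sup>+z. \<integral>\<^sup>+\<omega>. pmf (\<kappa> n (T n \<omega>)) z * (\<integral>\<^sup>+x. F (V \<omega>) z x \<partial>beta1 (c z)) \<partial>M \<partial>count_space UNIV)"
    by (intro nn_integral_cong
        nn_integral_split_state[symmetric, where S="T n" and g = "\<lambda>y \<omega>. ennreal (pmf (\<kappa> n y) z) * (\<integral>\<^sup>+x. F (V \<omega>) z x \<partial>beta1 (c z))" for z]) auto
  also have "\<dots> = (\<integral>\<^sup>+\<omega>. \<integral>\<^sup>+z. pmf (\<kappa> n (T n \<omega>)) z * (\<integral>\<^sup>+x. F (V \<omega>) z x \<partial>beta1 (c z)) \<partial>count_space UNIV \<partial>M)"
    by (rule nn_integral_count_space_nn_integral[symmetric]) auto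
  finally show ?thesis unfolding nn_integral_measure_pmf .
qed

end

subsection \<open>Moments of stick-breaking chains\<close>

lemma Suc_times_binomial_Suc: "Suc i * (k choose Suc i) = (k - i) * (k choose i)"
  by (simp only: binomial_absorption binomial_absorb_comp)

text \<open>
  If \<open>m i y\<close> is the \<open>i\<close>-th moment of a random mass \<open>Z\<close> given that the chain starts in \<open>y\<close>, then
  \<open>stick_moment m k w r y\<close> is the \<open>k\<close>-th moment of \<open>w + r Z\<close>.
\<close>

definition stick_moment :: "(nat \<Rightarrow> 'a \<Rightarrow> real) \<Rightarrow> nat \<Rightarrow> real \<Rightarrow> real \<Rightarrow> 'a \<Rightarrow> real" where
  "stick_moment m k w r y = (\<Sum>i\<le>k. real (k choose i) * w ^ (k - i) * r ^ i * m i y)"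

lemma stick_moment_nonneg:
  "0 \<le> w \<Longrightarrow> 0 \<le> r \<Longrightarrow> (\<And>i. 0 \<le> m i y) \<Longrightarrow> 0 \<le> stick_moment m k w r y"
  unfolding stick_moment_def by (intro sum_nonneg mult_nonneg_nonneg) auto

lemma stick_moment_le:
  assumes "w \<in> {0..1}" "r \<in> {0..1}" "\<And>i. m i y \<in> {0..1}"
  shows "stick_moment m k w r y \<le> 2 ^ k"
proof -
  have "stick_moment m k w r y \<le> (\<Sum>i\<le>k. real (k choose i))"
    unfolding stick_moment_def
  proof (rule sum_mono)
    fix i
    have "w ^ (k - i) * r ^ i * m i y \<le> 1"
      using assms by (intro mult_le_one mult_nonneg_nonneg power_le_one) auto
    then have "real (k choose i) * (w ^ (k - i) * r ^ i * m i y) \<le> real (k choose i) * 1"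
      by (intro mult_left_mono) auto
    then show "real (k choose i) * w ^ (k - i) * r ^ i * m i y \<le> real (k choose i)" by (simp add: mult.assoc)
  qed
  also have "\<dots> = 2 ^ k"
    unfolding of_nat_sum[symmetric] choose_row_sum by simp
  finally show ?thesis .
qed

lemma stick_moment_0_1: "stick_moment m k 0 1 y = m k y"
proof -
  have "stick_moment m k 0 1 y = (\<Sum>i\<in>{k}. real (k choose i) * 0 ^ (k - i) * 1 ^ i * m i y)"
    unfolding stick_moment_def by (intro sum.mono_neutral_right) auto
  then show ?thesis by simp
qed

lemma stick_moment_r0: "stick_moment m k w 0 y = w ^ k * m 0 y"
proof -
  have "stick_moment m k w 0 y = (\<Sum>i\<in>{0}. real (k choose i) * w ^ (k - i) * 0 ^ i * m i y)"
    unfolding stick_moment_def by (intro sum.mono_neutral_right) auto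
  then show ?thesis by simp
qed

text \<open>One stick at a state of value \<open>h\<close> turns collected mass \<open>w\<close> and
  remaining length \<open>r\<close> into \<open>w + r * x * h\<close> and
  \<open>r * (1 - x)\<close>; \<open>Km\<close> stands for the kernel average of \<open>m\<close>.
  The condition of \<open>nn_integral_beta1\<close> is checked on each coefficient of the binomial
  expansion, where it is exactly \<open>rec\<close>.\<close>

lemma nn_integral_beta1_stick_moment:
  fixes m Km :: "nat \<Rightarrow> 'a \<Rightarrow> real"
  assumes c: "0 \<le> c" and wr: "0 \<le> w" "0 \<le> r" and h: "0 \<le> h"
    and Km: "\<And>i. 0 \<le> Km i y" and zero: "Km 0 y = m 0 y"
    and rec: "\<And>i. (c + real (Suc i)) * m (Suc i) y = real (Suc i) * h * m i y + c * Km (Suc i) y"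
  shows "(\<integral>\<^sup>+x. ennreal (stick_moment Km k (w + r * x * h) (r * (1 - x)) y) \<partial>beta1 c) = ennreal (stick_moment m k w r y)"
proof -
  define p where "p x = stick_moment m k (w + r * x * h) (r * (1 - x)) y" for x
  define p' where "p' x = (\<Sum>i\<le>k. real (k choose i) * (real (k - i) * (w + r * x * h) ^ (k - i - 1) * (r * h) * (r * (1 - x)) ^ i
      - (w + r * x * h) ^ (k - i) * (real i * (r * (1 - x)) ^ (i - 1) * r)) * m i y)" for x
  have "(\<integral>\<^sup>+x. ennreal (stick_moment Km k (w + r * x * h) (r * (1 - x)) y) \<partial>beta1 c) = ennreal (p 0)"
  proof (rule nn_integral_beta1[where p'=p'])
    show "(p has_real_derivative p' x) (at x)" for x
      unfolding p_def p'_def stick_moment_def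
    proof (rule DERIV_sum)
      fix i
      have d1: "((\<lambda>x. (w + r * x * h) ^ (k - i)) has_real_derivative real (k - i) * (w + r * x * h) ^ (k - i - 1) * (r * h)) (at x)"
        using DERIV_power[of "\<lambda>x. w + r * x * h" "r * h" x UNIV "k - i"]
        by (auto intro!: derivative_eq_intros simp: algebra_simps)
      have d2: "((\<lambda>x. (r * (1 - x)) ^ i) has_real_derivative - (real i * (r * (1 - x)) ^ (i - 1) * r)) (at x)"
        using DERIV_power[of "\<lambda>x. r * (1 - x)" "- r" x UNIV i]
        by (auto intro!: derivative_eq_intros simp: algebra_simps)
      show "((\<lambda>x. real (k choose i) * (w + r * x * h) ^ (k - i) * (r * (1 - x)) ^ i * m i y) has_real_derivative
        real (k choose i) * (real (k - i) * (w + r * x * h) ^ (k - i - 1) * (r * h) * (r * (1 - x)) ^ i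
          - (w + r * x * h) ^ (k - i) * (real i * (r * (1 - x)) ^ (i - 1) * r)) * m i y) (at x)"
        using DERIV_cmult_right[OF DERIV_cmult[OF DERIV_mult[OF d1 d2], of "real (k choose i)"], of "m i y"]
        by (simp add: algebra_simps)
    qed
    show "c * stick_moment Km k (w + r * x * h) (r * (1 - x)) y = c * p x - (1 - x) * p' x" for x
    proof -
      define u v where "u = w + r * x * h" and "v = r * (1 - x)"
      \<comment> \<open>Valid also for \<open>i = 0\<close>, where \<open>i - 1\<close> is
        truncated, because the factor \<open>i\<close> vanishes.\<close>
      have vi: "real i * v ^ (i - 1) * v = real i * v ^ i" for i by (cases i) auto
      have "(1 - x) * p' x = (\<Sum>i\<le>k. real (k choose i) * (real (k - i) * u ^ (k - i - 1) * h * (v * v ^ i) * m i y)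
          - real (k choose i) * u ^ (k - i) * (real i * v ^ (i - 1) * v) * m i y)"
        unfolding p'_def u_def[symmetric] v_def[symmetric] sum_distrib_left
        by (intro sum.cong refl) (simp add: v_def algebra_simps)
      also have "\<dots> = (\<Sum>i\<le>k. real ((k - i) * (k choose i)) * u ^ (k - Suc i) * h * v ^ Suc i * m i y)
          - (\<Sum>i\<le>k. real (k choose i) * u ^ (k - i) * (real i * v ^ i) * m i y)"
        unfolding vi sum_subtractf by (simp add: mult_ac)
      \<comment> \<open>Differentiating the power of \<open>u\<close> lowers its exponent by one
        while \<open>v\<close> gains one. The absorption identity shifts the index, so that all
        terms carry the same monomial \<open>u ^ (k - i) * v ^ i\<close>.\<close>
      also have "(\<Sum>i\<le>k. real ((k - i) * (k choose i)) * u ^ (k - Suc i) * h * v ^ Suc i * m i y)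
          = (\<Sum>i<k. real (Suc i * (k choose Suc i)) * u ^ (k - Suc i) * h * v ^ Suc i * m i y)"
        unfolding Suc_times_binomial_Suc by (intro sum.mono_neutral_right) auto
      also have "\<dots> = (\<Sum>i\<le>k. real (i * (k choose i)) * u ^ (k - i) * h * v ^ i * m (i - 1) y)"
        by (simp only: lessThan_Suc_atMost[symmetric] sum.lessThan_Suc_shift) simp
      finally have p': "(1 - x) * p' x = (\<Sum>i\<le>k. real (i * (k choose i)) * u ^ (k - i) * h * v ^ i * m (i - 1) y)
          - (\<Sum>i\<le>k. real (k choose i) * u ^ (k - i) * (real i * v ^ i) * m i y)" .
      have "c * p x - (1 - x) * p' x = (\<Sum>i\<le>k. real (k choose i) * u ^ (k - i) * v ^ i *
          (c * m i y - (real i * h * m (i - 1) y - real i * m i y)))"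
        unfolding p' p_def stick_moment_def u_def[symmetric] v_def[symmetric]
        by (simp add: sum_distrib_left sum_subtractf[symmetric] sum.distrib[symmetric] algebra_simps)
      also have "\<dots> = (\<Sum>i\<le>k. real (k choose i) * u ^ (k - i) * v ^ i * (c * Km i y))"
      proof (intro sum.cong refl arg_cong2[where f="(*)"])
        fix i show "c * m i y - (real i * h * m (i - 1) y - real i * m i y) = c * Km i y"
        proof (cases i)
          case (Suc j) then show ?thesis using rec[of j] by (simp add: algebra_simps)
        qed (simp add: zero)
      qed
      finally show ?thesis
        unfolding stick_moment_def u_def[symmetric] v_def[symmetric] by (simp add: sum_distrib_left mult_ac)
    qed
    show "0 \<le> stick_moment Km k (w + r * x * h) (r * (1 - x)) y" if "x \<in> {0..1}" for x
      using that wr h Km by (intro stick_moment_nonneg) auto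
    show "(\<lambda>x. stick_moment Km k (w + r * x * h) (r * (1 - x)) y) \<in> borel_measurable borel"
      unfolding stick_moment_def by measurable
    show "stick_moment Km k (w + r * 1 * h) (r * (1 - 1)) y = p 1"
      by (simp add: p_def stick_moment_r0 zero)
  qed (fact c)
  then show ?thesis by (simp add: p_def)
qed

section \<open>Remaining stick length and collected mass\<close>

context stick_chain
begin

definition residue :: "nat \<Rightarrow> 'm \<Rightarrow> real" where
  "residue n \<omega> = (\<Prod>i\<in>{1..n}. (1 - X i \<omega>))"

definition partial_mass :: "('a \<Rightarrow> real) \<Rightarrow> nat \<Rightarrow> 'm \<Rightarrow> real" where
  "partial_mass h n \<omega> = (\<Sum>j\<in>{1..n}. stick (\<lambda>i. X i \<omega>) j * h (T j \<omega>))"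

lemma residue_0 [simp]: "residue 0 \<omega> = 1"
  and residue_Suc: "residue (Suc n) \<omega> = residue n \<omega> * (1 - X (Suc n) \<omega>)"
  by (simp_all add: residue_def)

lemma stick_Suc: "stick (\<lambda>i. X i \<omega>) (Suc n) = residue n \<omega> * X (Suc n) \<omega>"
  by (simp add: stick_def residue_def atLeastLessThanSuc_atLeastAtMost)

lemma partial_mass_0 [simp]: "partial_mass h 0 \<omega> = 0"
  and partial_mass_Suc: "partial_mass h (Suc n) \<omega> = partial_mass h n \<omega> + residue n \<omega> * X (Suc n) \<omega> * h (T (Suc n) \<omega>)"
  by (simp_all add: partial_mass_def stick_Suc)

lemma sum_stick: "(\<Sum>j<n. stick (\<lambda>i. X i \<omega>) (Suc j)) = 1 - residue n \<omega>"
  by (induction n) (simp_all add: stick_Suc residue_Suc algebra_simps)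

lemma sum_stick_mass: "(\<Sum>j<n. stick (\<lambda>i. X i \<omega>) (Suc j) * h (T (Suc j) \<omega>)) = partial_mass h n \<omega>"
  by (induction n) (simp_all add: partial_mass_Suc stick_Suc)

lemma measurable_past_comp_T: "k \<in> {1..n} \<Longrightarrow> (\<lambda>\<omega>. h (T k \<omega>) :: real) \<in> borel_measurable (past n)"
  using measurable_compose[OF measurable_past_T, of k n h borel] by simp

lemma measurable_past_residue: "residue n \<in> borel_measurable (past n)"
  unfolding residue_def[abs_def]
  by (intro borel_measurable_prod borel_measurable_diff borel_measurable_const measurable_past_X)

lemma measurable_past_partial_mass: "partial_mass h n \<in> borel_measurable (past n)"
  unfolding partial_mass_def[abs_def] stick_def
  by (intro borel_measurable_sum borel_measurable_times borel_measurable_prod borel_measurable_diff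
      borel_measurable_const measurable_past_X measurable_past_comp_T) auto

lemma measurable_residue [measurable]: "residue n \<in> borel_measurable M"
  and measurable_partial_mass [measurable]: "partial_mass h n \<in> borel_measurable M"
  by (intro measurable_past[OF measurable_past_residue] measurable_past[OF measurable_past_partial_mass])+

lemma AE_X_01: "AE \<omega> in M. \<forall>j\<ge>1. X j \<omega> \<in> {0..1}"
proof -
  have null: "(\<integral>\<^sup>+x. indicator (- {0..1}) x \<partial>beta1 (c z)) = 0" for z
  proof -
    have "AE x in beta1 (c z). indicator (- {0..1}) x = (0::ennreal)"
      using AE_beta1[of "c z"] by eventually_elim auto
    then show ?thesis by (subst nn_integral_cong_AE[where v="\<lambda>_. 0"]) auto
  qed
  have "(\<integral>\<^sup>+\<omega>. indicator (- {0..1}) (X j \<omega>) \<partial>M) = 0" if j: "j \<ge> 1" for j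
  proof (cases "j = 1")
    case True
    then show ?thesis using nn_integral_init[of "\<lambda>_ x. indicator (- {0..1}) x"] null by simp
  next
    case False
    then obtain n where "j = Suc n" "1 \<le> n" using j False by (cases j) auto
    \<comment> \<open>The trivial past \<open>()\<close> suffices, as only the law of a single stick
      matters.\<close>
    then show ?thesis
      using nn_integral_step[of n "\<lambda>_. ()" "count_space UNIV" "\<lambda>_ _ x. indicator (- {0..1}) x"] null by simp
  qed
  then have "AE \<omega> in M. X j \<omega> \<in> {0..1}" if "j \<ge> 1" for j
    using that by (subst (asm) nn_integral_0_iff_AE) (auto simp: indicator_def elim!: eventually_mono split: if_splits)
  then show ?thesis by (subst AE_all_countable) (auto intro: AE_impI)
qed

lemma residue_01: "\<forall>j\<ge>1. X j \<omega> \<in> {0..1} \<Longrightarrow> residue n \<omega> \<in> {0..1}"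
  unfolding residue_def by (auto intro!: prod_nonneg prod_le_1)

lemma partial_mass_01:
  assumes X: "\<forall>j\<ge>1. X j \<omega> \<in> {0..1}" and h: "\<And>y. h y \<in> {0..1}"
  shows "partial_mass h n \<omega> \<in> {0..1}"
proof -
  have "0 \<le> partial_mass h n \<omega> \<and> partial_mass h n \<omega> \<le> 1 - residue n \<omega>"
    unfolding sum_stick[symmetric] sum_stick_mass[symmetric]
    using residue_01[OF X] X h
    by (auto simp: stick_Suc intro!: sum_nonneg sum_mono mult_nonneg_nonneg mult_left_le)
  then show ?thesis using residue_01[OF X, of n] by auto
qed

text \<open>Whatever the state, a fresh stick leaves on average the fraction
  \<open>c / (1 + c)\<close>, which increases with \<open>c\<close>; hence a geometric bound with
  the uniform \<open>C\<close>.\<close>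

lemma nn_integral_residue_le:
  assumes C: "\<And>y. c y \<le> C"
  shows "(\<integral>\<^sup>+\<omega>. ennreal (residue n \<omega>) \<partial>M) \<le> ennreal ((C / (1 + C)) ^ n)"
proof -
  define q where "q = C / (1 + C)"
  have C0: "0 \<le> C" using c_nonneg[of undefined] C[of undefined] by simp
  then have q0: "0 \<le> q" by (simp add: q_def)
  have one: "(\<integral>\<^sup>+x. ennreal (1 - x) \<partial>beta1 (c z)) \<le> ennreal q" for z
  proof -
    have "c z / (1 + c z) \<le> q"
      unfolding q_def using C[of z] c_nonneg[of z] C0 by (simp add: frac_le_eq divide_simps algebra_simps)
    then show ?thesis by (simp add: nn_integral_beta1_one_minus c_nonneg ennreal_leI)
  qed
  have pos: "(\<integral>\<^sup>+\<omega>. ennreal (residue (Suc n) \<omega>) \<partial>M) \<le> ennreal (q ^ Suc n)" for n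
  proof (induction n)
    case 0
    have "(\<integral>\<^sup>+\<omega>. ennreal (residue (Suc 0) \<omega>) \<partial>M) = (\<integral>\<^sup>+z. (\<integral>\<^sup>+x. ennreal (1 - x) \<partial>beta1 (c z)) \<partial>ini)"
      using nn_integral_init[of "\<lambda>_ x. ennreal (1 - x)"] by (simp add: residue_Suc)
    also have "\<dots> \<le> (\<integral>\<^sup>+z. ennreal q \<partial>ini)" by (intro nn_integral_mono one)
    finally show ?case by simp
  next
    case (Suc n)
    have "(\<integral>\<^sup>+\<omega>. ennreal (residue (Suc (Suc n)) \<omega>) \<partial>M)
        = (\<integral>\<^sup>+\<omega>. ennreal (residue (Suc n) \<omega>) * ennreal (1 - X (Suc (Suc n)) \<omega>) \<partial>M)"
    proof (rule nn_integral_cong_AE)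
      show "AE \<omega> in M. ennreal (residue (Suc (Suc n)) \<omega>) = ennreal (residue (Suc n) \<omega>) * ennreal (1 - X (Suc (Suc n)) \<omega>)"
        using AE_X_01
      proof eventually_elim
      case (elim \<omega>)
      then show ?case using residue_01[OF elim(1), of "Suc n"] unfolding residue_Suc[of "Suc n"] by (intro ennreal_mult) auto
      qed
    qed
    also have "\<dots> = (\<integral>\<^sup>+\<omega>. (\<integral>\<^sup>+z. (\<integral>\<^sup>+x. ennreal (residue (Suc n) \<omega>) * ennreal (1 - x) \<partial>beta1 (c z)) \<partial>\<kappa> (Suc n) (T (Suc n) \<omega>)) \<partial>M)"
      by (rule nn_integral_step[OF _ measurable_past_residue, where F="\<lambda>v _ x. ennreal v * ennreal (1 - x)"]) simp_all
    also have "\<dots> \<le> (\<integral>\<^sup>+\<omega>. (\<integral>\<^sup>+z. ennreal (residue (Suc n) \<omega>) * ennreal q \<partial>\<kappa> (Suc n) (T (Suc n) \<omega>)) \<partial>M)"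
      by (intro nn_integral_mono) (auto simp: nn_integral_cmult intro!: mult_left_mono one)
    also have "\<dots> = (\<integral>\<^sup>+\<omega>. ennreal (residue (Suc n) \<omega>) \<partial>M) * ennreal q"
      by (simp add: nn_integral_multc measure_pmf.emeasure_space_1)
    also have "\<dots> \<le> ennreal (q ^ Suc n) * ennreal q" by (intro mult_right_mono Suc) auto
    finally show ?case using q0 by (simp add: ennreal_mult[symmetric] mult_ac)
  qed
  show ?thesis
  proof (cases n)
    case 0 then show ?thesis by (simp add: emeasure_space_1)
  next
    case (Suc k) then show ?thesis using pos[of k] by (simp add: q_def)
  qed
qed

text \<open>A Borel-Cantelli argument: the series of the residues has finite mean, so it converges
  almost surely and its terms tend to 0.\<close>

lemma AE_residue_tendsto_0:
  assumes C: "\<And>y. c y \<le> C"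
  shows "AE \<omega> in M. (\<lambda>n. residue n \<omega>) \<longlonglongrightarrow> 0"
proof -
  have C0: "0 \<le> C" using c_nonneg[of undefined] C[of undefined] by simp
  have "(\<integral>\<^sup>+\<omega>. (\<Sum>n. ennreal (residue n \<omega>)) \<partial>M) = (\<Sum>n. \<integral>\<^sup>+\<omega>. ennreal (residue n \<omega>) \<partial>M)"
    by (rule nn_integral_suminf) simp
  also have "\<dots> \<le> (\<Sum>n. ennreal ((C / (1 + C)) ^ n))"
    by (intro suminf_le nn_integral_residue_le C) auto
  also have "\<dots> < \<infinity>"
  proof -
    have "norm (C / (1 + C)) < 1" using C0 by simp
    then show ?thesis using C0
      by (subst suminf_ennreal2) (auto intro!: summable_geometric simp: less_top[symmetric])
  qed
  finally have "(\<integral>\<^sup>+\<omega>. (\<Sum>n. ennreal (residue n \<omega>)) \<partial>M) \<noteq> \<infinity>" by simp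
  then have "AE \<omega> in M. (\<Sum>n. ennreal (residue n \<omega>)) \<noteq> \<infinity>"
    by (intro nn_integral_noteq_infinite) auto
  with AE_X_01 show ?thesis
  proof eventually_elim
    case (elim \<omega>)
    then have "summable (\<lambda>n. residue n \<omega>)"
      using residue_01[OF elim(1)] by (intro summable_suminf_not_top) auto
    then show ?case by (rule summable_LIMSEQ_zero)
  qed
qed

end

text \<open>\<open>m\<close> is any solution in the unit interval of the moment equation, written
  with jump rates \<open>c\<close> and kernel \<open>\<kappa>\<close>:
  \<open>k m k = k h m (k - 1) + c (\<kappa> - I) m k\<close>. That it describes the moments of the
  total mass is a consequence, \<open>expectation_total_mass_power\<close>.\<close>

locale homogeneous_stick_chain = stick_chain M ini "\<lambda>_. \<kappa>" c T X
  for M :: "'m measure" and ini :: "'a::countable pmf" and \<kappa> :: "'a \<Rightarrow> 'a pmf" and c T X +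
  fixes h :: "'a \<Rightarrow> real" and m :: "nat \<Rightarrow> 'a \<Rightarrow> real" and C :: real
  assumes h: "\<And>y. h y \<in> {0..1}" and m: "\<And>k y. m k y \<in> {0..1}" and m_0: "\<And>y. m 0 y = 1"
    and c_le: "\<And>y. c y \<le> C"
    and moment_equation: "\<And>k y. (c y + real (Suc k)) * m (Suc k) y = real (Suc k) * h y * m k y + c y * kexp \<kappa> (m (Suc k)) y"
begin

abbreviation moment_next :: "nat \<Rightarrow> 'a \<Rightarrow> real" where
  "moment_next k \<equiv> kexp \<kappa> (m k)"

lemma moment_next_01: "moment_next k y \<in> {0..1}"
  by (rule kexp_01) (rule m)

lemma moment_next_0: "moment_next 0 y = 1"
proof -
  have "m 0 = (\<lambda>_. 1)" using m_0 by auto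
  then show ?thesis by (simp add: kexp_def)
qed

lemma nn_integral_kernel_stick_moment:
  assumes "0 \<le> w" "0 \<le> r"
  shows "(\<integral>\<^sup>+z. ennreal (stick_moment m k w r z) \<partial>\<kappa> y) = ennreal (stick_moment moment_next k w r y)"
proof -
  have int: "integrable (measure_pmf (\<kappa> y)) (\<lambda>z. m i z)" for i by (intro integrable_pmf_01 m)
  have "(\<integral>\<^sup>+z. ennreal (stick_moment m k w r z) \<partial>\<kappa> y) = ennreal (\<integral>z. stick_moment m k w r z \<partial>\<kappa> y)"
  proof (rule nn_integral_eq_integral)
    show "integrable (measure_pmf (\<kappa> y)) (stick_moment m k w r)"
      unfolding stick_moment_def[abs_def] using int by (intro Bochner_Integration.integrable_sum integrable_mult_right) auto
    show "AE z in measure_pmf (\<kappa> y). 0 \<le> stick_moment m k w r z"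
      using assms m by (intro AE_I2 stick_moment_nonneg) auto
  qed
  also have "(\<integral>z. stick_moment m k w r z \<partial>\<kappa> y) = stick_moment moment_next k w r y"
    unfolding stick_moment_def kexp_def using int by (subst Bochner_Integration.integral_sum) auto
  finally show ?thesis .
qed

lemma nn_integral_beta1_stick_moment':
  assumes "0 \<le> w" "0 \<le> r"
  shows "(\<integral>\<^sup>+x. ennreal (stick_moment moment_next k (w + r * x * h z) (r * (1 - x)) z) \<partial>beta1 (c z)) = ennreal (stick_moment m k w r z)"
  using assms h moment_next_01
  by (intro nn_integral_beta1_stick_moment c_nonneg moment_equation) (auto simp: moment_next_0 m_0)

lemma measurable_stick_moment: "(\<lambda>(v, x). ennreal (stick_moment moment_next k (fst v + snd v * x * h z) (snd v * (1 - x)) z))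
    \<in> borel_measurable ((borel \<Otimes>\<^sub>M borel) \<Otimes>\<^sub>M borel)"
  unfolding stick_moment_def split_beta' by measurable

text \<open>The martingale, in expectation. \<open>moment_next\<close> appears in place of
  \<open>m\<close> since the current state has already spent its stick: the next state averages
  \<open>m\<close> into \<open>moment_next\<close>, and its stick integrates
  \<open>moment_next\<close> back to \<open>m\<close>. The index is \<open>Suc n\<close> because the
  chain starts at time 1.\<close>

lemma nn_integral_stick_moment_const:
  "(\<integral>\<^sup>+\<omega>. ennreal (stick_moment moment_next k (partial_mass h (Suc n) \<omega>) (residue (Suc n) \<omega>) (T (Suc n) \<omega>)) \<partial>M)
    = ennreal (measure_pmf.expectation ini (m k))"
proof (induction n)
  case 0
  have "(\<integral>\<^sup>+\<omega>. ennreal (stick_moment moment_next k (partial_mass h (Suc 0) \<omega>) (residue (Suc 0) \<omega>) (T (Suc 0) \<omega>)) \<partial>M)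
      = (\<integral>\<^sup>+\<omega>. ennreal (stick_moment moment_next k (0 + 1 * X 1 \<omega> * h (T 1 \<omega>)) (1 * (1 - X 1 \<omega>)) (T 1 \<omega>)) \<partial>M)"
    by (simp add: partial_mass_Suc residue_Suc)
  also have "\<dots> = (\<integral>\<^sup>+z. (\<integral>\<^sup>+x. ennreal (stick_moment moment_next k (0 + 1 * x * h z) (1 * (1 - x)) z) \<partial>beta1 (c z)) \<partial>ini)"
    by (rule nn_integral_init) (simp add: stick_moment_def)
  also have "\<dots> = (\<integral>\<^sup>+z. ennreal (m k z) \<partial>ini)"
    by (subst nn_integral_beta1_stick_moment') (simp_all add: stick_moment_0_1)
  also have "\<dots> = ennreal (measure_pmf.expectation ini (m k))"
    using m by (intro nn_integral_eq_integral integrable_pmf_01) auto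
  finally show ?case .
next
  case (Suc n)
  let ?n = "Suc n"
  let ?V = "\<lambda>\<omega>. (partial_mass h ?n \<omega>, residue ?n \<omega>)"
  have "(\<integral>\<^sup>+\<omega>. ennreal (stick_moment moment_next k (partial_mass h (Suc ?n) \<omega>) (residue (Suc ?n) \<omega>) (T (Suc ?n) \<omega>)) \<partial>M)
    = (\<integral>\<^sup>+\<omega>. ennreal (stick_moment moment_next k (fst (?V \<omega>) + snd (?V \<omega>) * X (Suc ?n) \<omega> * h (T (Suc ?n) \<omega>)) (snd (?V \<omega>) * (1 - X (Suc ?n) \<omega>)) (T (Suc ?n) \<omega>)) \<partial>M)"
    by (simp add: partial_mass_Suc[of h ?n] residue_Suc[of ?n])
  also have "\<dots> = (\<integral>\<^sup>+\<omega>. (\<integral>\<^sup>+z. (\<integral>\<^sup>+x. ennreal (stick_moment moment_next k (fst (?V \<omega>) + snd (?V \<omega>) * x * h z) (snd (?V \<omega>) * (1 - x)) z) \<partial>beta1 (c z)) \<partial>\<kappa> (T ?n \<omega>)) \<partial>M)"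
    by (rule nn_integral_step[where F = "\<lambda>v z x. ennreal (stick_moment moment_next k (fst v + snd v * x * h z) (snd v * (1 - x)) z)",
          OF _ measurable_Pair[OF measurable_past_partial_mass measurable_past_residue] measurable_stick_moment]) simp
  also have "\<dots> = (\<integral>\<^sup>+\<omega>. ennreal (stick_moment moment_next k (partial_mass h ?n \<omega>) (residue ?n \<omega>) (T ?n \<omega>)) \<partial>M)"
  proof (rule nn_integral_cong_AE)
    show "AE \<omega> in M. (\<integral>\<^sup>+z. (\<integral>\<^sup>+x. ennreal (stick_moment moment_next k (fst (?V \<omega>) + snd (?V \<omega>) * x * h z) (snd (?V \<omega>) * (1 - x)) z) \<partial>beta1 (c z)) \<partial>\<kappa> (T ?n \<omega>))
      = ennreal (stick_moment moment_next k (partial_mass h ?n \<omega>) (residue ?n \<omega>) (T ?n \<omega>))"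
      using AE_X_01
    proof eventually_elim
      case (elim \<omega>)
      then show ?case using residue_01[OF elim, of ?n] partial_mass_01[where h=h and n="?n", OF elim h]
        by (simp add: nn_integral_beta1_stick_moment' nn_integral_kernel_stick_moment)
    qed
  qed
  finally show ?case using Suc by simp
qed

definition total_mass :: "'m \<Rightarrow> real" where
  "total_mass \<omega> = (\<Sum>j. stick (\<lambda>i. X i \<omega>) (Suc j) * h (T (Suc j) \<omega>))"

lemma partial_mass_tendsto:
  assumes X: "\<forall>j\<ge>1. X j \<omega> \<in> {0..1}"
  shows "(\<lambda>n. partial_mass h n \<omega>) \<longlonglongrightarrow> total_mass \<omega>"
proof -
  have "summable (\<lambda>j. stick (\<lambda>i. X i \<omega>) (Suc j) * h (T (Suc j) \<omega>))"
  proof (rule summableI_nonneg_bounded[where x=1])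
    show "0 \<le> stick (\<lambda>i. X i \<omega>) (Suc j) * h (T (Suc j) \<omega>)" for j
      using X residue_01[OF X] h by (auto simp: stick_Suc intro!: mult_nonneg_nonneg)
    show "(\<Sum>j<n. stick (\<lambda>i. X i \<omega>) (Suc j) * h (T (Suc j) \<omega>)) \<le> 1" for n
      using partial_mass_01[OF X h] by (simp add: sum_stick_mass)
  qed
  then show ?thesis
    unfolding total_mass_def sum_stick_mass[symmetric] by (rule summable_LIMSEQ)
qed

text \<open>Let n tend to infinity in the constant expectation: the residue tends to 0, so only the
  term without a residue survives, and it tends to the power of the total mass.\<close>

lemma expectation_total_mass_power: "expectation (\<lambda>\<omega>. total_mass \<omega> ^ k) = measure_pmf.expectation ini (m k)"
proof -
  let ?f = "\<lambda>n \<omega>. stick_moment moment_next k (partial_mass h (Suc n) \<omega>) (residue (Suc n) \<omega>) (T (Suc n) \<omega>)"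
  have meas: "?f n \<in> borel_measurable M" for n unfolding stick_moment_def by measurable
  have bound: "AE \<omega> in M. 0 \<le> ?f n \<omega> \<and> ?f n \<omega> \<le> 2 ^ k" for n
    using AE_X_01
  proof eventually_elim
    case (elim \<omega>)
    have *: "partial_mass h (Suc n) \<omega> \<in> {0..1}" "residue (Suc n) \<omega> \<in> {0..1}"
      using residue_01[OF elim] partial_mass_01[OF elim h] by auto
    then show ?case using stick_moment_le[OF *, of moment_next] moment_next_01
      by (auto intro!: stick_moment_nonneg)
  qed
  have "(\<lambda>n. expectation (?f n)) \<longlonglongrightarrow> expectation (\<lambda>\<omega>. total_mass \<omega> ^ k)"
  proof (rule integral_dominated_convergence[where w="\<lambda>_. 2 ^ k"])
    show "AE \<omega> in M. (\<lambda>n. ?f n \<omega>) \<longlonglongrightarrow> total_mass \<omega> ^ k"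
      using AE_X_01 AE_residue_tendsto_0[OF c_le]
    proof eventually_elim
      case (elim \<omega>)
      have W: "(\<lambda>n. partial_mass h (Suc n) \<omega>) \<longlonglongrightarrow> total_mass \<omega>"
        using partial_mass_tendsto[OF elim(1)] by (rule LIMSEQ_Suc)
      have R: "(\<lambda>n. residue (Suc n) \<omega>) \<longlonglongrightarrow> 0" using elim(2) by (rule LIMSEQ_Suc)
      have "(\<lambda>n. real (k choose i) * partial_mass h (Suc n) \<omega> ^ (k - i) * residue (Suc n) \<omega> ^ i * moment_next i (T (Suc n) \<omega>))
          \<longlonglongrightarrow> (if i = 0 then total_mass \<omega> ^ k else 0)" for i
      proof (cases "i = 0")
        case True
        then show ?thesis using tendsto_power[OF W, of k] by (simp add: moment_next_0)
      next
        case False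
        have "(\<lambda>n. real (k choose i) * partial_mass h (Suc n) \<omega> ^ (k - i) * residue (Suc n) \<omega> ^ i) \<longlonglongrightarrow> real (k choose i) * total_mass \<omega> ^ (k - i) * 0 ^ i"
          by (intro tendsto_intros W R)
        then have "(\<lambda>n. real (k choose i) * partial_mass h (Suc n) \<omega> ^ (k - i) * residue (Suc n) \<omega> ^ i) \<longlonglongrightarrow> 0"
          using False by (simp add: power_0_left)
        \<comment> \<open>The factor \<open>moment_next i (T (Suc n) \<omega>)\<close> need not
          converge along the path, but it is bounded by 1.\<close>
        then have "(\<lambda>n. real (k choose i) * partial_mass h (Suc n) \<omega> ^ (k - i) * residue (Suc n) \<omega> ^ i * moment_next i (T (Suc n) \<omega>)) \<longlonglongrightarrow> 0"
        proof (rule tendsto_0_le[where K=1])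
          show "\<forall>\<^sub>F n in sequentially. norm (real (k choose i) * partial_mass h (Suc n) \<omega> ^ (k - i) * residue (Suc n) \<omega> ^ i * moment_next i (T (Suc n) \<omega>))
            \<le> norm (real (k choose i) * partial_mass h (Suc n) \<omega> ^ (k - i) * residue (Suc n) \<omega> ^ i) * 1"
            unfolding norm_mult using moment_next_01 by (intro always_eventually allI mult_left_mono) auto
        qed
        then show ?thesis using False by simp
      qed
      then have "(\<lambda>n. ?f n \<omega>) \<longlonglongrightarrow> (\<Sum>i\<le>k. if i = 0 then total_mass \<omega> ^ k else 0)"
        unfolding stick_moment_def by (rule tendsto_sum)
      then show ?case by simp
    qed
    show "AE \<omega> in M. norm (?f n \<omega>) \<le> 2 ^ k" for n using bound[of n] by eventually_elim simp
  qed (use meas in \<open>auto simp: total_mass_def stick_def\<close>)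
  moreover have "expectation (?f n) = measure_pmf.expectation ini (m k)" for n
  proof -
    have "expectation (?f n) = enn2real (\<integral>\<^sup>+\<omega>. ennreal (?f n \<omega>) \<partial>M)"
      using bound[of n] by (intro integral_eq_nn_integral meas) (auto elim: eventually_mono)
    then show ?thesis using expectation_pmf_01[of "m k" ini] m
      unfolding nn_integral_stick_moment_const by auto
  qed
  ultimately show ?thesis by (auto dest: LIMSEQ_unique[OF _ tendsto_const])
qed

end

subsection \<open>Moments of the occupation measure\<close>

text \<open>Both mass functions have total 1, so their distance is twice the positive part of
  \<open>q - p n\<close>, and that part is dominated by \<open>q\<close>. One null sequence serves
  all test functions at once.\<close>

lemma Scheffe_pmf:
  assumes conv: "\<And>i. (\<lambda>n. pmf (p n) i) \<longlonglongrightarrow> pmf q i"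
  obtains \<epsilon> :: "nat \<Rightarrow> real" where "\<epsilon> \<longlonglongrightarrow> 0"
    "\<And>n f. (\<And>x. f x \<in> {0..1}) \<Longrightarrow> \<bar>measure_pmf.expectation (p n) f - measure_pmf.expectation q f\<bar> \<le> \<epsilon> n"
proof
  let ?C = "count_space (UNIV :: 'a set)"
  define \<epsilon> where "\<epsilon> n = (\<integral>x. \<bar>pmf (p n) x - pmf q x\<bar> \<partial>?C)" for n
  have int: "integrable ?C (pmf r)" for r :: "'a pmf" by (rule integrable_pmf)
  have one: "(\<integral>x. pmf r x \<partial>?C) = 1" for r :: "'a pmf" by (simp add: integral_pmf)
  show "\<bar>measure_pmf.expectation (p n) f - measure_pmf.expectation q f\<bar> \<le> \<epsilon> n"
    if f: "\<And>x. f x \<in> {0..1}" for n f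
  proof -
    have i: "integrable ?C (\<lambda>x. pmf r x * f x)" for r :: "'a pmf"
      using f by (intro Bochner_Integration.integrable_bound[OF int[of r]]) (auto simp: abs_mult intro!: AE_I2 mult_left_le)
    have "measure_pmf.expectation (p n) f - measure_pmf.expectation q f = (\<integral>x. (pmf (p n) x - pmf q x) * f x \<partial>?C)"
      unfolding expectation_pmf_count_space using i by (simp add: left_diff_distrib)
    also have "\<bar>\<dots>\<bar> \<le> (\<integral>x. \<bar>(pmf (p n) x - pmf q x) * f x\<bar> \<partial>?C)" by (rule integral_abs_bound)
    also have "\<dots> \<le> \<epsilon> n"
      unfolding \<epsilon>_def
    proof (rule integral_mono)
      show "integrable ?C (\<lambda>x. \<bar>(pmf (p n) x - pmf q x) * f x\<bar>)"
        using i by (simp add: left_diff_distrib)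
      show "integrable ?C (\<lambda>x. \<bar>pmf (p n) x - pmf q x\<bar>)" using int by simp
      show "\<bar>(pmf (p n) x - pmf q x) * f x\<bar> \<le> \<bar>pmf (p n) x - pmf q x\<bar>" for x
        using f[of x] by (auto simp: abs_mult intro!: mult_left_le)
    qed
    finally show ?thesis .
  qed
  have "\<epsilon> = (\<lambda>n. 2 * (\<integral>x. max 0 (pmf q x - pmf (p n) x) \<partial>?C))"
  proof
    fix n
    have "\<epsilon> n = (\<integral>x. 2 * max 0 (pmf q x - pmf (p n) x) + (pmf (p n) x - pmf q x) \<partial>?C)"
      unfolding \<epsilon>_def by (intro Bochner_Integration.integral_cong) (auto simp: max_def abs_if)
    also have "\<dots> = 2 * (\<integral>x. max 0 (pmf q x - pmf (p n) x) \<partial>?C) + (1 - 1)"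
      using int by (subst Bochner_Integration.integral_add) (auto simp: one)
    finally show "\<epsilon> n = 2 * (\<integral>x. max 0 (pmf q x - pmf (p n) x) \<partial>?C)" by simp
  qed
  moreover have "(\<lambda>n. \<integral>x. max 0 (pmf q x - pmf (p n) x) \<partial>?C) \<longlonglongrightarrow> (\<integral>x. 0 \<partial>?C)"
  proof (rule integral_dominated_convergence[OF _ _ int[of q]])
    have "(\<lambda>n. max 0 (pmf q x - pmf (p n) x)) \<longlonglongrightarrow> max 0 (pmf q x - pmf q x)" for x
      by (intro tendsto_intros conv)
    then show "AE x in ?C. (\<lambda>n. max 0 (pmf q x - pmf (p n) x)) \<longlonglongrightarrow> 0" by simp
  qed (auto intro!: AE_I2)
  ultimately show "\<epsilon> \<longlonglongrightarrow> 0" using tendsto_mult[OF tendsto_const, of _ 0 _ 2] by simp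
qed

lemma kexp_linear:
  assumes "\<And>x. f x \<in> {0..1::real}" "\<And>x. g x \<in> {0..1}"
  shows "kexp \<kappa> (\<lambda>x. a * f x + b * g x) y = a * kexp \<kappa> f y + b * kexp \<kappa> g y"
  unfolding kexp_def using integrable_pmf_01[of f, OF assms(1)] integrable_pmf_01[of g, OF assms(2)] by simp

lemma kexp_mixture:
  assumes "\<And>z. pmf (\<kappa> y) z = (1 - t) * pmf (return_pmf y) z + t * pmf (\<rho> y) z" "\<And>x. f x \<in> {0..1::real}"
  shows "kexp \<kappa> f y = (1 - t) * f y + t * kexp \<rho> f y"
  unfolding kexp_def using assms(2)
  by (subst expectation_pmf_mixture[OF assms(1), of _ 1]) (auto simp: abs_le_iff intro: order_trans[of _ 0])

text \<open>By \<open>rev\<close>, a \<open>Q\<close>-step from \<open>\<mu>\<close> and a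
  \<open>Q'\<close>-step from \<open>\<mu>\<close> with swapped coordinates have the same joint law.
  Both sides are the mean of \<open>g (fst x) * f (snd x)\<close> under it: the two kernels are
  adjoint in L2 of \<open>\<mu>\<close>.\<close>

lemma expectation_reversal:
  assumes rev: "\<And>i j. pmf \<mu> i * pmf (Q i) j = pmf \<mu> j * pmf (Q' j) i"
    and f: "\<And>x. f x \<in> {0..1::real}" and g: "\<And>x. g x \<in> {0..1}"
  shows "measure_pmf.expectation \<mu> (\<lambda>i. g i * kexp Q f i) = measure_pmf.expectation \<mu> (\<lambda>j. kexp Q' g j * f j)"
proof -
  define J where "J = bind_pmf \<mu> (\<lambda>i. map_pmf (Pair i) (Q i))"
  define J' where "J' = bind_pmf \<mu> (\<lambda>j. map_pmf (\<lambda>i. (i, j)) (Q' j))"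
  have *: "pmf (bind_pmf \<mu> (\<lambda>y. map_pmf (F y) (R y))) x = pmf \<mu> i * pmf (R i) j"
    if "F i j = x" "\<And>y. inj (F y)" "\<And>y. y \<noteq> i \<Longrightarrow> x \<notin> range (F y)" for F R and x :: "'a \<times> 'a" and i j
  proof -
    have "pmf (map_pmf (F y) (R y)) x = indicator {i} y * pmf (R i) j" for y
    proof (cases "y = i")
      case True then show ?thesis using pmf_map_inj'[OF that(2)[of i], of "R i" j] that(1) by simp
    next
      case False then show ?thesis using that(3)[of y] by (auto simp: pmf_eq_0_set_pmf)
    qed
    then have "pmf (bind_pmf \<mu> (\<lambda>y. map_pmf (F y) (R y))) x = (\<integral>y. indicator {i} y * pmf (R i) j \<partial>\<mu>)"
      unfolding pmf_bind by simp
    also have "\<dots> = pmf \<mu> i * pmf (R i) j" by (simp add: pmf.rep_eq)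
    finally show ?thesis .
  qed
  have "J = J'"
  proof (rule pmf_eqI)
    fix x :: "'a \<times> 'a" obtain i j where x: "x = (i, j)" by (cases x)
    have "pmf J x = pmf \<mu> i * pmf (Q i) j"
      unfolding J_def by (rule *) (auto simp: x inj_def)
    moreover have "pmf J' x = pmf \<mu> j * pmf (Q' j) i"
      unfolding J'_def by (rule *) (auto simp: x inj_def)
    ultimately show "pmf J x = pmf J' x" by (simp add: rev)
  qed
  have bound: "\<bar>g (fst x) * f (snd x)\<bar> \<le> 1" for x
    using f[of "snd x"] g[of "fst x"] by (auto simp: abs_mult intro!: mult_le_one)
  have "measure_pmf.expectation \<mu> (\<lambda>i. g i * kexp Q f i) = measure_pmf.expectation J (\<lambda>x. g (fst x) * f (snd x))"
    unfolding J_def by (subst expectation_bind_pmf[OF bound]) (simp add: kexp_def)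
  also have "\<dots> = measure_pmf.expectation \<mu> (\<lambda>j. kexp Q' g j * f j)"
    unfolding \<open>J = J'\<close> J'_def by (subst expectation_bind_pmf[OF bound]) (simp add: kexp_def)
  finally show ?thesis .
qed

text \<open>The degenerate sticks \<open>X = 1\<close> have law Beta(\<open>1, 0\<close>), so a bare Markov chain is a special case.\<close>

lemma markov_chain_stick_chain:
  fixes T :: "nat \<Rightarrow> 'm \<Rightarrow> 'a::countable"
  assumes "markov_chain M (pmf ini) (\<lambda>n y z. pmf (\<kappa> n y) z) T"
  shows "stick_chain M ini \<kappa> (\<lambda>_. 0) T (\<lambda>_ _. 1)"
proof -
  have ps: "prob_space M" and [measurable]: "\<And>j. T j \<in> measurable M (count_space UNIV)"
    and fdd: "\<And>n x. 1 \<le> n \<Longrightarrow> measure M {\<omega>\<in>space M. \<forall>k\<in>{1..n}. T k \<omega> = x k}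
        = pmf ini (x 1) * (\<Prod>k\<in>{1..<n}. pmf (\<kappa> k (x k)) (x (k + 1)))"
    using assms by (auto simp: markov_chain_def)
  interpret prob_space M by (rule ps)
  show ?thesis
  proof (unfold_locales, unfold chain_with_sticks_def, intro conjI allI impI)
    fix n x and B :: "nat \<Rightarrow> real set" assume n: "(1::nat) \<le> n" and B: "\<forall>k. B k \<in> sets borel"
    have B1: "measure (beta1 0) (B k) = indicator (B k) 1" for k
      using B by (simp add: beta1_def measure_return)
    show "measure M {\<omega> \<in> space M. \<forall>k\<in>{1..n}. T k \<omega> = x k \<and> 1 \<in> B k} =
       pmf ini (x 1) * (\<Prod>k\<in>{1..<n}. pmf (\<kappa> k (x k)) (x (k + 1))) * (\<Prod>k\<in>{1..n}. measure (beta1 0) (B k))"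
    proof (cases "\<forall>k\<in>{1..n}. 1 \<in> B k")
      case True
      then have "{\<omega> \<in> space M. \<forall>k\<in>{1..n}. T k \<omega> = x k \<and> 1 \<in> B k} = {\<omega> \<in> space M. \<forall>k\<in>{1..n}. T k \<omega> = x k}" by auto
      then show ?thesis using True fdd[OF n] by (simp add: B1)
    next
      case False
      then have "{\<omega> \<in> space M. \<forall>k\<in>{1..n}. T k \<omega> = x k \<and> 1 \<in> B k} = {}" by auto
      moreover have "(\<Prod>k\<in>{1..n}. measure (beta1 0) (B k)) = 0"
        using False by (auto simp: B1 indicator_def)
      ultimately show ?thesis by (simp only: measure_empty mult_zero_right)
    qed
  qed (auto simp: ps)
qed

context stick_chain
begin

lemma expectation_step:
  assumes n: "1 \<le> n" and V: "V \<in> borel_measurable (past n)" "\<And>\<omega>. V \<omega> \<in> {0..1::real}" and f: "\<And>y. f y \<in> {0..1::real}"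
  shows "expectation (\<lambda>\<omega>. V \<omega> * f (T (Suc n) \<omega>)) = expectation (\<lambda>\<omega>. V \<omega> * kexp (\<kappa> n) f (T n \<omega>))"
proof -
  have [measurable]: "V \<in> borel_measurable M" using V(1) by (rule measurable_past)
  have "(\<integral>\<^sup>+\<omega>. ennreal (V \<omega> * f (T (Suc n) \<omega>)) \<partial>M) = (\<integral>\<^sup>+\<omega>. (\<integral>\<^sup>+z. (\<integral>\<^sup>+x. ennreal (V \<omega> * f z) \<partial>beta1 (c z)) \<partial>\<kappa> n (T n \<omega>)) \<partial>M)"
    by (rule nn_integral_step[where F = "\<lambda>v z x. ennreal (v * f z)", OF n V(1)]) simp
  also have "\<dots> = (\<integral>\<^sup>+\<omega>. ennreal (V \<omega> * kexp (\<kappa> n) f (T n \<omega>)) \<partial>M)"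
  proof (rule nn_integral_cong)
    fix \<omega>
    have "(\<integral>\<^sup>+z. (\<integral>\<^sup>+x. ennreal (V \<omega> * f z) \<partial>beta1 (c z)) \<partial>\<kappa> n (T n \<omega>)) = (\<integral>\<^sup>+z. ennreal (V \<omega> * f z) \<partial>\<kappa> n (T n \<omega>))"
      using prob_space.emeasure_space_1[OF prob_space_beta1[OF c_nonneg]] by (intro nn_integral_cong) simp
    also have "\<dots> = ennreal (\<integral>z. V \<omega> * f z \<partial>\<kappa> n (T n \<omega>))"
      using V(2)[of \<omega>] f integrable_pmf_01[of f, OF f]
      by (intro nn_integral_eq_integral) (auto intro!: AE_I2 integrable_mult_right mult_nonneg_nonneg)
    finally show "(\<integral>\<^sup>+z. (\<integral>\<^sup>+x. ennreal (V \<omega> * f z) \<partial>beta1 (c z)) \<partial>\<kappa> n (T n \<omega>)) = ennreal (V \<omega> * kexp (\<kappa> n) f (T n \<omega>))"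
      by (simp add: kexp_def)
  qed
  finally have "enn2real (\<integral>\<^sup>+\<omega>. ennreal (V \<omega> * f (T (Suc n) \<omega>)) \<partial>M) = enn2real (\<integral>\<^sup>+\<omega>. ennreal (V \<omega> * kexp (\<kappa> n) f (T n \<omega>)) \<partial>M)" by simp
  moreover have "0 \<le> V \<omega> * f (T (Suc n) \<omega>)" "0 \<le> V \<omega> * kexp (\<kappa> n) f (T n \<omega>)" for \<omega>
    using V(2)[of \<omega>] f kexp_01[of f, OF f] by auto
  ultimately show ?thesis by (simp add: integral_eq_nn_integral)
qed

lemma expectation_init:
  assumes f: "\<And>y. f y \<in> {0..1::real}"
  shows "expectation (\<lambda>\<omega>. f (T 1 \<omega>)) = measure_pmf.expectation ini f"
proof -
  have "(\<integral>\<^sup>+\<omega>. ennreal (f (T 1 \<omega>)) \<partial>M) = (\<integral>\<^sup>+z. (\<integral>\<^sup>+x. ennreal (f z) \<partial>beta1 (c z)) \<partial>ini)"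
    by (rule nn_integral_init) simp
  also have "\<dots> = (\<integral>\<^sup>+z. ennreal (f z) \<partial>ini)"
    using prob_space.emeasure_space_1[OF prob_space_beta1[OF c_nonneg]] by (intro nn_integral_cong) simp
  finally have "enn2real (\<integral>\<^sup>+\<omega>. ennreal (f (T 1 \<omega>)) \<partial>M) = enn2real (\<integral>\<^sup>+z. ennreal (f z) \<partial>ini)" by simp
  then show ?thesis using f by (simp add: integral_eq_nn_integral)
qed

end

text \<open>The late kernel is \<open>I + G / n\<close> rewritten with
  \<open>G = \<theta> (Q - I)\<close>, the early one the identity. The weight
  \<open>\<theta> / n\<close> may exceed 1 for the first indices after \<open>N\<close>, so this is
  a convex combination only eventually.\<close>

locale occupation_chain = stick_chain M ini \<kappa> c T X
  for M :: "'m measure" and ini :: "'a::countable pmf" and \<kappa> c T X +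
  fixes Q Q' :: "'a \<Rightarrow> 'a pmf" and \<mu> :: "'a pmf" and \<theta> :: real and N :: nat
    and h :: "'a \<Rightarrow> real" and m :: "nat \<Rightarrow> 'a \<Rightarrow> real"
  assumes theta: "0 < \<theta>"
    and kernel_late: "\<And>n y z. N < n \<Longrightarrow> pmf (\<kappa> n y) z = (1 - \<theta> / real n) * pmf (return_pmf y) z + \<theta> / real n * pmf (Q y) z"
    and kernel_early: "\<And>n y. n \<le> N \<Longrightarrow> \<kappa> n y = return_pmf y"
    and reversal: "\<And>i j. pmf \<mu> i * pmf (Q i) j = pmf \<mu> j * pmf (Q' j) i"
    and ergodic: "\<And>j. (\<lambda>n. pmf (((\<lambda>p. bind_pmf p Q) ^^ n) ini) j) \<longlonglongrightarrow> pmf \<mu> j"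
    and h: "\<And>y. h y \<in> {0..1}" and m: "\<And>k y. m k y \<in> {0..1}" and m_0: "\<And>y. m 0 y = 1"
    and moment_equation: "\<And>k y. (\<theta> + real (Suc k)) * m (Suc k) y = real (Suc k) * h y * m k y + \<theta> * kexp Q' (m (Suc k)) y"
begin

text \<open>The value 0 lets the identity kernels of the early times obey the same mixture
  formula.\<close>

definition rate :: "nat \<Rightarrow> real" where
  "rate n = (if N < n then \<theta> / real n else 0)"

lemma kexp_kernel: "(\<And>x. f x \<in> {0..1}) \<Longrightarrow> kexp (\<kappa> n) f y = (1 - rate n) * f y + rate n * kexp Q f y"
  by (rule kexp_mixture) (auto simp: rate_def kernel_late kernel_early)

lemma eventually_rate: "\<forall>\<^sub>F n in sequentially. rate n = \<theta> / real n \<and> rate n \<in> {0..1} \<and> 1 \<le> n \<and> j \<le> n"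
proof -
  have "\<forall>\<^sub>F n in sequentially. Suc (N + nat \<lceil>\<theta>\<rceil> + j) \<le> n" by (rule eventually_ge_at_top)
  then show ?thesis
  proof eventually_elim
    case (elim n)
    then have "\<theta> \<le> real n" by linarith
    then show ?case using elim theta by (auto simp: rate_def)
  qed
qed

lemma not_summable_rate: "\<not> summable rate"
proof
  assume "summable rate"
  moreover have "\<forall>\<^sub>F n in sequentially. rate n = \<theta> / real n"
    using eventually_rate[of 0] by eventually_elim simp
  ultimately have "summable (\<lambda>n. \<theta> / real n)"
    using summable_cong by metis
  then have "summable (\<lambda>n. \<theta> / real (Suc n))" by (subst summable_Suc_iff)
  then show False using not_summable_const_div_Suc[of \<theta>] theta by simp
qed

abbreviation test_functions :: "('a \<Rightarrow> real) set" where
  "test_functions \<equiv> {f. \<forall>y. f y \<in> {0..1}}"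

text \<open>The candidate limit: the last state has law \<open>\<mu>\<close>, and
  \<open>m k y\<close> is the conditional \<open>k\<close>-th moment given that this state is
  \<open>y\<close>.\<close>

definition limit_moment :: "nat \<Rightarrow> ('a \<Rightarrow> real) \<Rightarrow> real" where
  "limit_moment k f = measure_pmf.expectation \<mu> (\<lambda>y. m k y * f y)"

definition occ :: "nat \<Rightarrow> 'm \<Rightarrow> real" where
  "occ n \<omega> = (\<Sum>j\<in>{1..n}. h (T j \<omega>)) / real n"

text \<open>The factor \<open>f (T n \<omega>)\<close> closes the recursion: the next summand
  depends on the current state, so the bare moments of \<open>occ\<close> do not evolve
  autonomously.\<close>

definition occ_moment :: "nat \<Rightarrow> nat \<Rightarrow> ('a \<Rightarrow> real) \<Rightarrow> real" where
  "occ_moment k n f = expectation (\<lambda>\<omega>. occ n \<omega> ^ k * f (T n \<omega>))"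

lemma occ_01: "occ n \<omega> \<in> {0..1}"
proof -
  have "(\<Sum>j\<in>{1..n}. h (T j \<omega>)) \<le> (\<Sum>j\<in>{1..n}. 1)" using h by (intro sum_mono) auto
  then show ?thesis using h by (auto simp: occ_def divide_le_eq intro!: divide_nonneg_nonneg sum_nonneg)
qed

lemma measurable_past_occ: "occ n \<in> borel_measurable (past n)"
  unfolding occ_def[abs_def]
  by (intro borel_measurable_divide borel_measurable_sum borel_measurable_const measurable_past_comp_T)

lemma measurable_occ [measurable]: "occ n \<in> borel_measurable M"
  by (rule measurable_past[OF measurable_past_occ])

lemma mult_01: "x \<in> {0..1} \<Longrightarrow> y \<in> {0..1} \<Longrightarrow> x * y \<in> {0..1::real}"
  by (auto intro!: mult_le_one)

lemma power_01: "x \<in> {0..1} \<Longrightarrow> x ^ k \<in> {0..1::real}"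
  by (auto intro!: power_le_one)

lemma integrable_occ: "(\<And>y. f y \<in> {0..1}) \<Longrightarrow> integrable M (\<lambda>\<omega>. occ n \<omega> ^ k * f (T n \<omega>))"
  using mult_01[OF power_01[OF occ_01]] by (intro integrable_const_bound[where B=1]) (auto intro!: AE_I2)

lemma occ_moment_linear:
  assumes "\<And>y. f y \<in> {0..1}" "\<And>y. g y \<in> {0..1}"
  shows "occ_moment k n (\<lambda>y. a * f y + b * g y) = a * occ_moment k n f + b * occ_moment k n g"
proof -
  have "occ_moment k n (\<lambda>y. a * f y + b * g y) = expectation (\<lambda>\<omega>. a * (occ n \<omega> ^ k * f (T n \<omega>)) + b * (occ n \<omega> ^ k * g (T n \<omega>)))"
    unfolding occ_moment_def by (simp add: algebra_simps)
  then show ?thesis using integrable_occ[of f, OF assms(1)] integrable_occ[of g, OF assms(2)] by (simp add: occ_moment_def)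
qed

lemma limit_moment_linear:
  assumes "\<And>y. f y \<in> {0..1}" "\<And>y. g y \<in> {0..1}"
  shows "limit_moment k (\<lambda>y. a * f y + b * g y) = a * limit_moment k f + b * limit_moment k g"
proof -
  have i: "integrable (measure_pmf \<mu>) (\<lambda>y. m k y * f y)" if "\<And>y. f y \<in> {0..1}" for f
    by (intro integrable_pmf_01 mult_01 m that)
  have "limit_moment k (\<lambda>y. a * f y + b * g y) = measure_pmf.expectation \<mu> (\<lambda>y. a * (m k y * f y) + b * (m k y * g y))"
    unfolding limit_moment_def by (simp add: algebra_simps)
  then show ?thesis using i[of f, OF assms(1)] i[of g, OF assms(2)] by (simp add: limit_moment_def)
qed

lemma occ_moment_01: "(\<And>y. f y \<in> {0..1}) \<Longrightarrow> occ_moment k n f \<in> {0..1}"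
proof -
  assume f: "\<And>y. f y \<in> {0..1}"
  have "occ_moment k n f \<le> expectation (\<lambda>_. 1)"
    unfolding occ_moment_def using integrable_occ[of f, OF f] mult_01[OF power_01[OF occ_01] f] by (intro integral_mono) auto
  then show ?thesis
    using mult_01[OF power_01[OF occ_01] f] by (auto simp: prob_space occ_moment_def intro!: integral_nonneg)
qed

lemma limit_moment_01: "(\<And>y. f y \<in> {0..1}) \<Longrightarrow> limit_moment k f \<in> {0..1}"
  unfolding limit_moment_def by (intro expectation_pmf_01 mult_01 m)

lemma limit_moment_0: "limit_moment 0 f = measure_pmf.expectation \<mu> f"
  by (simp add: limit_moment_def m_0)

lemma limit_moment_0_kexp:
  assumes f: "\<And>y. f y \<in> {0..1}" shows "limit_moment 0 (kexp Q f) = limit_moment 0 f"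
  using expectation_reversal[where g="\<lambda>_. 1" and f=f, OF reversal f] by (simp add: limit_moment_0 kexp_def[abs_def])

text \<open>Duality: \<open>expectation_reversal\<close> moves \<open>Q\<close> from
  \<open>f\<close> onto \<open>m (Suc k)\<close> as \<open>Q'\<close>, where the moment equation
  evaluates it.\<close>

lemma limit_moment_kernel_Suc:
  assumes f: "\<And>y. f y \<in> {0..1}"
  shows "\<theta> * (limit_moment (Suc k) (kexp Q f) - limit_moment (Suc k) f)
    = real (Suc k) * (limit_moment (Suc k) f - limit_moment k (\<lambda>y. h y * f y))"
proof -
  have i: "integrable (measure_pmf \<mu>) (\<lambda>y. m k y * f y)" if "\<And>y. f y \<in> {0..1}" for f k
    by (intro integrable_pmf_01 mult_01 m that)
  have "\<theta> * limit_moment (Suc k) (kexp Q f) = \<theta> * measure_pmf.expectation \<mu> (\<lambda>y. kexp Q' (m (Suc k)) y * f y)"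
    unfolding limit_moment_def using expectation_reversal[where f=f and g="m (Suc k)", OF reversal f m] by simp
  also have "\<dots> = measure_pmf.expectation \<mu> (\<lambda>y. \<theta> * kexp Q' (m (Suc k)) y * f y)"
    by (simp add: mult.assoc)
  also have "\<dots> = measure_pmf.expectation \<mu> (\<lambda>y. (\<theta> + real (Suc k)) * (m (Suc k) y * f y) - real (Suc k) * (m k y * (h y * f y)))"
  proof (intro Bochner_Integration.integral_cong refl)
    fix y
    have "\<theta> * kexp Q' (m (Suc k)) y = (\<theta> + real (Suc k)) * m (Suc k) y - real (Suc k) * h y * m k y"
      using moment_equation[of k y] by simp
    then show "\<theta> * kexp Q' (m (Suc k)) y * f y = (\<theta> + real (Suc k)) * (m (Suc k) y * f y) - real (Suc k) * (m k y * (h y * f y))"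
      by (simp only:) (simp add: algebra_simps)
  qed
  also have "\<dots> = (\<theta> + real (Suc k)) * limit_moment (Suc k) f - real (Suc k) * limit_moment k (\<lambda>y. h y * f y)"
    unfolding limit_moment_def using i[of f, OF f] i[of "\<lambda>y. h y * f y", OF mult_01[OF h f]] by simp
  finally show ?thesis by (simp add: algebra_simps)
qed

abbreviation "Qpow j f \<equiv> (kexp Q ^^ j) f"

lemma Qpow_01: "(\<And>y. f y \<in> {0..1}) \<Longrightarrow> Qpow j f y \<in> {0..1}"
  by (induction j arbitrary: y) (simp, simp only: funpow.simps o_def, rule kexp_01, auto)

lemma Qpow_linear:
  assumes "\<And>y. f y \<in> {0..1}" "\<And>y. g y \<in> {0..1}"
  shows "Qpow j (\<lambda>y. a * f y + b * g y) = (\<lambda>y. a * Qpow j f y + b * Qpow j g y)"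
  by (induction j) (use kexp_linear[of "Qpow _ f" "Qpow _ g", OF Qpow_01[of f] Qpow_01[of g]] assms in auto)

lemma expectation_Qpow:
  "(\<And>y. f y \<in> {0..1}) \<Longrightarrow> measure_pmf.expectation p (Qpow j f) = measure_pmf.expectation (((\<lambda>p. bind_pmf p Q) ^^ j) p) f"
proof (induction j arbitrary: f)
  case (Suc j)
  have "measure_pmf.expectation p (Qpow (Suc j) f) = measure_pmf.expectation p (Qpow j (kexp Q f))"
    by (simp only: funpow_Suc_right o_def)
  also have "\<dots> = measure_pmf.expectation (((\<lambda>p. bind_pmf p Q) ^^ j) p) (kexp Q f)"
    by (intro Suc.IH kexp_01 Suc.prems)
  also have "\<dots> = measure_pmf.expectation (((\<lambda>p. bind_pmf p Q) ^^ Suc j) p) f"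
    using Suc.prems by (simp add: kexp_def[abs_def] expectation_bind_pmf[where B=1] abs_le_iff order_trans[of _ 0])
  finally show ?case .
qed simp

section \<open>Order zero: the law of the current state\<close>

lemma occ_moment_0_step:
  assumes n: "1 \<le> n" and f: "\<And>y. f y \<in> {0..1}"
  shows "occ_moment 0 (Suc n) f = occ_moment 0 n (kexp (\<kappa> n) f)"
  using expectation_step[OF n, of "\<lambda>_. 1" f] f by (simp add: occ_moment_def)

lemma occ_moment_0_Suc:
  assumes n: "1 \<le> n" and f: "\<And>y. f y \<in> {0..1}"
  shows "occ_moment 0 (Suc n) f = (1 - rate n) * occ_moment 0 n f + rate n * occ_moment 0 n (kexp Q f)"
  unfolding occ_moment_0_step[OF n, of f, OF f] kexp_kernel[of f, OF f, abs_def]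
  by (intro occ_moment_linear f kexp_01)

text \<open>The powers of \<open>Q\<close> act on the test function but not on the target, since
  \<open>\<mu>\<close> is invariant under \<open>Q\<close>. The supremum over all test functions
  makes the error stable under the kernels, which map test functions to test functions.\<close>

definition error_0 :: "nat \<Rightarrow> nat \<Rightarrow> real" where
  "error_0 j n = (SUP f\<in>test_functions. \<bar>occ_moment 0 n (Qpow j f) - limit_moment 0 f\<bar>)"

definition error :: "nat \<Rightarrow> nat \<Rightarrow> real" where
  "error k n = (SUP f\<in>test_functions. \<bar>occ_moment k n f - limit_moment k f\<bar>)"

lemma test_functions_nonempty: "test_functions \<noteq> {}"
  by (auto intro!: exI[of _ "\<lambda>_. 0"])

lemma error_0_upper:
  assumes f: "\<And>y. f y \<in> {0..1}"
  shows "\<bar>occ_moment 0 n (Qpow j f) - limit_moment 0 f\<bar> \<le> error_0 j n"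
  unfolding error_0_def
proof (rule cSUP_upper)
  show "bdd_above ((\<lambda>f. \<bar>occ_moment 0 n (Qpow j f) - limit_moment 0 f\<bar>) ` test_functions)"
  proof (rule bdd_aboveI2)
    fix f :: "'a \<Rightarrow> real" assume "f \<in> test_functions"
    then have f: "\<And>y. f y \<in> {0..1}" by blast
    show "\<bar>occ_moment 0 n (Qpow j f) - limit_moment 0 f\<bar> \<le> 1"
      using occ_moment_01[of "Qpow j f" 0 n, OF Qpow_01[of f, OF f]] limit_moment_01[of f 0, OF f] by auto
  qed
qed (use f in blast)

lemma error_upper:
  assumes f: "\<And>y. f y \<in> {0..1}"
  shows "\<bar>occ_moment k n f - limit_moment k f\<bar> \<le> error k n"
  unfolding error_def
proof (rule cSUP_upper)
  show "bdd_above ((\<lambda>f. \<bar>occ_moment k n f - limit_moment k f\<bar>) ` test_functions)"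
  proof (rule bdd_aboveI2)
    fix f :: "'a \<Rightarrow> real" assume "f \<in> test_functions"
    then have f: "\<And>y. f y \<in> {0..1}" by blast
    show "\<bar>occ_moment k n f - limit_moment k f\<bar> \<le> 1"
      using occ_moment_01[of f k n, OF f] limit_moment_01[of f k, OF f] by auto
  qed
qed (use f in blast)

text \<open>A step of the chain is a mixture of staying and a \<open>Q\<close>-step, so level
  \<open>j\<close> is averaged with level \<open>Suc j\<close> at weight
  \<open>rate n\<close>.\<close>

lemma error_0_step:
  assumes n: "1 \<le> n" and r: "rate n \<in> {0..1}"
  shows "error_0 j (Suc n) \<le> (1 - rate n) * error_0 j n + rate n * error_0 (Suc j) n"
  unfolding error_0_def[of j "Suc n"]
proof (rule cSUP_least[OF test_functions_nonempty])
  fix f :: "'a \<Rightarrow> real" assume "f \<in> test_functions"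
  then have f: "\<And>y. f y \<in> {0..1}" by blast
  let ?L = "limit_moment 0 f"
  have eq: "occ_moment 0 (Suc n) (Qpow j f) - ?L = (1 - rate n) * (occ_moment 0 n (Qpow j f) - ?L) + rate n * (occ_moment 0 n (Qpow (Suc j) f) - ?L)"
    using occ_moment_0_Suc[of n "Qpow j f", OF n Qpow_01[of f j, OF f]] by (simp add: algebra_simps)
  have "\<bar>occ_moment 0 (Suc n) (Qpow j f) - ?L\<bar> \<le> (1 - rate n) * \<bar>occ_moment 0 n (Qpow j f) - ?L\<bar> + rate n * \<bar>occ_moment 0 n (Qpow (Suc j) f) - ?L\<bar>"
    unfolding eq using r by (intro order_trans[OF abs_triangle_ineq]) (simp add: abs_mult)
  also have "\<dots> \<le> (1 - rate n) * error_0 j n + rate n * error_0 (Suc j) n"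
    by (rule add_mono[OF mult_left_mono[OF error_0_upper[of f n j, OF f]] mult_left_mono[OF error_0_upper[of f n "Suc j", OF f]]])
      (use r in simp_all)
  finally show "\<bar>occ_moment 0 (Suc n) (Qpow j f) - ?L\<bar> \<le> (1 - rate n) * error_0 j n + rate n * error_0 (Suc j) n" .
qed

text \<open>
  All kernels commute with \<open>Q\<close>, so \<open>j\<close> applications of \<open>Q\<close> can be moved to the initial law, which makes
  the error small uniformly in time; the averaging recursion then transports smallness from \<open>j + 1\<close> to \<open>j\<close>.
\<close>

lemma error_0_uniform:
  obtains \<epsilon> :: "nat \<Rightarrow> real" where "\<epsilon> \<longlonglongrightarrow> 0" "\<And>j n. 1 \<le> n \<Longrightarrow> error_0 j n \<le> \<epsilon> j"
proof -
  obtain \<epsilon> :: "nat \<Rightarrow> real" where lim: "\<epsilon> \<longlonglongrightarrow> 0"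
    and \<epsilon>: "\<And>n f. (\<And>x. f x \<in> {0..1}) \<Longrightarrow>
      \<bar>measure_pmf.expectation (((\<lambda>p. bind_pmf p Q) ^^ n) ini) f - measure_pmf.expectation \<mu> f\<bar> \<le> \<epsilon> n"
    using Scheffe_pmf[OF ergodic] by blast
  have "\<bar>occ_moment 0 (Suc n) (Qpow j f) - limit_moment 0 f\<bar> \<le> \<epsilon> j" if "\<And>y. f y \<in> {0..1}" for j n f
    using that
  proof (induction n arbitrary: f)
    case 0
    then show ?case
      using \<epsilon>[of f j] expectation_init[of "Qpow j f", OF Qpow_01[of f j]]
      by (simp add: occ_moment_def limit_moment_0 expectation_Qpow)
  next
    case (Suc n)
    let ?g = "kexp (\<kappa> (Suc n)) f"
    have k01: "\<And>y. ?g y \<in> {0..1}" "\<And>y. kexp Q f y \<in> {0..1}" by (intro kexp_01 Suc.prems)+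
    have g: "?g = (\<lambda>y. (1 - rate (Suc n)) * f y + rate (Suc n) * kexp Q f y)"
      using kexp_kernel[of f, OF Suc.prems] by blast
    have "kexp (\<kappa> (Suc n)) (Qpow j f) = Qpow j ?g"
      unfolding g Qpow_linear[of f "kexp Q f", OF Suc.prems k01(2)] using kexp_kernel[of "Qpow j f", OF Qpow_01[of f, OF Suc.prems]]
      by (auto simp: funpow_swap1)
    moreover have "limit_moment 0 ?g = limit_moment 0 f"
      unfolding g limit_moment_linear[of f "kexp Q f", OF Suc.prems k01(2)] limit_moment_0_kexp[of f, OF Suc.prems] by (simp add: algebra_simps)
    ultimately show ?case
      using Suc.IH[of ?g, OF k01(1)] occ_moment_0_step[of "Suc n" "Qpow j f", OF _ Qpow_01[of f, OF Suc.prems]] by simp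
  qed
  then have "error_0 j n \<le> \<epsilon> j" if "1 \<le> n" for j n
    unfolding error_0_def using that by (intro cSUP_least[OF test_functions_nonempty]) (cases n; auto)
  with lim show ?thesis by (rule that)
qed

lemma eventually_error_0:
  assumes "e > 0" shows "\<forall>\<^sub>F n in sequentially. error 0 n \<le> e"
proof -
  obtain \<epsilon> :: "nat \<Rightarrow> real" where lim: "\<epsilon> \<longlonglongrightarrow> 0" and \<epsilon>: "\<And>j n. 1 \<le> n \<Longrightarrow> error_0 j n \<le> \<epsilon> j"
    using error_0_uniform by blast
  \<comment> \<open>Induction on the number \<open>d\<close> of levels between \<open>j\<close> and
    the level where the uniform bound is used; each pass through the averaging recursion spends half
    of the current \<open>e\<close>.\<close>
  have ev: "\<forall>\<^sub>F n in sequentially. error_0 j n \<le> \<epsilon> (j + d) + e" if "e > 0" for d j e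
    using that
  proof (induction d arbitrary: j e)
    case 0
    show ?case using eventually_ge_at_top[of 1]
      by eventually_elim (use \<epsilon>[of _ j] 0 in \<open>simp add: add_increasing2\<close>)
  next
    case (Suc d)
    have "\<forall>\<^sub>F n in sequentially. error_0 j n \<le> (\<epsilon> (Suc j + d) + e / 2) + e / 2"
    proof (rule eventually_le_of_averaging_recursion[where p=rate])
      show "\<forall>\<^sub>F n in sequentially. error_0 j (Suc n) \<le> (1 - rate n) * error_0 j n + rate n * error_0 (Suc j) n"
        using eventually_rate[of 0] by eventually_elim (rule error_0_step, blast+)
      show "\<forall>\<^sub>F n in sequentially. 0 \<le> rate n \<and> rate n \<le> 1"
        using eventually_rate[of 0] by eventually_elim auto
      show "\<forall>\<^sub>F n in sequentially. error_0 (Suc j) n \<le> \<epsilon> (Suc j + d) + e / 2"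
        using Suc.prems by (intro Suc.IH) simp
    qed (use Suc.prems not_summable_rate in auto)
    then show ?case by (simp add: add.commute)
  qed
  obtain d where "\<epsilon> d < e / 2"
    using order_tendstoD(2)[OF lim, of "e / 2"] \<open>e > 0\<close> by (auto simp: eventually_sequentially)
  moreover have "\<forall>\<^sub>F n in sequentially. error_0 0 n \<le> \<epsilon> (0 + d) + e / 2" using \<open>e > 0\<close> by (intro ev) simp
  ultimately have "\<forall>\<^sub>F n in sequentially. error_0 0 n \<le> e" by (auto elim!: eventually_mono)
  then show ?thesis by (simp add: error_0_def error_def)
qed

text \<open>The new average is the old one plus \<open>(h (T (Suc n)) - occ n) / Suc n\<close>;
  expanding its power to first order produces the weight \<open>a\<close>. The remainder is stated
  as \<open>a\<close> times a null sequence, the form that the averaging recursion absorbs.\<close>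

lemma occ_moment_step:
  fixes k n :: nat
  assumes n: "1 \<le> n" and f: "\<And>y. f y \<in> {0..1}"
  defines "a \<equiv> real (Suc k) / real (Suc n)"
  shows "\<bar>occ_moment (Suc k) (Suc n) f - ((1 - a) * occ_moment (Suc k) n (kexp (\<kappa> n) f)
      + a * occ_moment k n (kexp (\<kappa> n) (\<lambda>y. h y * f y)))\<bar> \<le> a * (real (Suc k) / real n)"
proof -
  let ?u = "occ n" and ?F = "\<lambda>\<omega>. f (T (Suc n) \<omega>)" and ?H = "\<lambda>\<omega>. h (T (Suc n) \<omega>)"
  let ?d = "\<lambda>\<omega>. (?H \<omega> - ?u \<omega>) / real (Suc n)"
  have hf: "\<And>y. h y * f y \<in> {0..1}" by (intro mult_01 h f)
  have occ_Suc: "occ (Suc n) \<omega> = ?u \<omega> + ?d \<omega>" for \<omega>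
  proof -
    have "real n * ?u \<omega> = (\<Sum>j\<in>{1..n}. h (T j \<omega>))" using n by (simp add: occ_def)
    then have "occ (Suc n) \<omega> = (real n * ?u \<omega> + ?H \<omega>) / real (Suc n)" by (simp add: occ_def[of "Suc n"])
    then show ?thesis by (simp add: field_simps)
  qed
  have main: "occ n \<omega> ^ Suc k + (1 + real k) * occ n \<omega> ^ k * ?d \<omega> = (1 - a) * ?u \<omega> ^ Suc k + a * (?u \<omega> ^ k * ?H \<omega>)" for \<omega>
  proof -
    have "(1 + real k) * occ n \<omega> ^ k * ?d \<omega> = a * (?u \<omega> ^ k * (?H \<omega> - ?u \<omega>))"
      by (simp add: a_def)
    then show ?thesis by (simp only:) (simp add: algebra_simps)
  qed
  have i: "integrable M (\<lambda>\<omega>. ?u \<omega> ^ l * g (T (Suc n) \<omega>))" if "\<And>y. g y \<in> {0..1}" for g l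
    using mult_01[OF power_01[OF occ_01] that[of "T _ _"]] by (intro integrable_const_bound[where B=1]) (auto intro!: AE_I2)
  have i2: "integrable M (\<lambda>\<omega>. occ (Suc n) \<omega> ^ Suc k * ?F \<omega>)" by (rule integrable_occ[of f, OF f])
  have step: "expectation (\<lambda>\<omega>. ?u \<omega> ^ l * g (T (Suc n) \<omega>)) = occ_moment l n (kexp (\<kappa> n) g)" if "\<And>y. g y \<in> {0..1}" for g l
    unfolding occ_moment_def
    by (rule expectation_step[OF n _ power_01[OF occ_01] that]) (intro borel_measurable_power measurable_past_occ)
  define G where "G \<omega> = (1 - a) * (?u \<omega> ^ Suc k * ?F \<omega>) + a * (?u \<omega> ^ k * (?H \<omega> * ?F \<omega>))" for \<omega>
  have iG: "integrable M G" unfolding G_def using i[of f "Suc k", OF f] i[of "\<lambda>y. h y * f y" k, OF hf] by auto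
  have EG: "expectation G = (1 - a) * occ_moment (Suc k) n (kexp (\<kappa> n) f) + a * occ_moment k n (kexp (\<kappa> n) (\<lambda>y. h y * f y))"
    unfolding G_def using i[of f "Suc k", OF f] i[of "\<lambda>y. h y * f y" k, OF hf] step[of f "Suc k", OF f] step[of "\<lambda>y. h y * f y" k, OF hf]
    by simp
  have "\<bar>occ (Suc n) \<omega> ^ Suc k * ?F \<omega> - G \<omega>\<bar> \<le> a * (real (Suc k) / real n)" for \<omega>
  proof -
    have "\<bar>?H \<omega> - ?u \<omega>\<bar> \<le> 1" using h[of "T (Suc n) \<omega>"] occ_01[of n \<omega>] by auto
    then have d: "(?d \<omega>)\<^sup>2 \<le> (1 / real (Suc n))\<^sup>2" by (subst abs_le_square_iff[symmetric]) (simp add: divide_right_mono)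
    have u: "\<bar>?u \<omega>\<bar> \<le> 1" "\<bar>?u \<omega> + ?d \<omega>\<bar> \<le> 1"
      unfolding occ_Suc[symmetric] using occ_01[of n \<omega>] occ_01[of "Suc n" \<omega>] by auto
    have "occ (Suc n) \<omega> ^ Suc k * ?F \<omega> - G \<omega> = (occ (Suc n) \<omega> ^ Suc k - ((1 - a) * ?u \<omega> ^ Suc k + a * (?u \<omega> ^ k * ?H \<omega>))) * ?F \<omega>"
      unfolding G_def by (simp add: algebra_simps)
    also have "\<dots> = ((?u \<omega> + ?d \<omega>) ^ Suc k - ?u \<omega> ^ Suc k - (1 + real k) * ?u \<omega> ^ k * ?d \<omega>) * ?F \<omega>"
      unfolding main[symmetric] occ_Suc by simp
    also have "\<bar>\<dots>\<bar> \<le> ((1 + real k)\<^sup>2 * (?d \<omega>)\<^sup>2) * 1"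
      unfolding abs_mult using f[of "T (Suc n) \<omega>"] power_add_first_order[OF u, of k] by (intro mult_mono) auto
    also have "\<dots> \<le> (1 + real k)\<^sup>2 * (1 / real (Suc n))\<^sup>2" using d by (simp add: mult_left_mono)
    also have "\<dots> = a * (real (Suc k) / real (Suc n))" by (simp add: a_def power2_eq_square)
    also have "\<dots> \<le> a * (real (Suc k) / real n)"
      using n by (intro mult_left_mono divide_left_mono) (auto simp: a_def)
    finally show ?thesis .
  qed
  then have "\<bar>expectation (\<lambda>\<omega>. occ (Suc n) \<omega> ^ Suc k * ?F \<omega> - G \<omega>)\<bar> \<le> expectation (\<lambda>_. a * (real (Suc k) / real n))"
    using i2 iG by (intro order_trans[OF integral_abs_bound] integral_mono) auto
  moreover have e: "occ_moment (Suc k) (Suc n) f = expectation (\<lambda>\<omega>. occ (Suc n) \<omega> ^ Suc k * ?F \<omega>)"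
    by (simp only: occ_moment_def)
  ultimately show ?thesis unfolding EG[symmetric] e using i2 iG by (simp add: prob_space)
qed

text \<open>The limit functional solves the same recursion up to a smaller error: the contributions
  of order 1/n, from the kernel and from the weight \<open>a\<close>, cancel by
  \<open>limit_moment_kernel_Suc\<close>, and a multiple of \<open>a / n\<close> is left.\<close>

lemma limit_moment_step:
  fixes k n :: nat
  assumes n: "1 \<le> n" and r: "rate n = \<theta> / real n" and f: "\<And>y. f y \<in> {0..1}"
  defines "a \<equiv> real (Suc k) / real (Suc n)"
  shows "\<bar>(1 - a) * limit_moment (Suc k) (kexp (\<kappa> n) f) + a * limit_moment k (kexp (\<kappa> n) (\<lambda>y. h y * f y))
      - limit_moment (Suc k) f\<bar> \<le> a * ((real k + \<theta>) / real n)"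
proof -
  let ?g = "\<lambda>y. h y * f y"
  have hf: "\<And>y. ?g y \<in> {0..1}" by (intro mult_01 h f)
  have Pn: "limit_moment l (kexp (\<kappa> n) g) = limit_moment l g + \<theta> / real n * (limit_moment l (kexp Q g) - limit_moment l g)"
    if g: "\<And>y. g y \<in> {0..1}" for l g
  proof -
    have "kexp (\<kappa> n) g = (\<lambda>y. (1 - rate n) * g y + rate n * kexp Q g y)" using kexp_kernel[of g, OF g] by blast
    then show ?thesis using limit_moment_linear[of g "kexp Q g" l "1 - rate n" "rate n", OF g kexp_01[of g, OF g]]
      by (simp add: r algebra_simps)
  qed
  define x y z where "x = limit_moment (Suc k) f" and "y = limit_moment k ?g"
    and "z = limit_moment k (kexp Q ?g)"
  have xyz: "x \<in> {0..1}" "y \<in> {0..1}" "z \<in> {0..1}"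
    unfolding x_def y_def z_def by (intro limit_moment_01 f hf kexp_01)+
  have 1: "limit_moment (Suc k) (kexp (\<kappa> n) f) = x + real (Suc k) / real n * (x - y)"
    unfolding Pn[of f, OF f] x_def y_def using limit_moment_kernel_Suc[of f k, OF f] by (simp add: field_simps)
  have 2: "limit_moment k (kexp (\<kappa> n) ?g) = y + \<theta> / real n * (z - y)"
    unfolding Pn[of ?g, OF hf] y_def z_def ..
  have a: "0 \<le> a" by (simp add: a_def)
  \<comment> \<open>The cancellation: each of the two terms is of order 1/n, their difference of
    order 1/n^2.\<close>
  have coeff: "(1 - a) * (real (Suc k) / real n) - a = - (a * (real k / real n))"
  proof -
    have "a * (1 + real n) = 1 + real k" by (simp add: a_def)
    then have "(1 - a) * real (Suc k) - a * real n = - (a * real k)" by (simp add: algebra_simps)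
    moreover have "(1 - a) * (real (Suc k) / real n) - a = ((1 - a) * real (Suc k) - a * real n) / real n"
      using n by (simp add: diff_divide_distrib)
    ultimately show ?thesis by simp
  qed
  define r' s' where "r' = real k / real n" and "s' = \<theta> / real n"
  have "(1 - a) * (x + real (Suc k) / real n * (x - y)) + a * (y + \<theta> / real n * (z - y)) - x
      = ((1 - a) * (real (Suc k) / real n) - a) * (x - y) + a * (\<theta> / real n * (z - y))"
    by (simp add: algebra_simps)
  also have "\<dots> = a * (r' * (y - x) + s' * (z - y))"
    unfolding coeff r'_def[symmetric] s'_def[symmetric] by (simp add: algebra_simps)
  finally have eq: "(1 - a) * (x + real (Suc k) / real n * (x - y)) + a * (y + \<theta> / real n * (z - y)) - x
      = a * (r' * (y - x) + s' * (z - y))" .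
  have rs: "0 \<le> r'" "0 \<le> s'" using theta by (auto simp: r'_def s'_def)
  have "\<bar>r' * (y - x)\<bar> \<le> r' * 1" "\<bar>s' * (z - y)\<bar> \<le> s' * 1"
    using rs xyz by (auto simp: abs_mult intro!: mult_left_le)
  then have "\<bar>r' * (y - x) + s' * (z - y)\<bar> \<le> r' + s'" by simp
  then have "\<bar>a * (r' * (y - x) + s' * (z - y))\<bar> \<le> a * (r' + s')"
    using a by (simp add: abs_mult mult_left_mono)
  also have "r' + s' = (real k + \<theta>) / real n" by (simp add: r'_def s'_def add_divide_distrib)
  finally show ?thesis unfolding 1 2 eq x_def[symmetric] .

qed

text \<open>Difference of the two recursions. The constant collects \<open>Suc k\<close> from
  \<open>occ_moment_step\<close> and \<open>k + \<theta>\<close> from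
  \<open>limit_moment_step\<close>, rounded up; \<open>k \<le> n\<close> gives
  \<open>a \<le> 1\<close>, so the combination is convex.\<close>

lemma error_step:
  fixes k n :: nat
  assumes n: "1 \<le> n" and r: "rate n = \<theta> / real n" and k: "k \<le> n"
  defines "a \<equiv> real (Suc k) / real (Suc n)"
  shows "error (Suc k) (Suc n) \<le> (1 - a) * error (Suc k) n + a * (error k n + (2 * real (Suc k) + \<theta>) / real n)"
  unfolding error_def[of "Suc k" "Suc n"]
proof (rule cSUP_least[OF test_functions_nonempty])
  fix f :: "'a \<Rightarrow> real" assume "f \<in> test_functions"
  then have f: "\<And>y. f y \<in> {0..1}" by blast
  let ?g = "\<lambda>y. h y * f y"
  have hf: "\<And>y. ?g y \<in> {0..1}" by (intro mult_01 h f)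
  have a: "0 \<le> a" "a \<le> 1" using k by (auto simp: a_def)
  let ?A = "occ_moment (Suc k) n (kexp (\<kappa> n) f)" and ?B = "occ_moment k n (kexp (\<kappa> n) ?g)"
  let ?A' = "limit_moment (Suc k) (kexp (\<kappa> n) f)" and ?B' = "limit_moment k (kexp (\<kappa> n) ?g)"
  have "\<bar>?A - ?A'\<bar> \<le> error (Suc k) n" "\<bar>?B - ?B'\<bar> \<le> error k n"
    using error_upper[of "kexp (\<kappa> n) f" "Suc k" n, OF kexp_01[of f, OF f]]
      error_upper[of "kexp (\<kappa> n) ?g" k n, OF kexp_01[of ?g, OF hf]] by auto
  then have "(1 - a) * \<bar>?A - ?A'\<bar> \<le> (1 - a) * error (Suc k) n" "a * \<bar>?B - ?B'\<bar> \<le> a * error k n"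
    using a by (auto intro: mult_left_mono)
  moreover have "\<bar>(1 - a) * (?A - ?A') + a * (?B - ?B')\<bar> \<le> (1 - a) * \<bar>?A - ?A'\<bar> + a * \<bar>?B - ?B'\<bar>"
    using a by (intro order_trans[OF abs_triangle_ineq]) (simp add: abs_mult)
  ultimately have 1: "\<bar>((1 - a) * ?A + a * ?B) - ((1 - a) * ?A' + a * ?B')\<bar> \<le> (1 - a) * error (Suc k) n + a * error k n"
    by (simp add: algebra_simps)
  have 2: "\<bar>occ_moment (Suc k) (Suc n) f - ((1 - a) * ?A + a * ?B)\<bar> \<le> a * (real (Suc k) / real n)"
    unfolding a_def by (rule occ_moment_step[of n f, OF n f])
  have 3: "\<bar>((1 - a) * ?A' + a * ?B') - limit_moment (Suc k) f\<bar> \<le> a * ((real k + \<theta>) / real n)"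
    unfolding a_def by (rule limit_moment_step[of n f, OF n r f])
  have "\<bar>occ_moment (Suc k) (Suc n) f - limit_moment (Suc k) f\<bar>
      \<le> (1 - a) * error (Suc k) n + a * error k n + (a * (real (Suc k) / real n) + a * ((real k + \<theta>) / real n))"
    using 1 2 3 by linarith
  also have "a * (real (Suc k) / real n) + a * ((real k + \<theta>) / real n) = a * ((real (Suc k) + (real k + \<theta>)) / real n)"
    by (simp add: add_divide_distrib algebra_simps)
  also have "\<dots> \<le> a * ((2 * real (Suc k) + \<theta>) / real n)"
    using a by (intro mult_left_mono divide_right_mono) auto
  finally show "\<bar>occ_moment (Suc k) (Suc n) f - limit_moment (Suc k) f\<bar>
      \<le> (1 - a) * error (Suc k) n + a * (error k n + (2 * real (Suc k) + \<theta>) / real n)"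
    by (simp add: algebra_simps)
qed

lemma eventually_error: "e > 0 \<Longrightarrow> \<forall>\<^sub>F n in sequentially. error k n \<le> e"
proof (induction k arbitrary: e)
  case 0
  then show ?case by (rule eventually_error_0)
next
  case (Suc k)
  have "\<forall>\<^sub>F n in sequentially. error (Suc k) n \<le> e / 2 + e / 2"
  proof (rule eventually_le_of_averaging_recursion[where p="\<lambda>n. real (Suc k) / real (Suc n)"])
    show "\<forall>\<^sub>F n in sequentially. error (Suc k) (Suc n) \<le> (1 - real (Suc k) / real (Suc n)) * error (Suc k) n
        + real (Suc k) / real (Suc n) * (error k n + (2 * real (Suc k) + \<theta>) / real n)"
      using eventually_rate[of k] by eventually_elim (rule error_step, blast+)
    show "\<forall>\<^sub>F n in sequentially. 0 \<le> real (Suc k) / real (Suc n) \<and> real (Suc k) / real (Suc n) \<le> 1"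
      using eventually_ge_at_top[of k] by eventually_elim auto
    show "\<not> summable (\<lambda>n. real (Suc k) / real (Suc n))" by (rule not_summable_const_div_Suc) simp
    have "(\<lambda>n. (2 * real (Suc k) + \<theta>) / real n) \<longlonglongrightarrow> 0" by (rule lim_const_over_n)
    then have "\<forall>\<^sub>F n in sequentially. (2 * real (Suc k) + \<theta>) / real n < e / 4"
      using Suc.prems by (intro order_tendstoD(2)) auto
    moreover have "\<forall>\<^sub>F n in sequentially. error k n \<le> e / 4" using Suc.prems by (intro Suc.IH) simp
    ultimately show "\<forall>\<^sub>F n in sequentially. error k n + (2 * real (Suc k) + \<theta>) / real n \<le> e / 2"
      by eventually_elim linarith
  qed (use Suc.prems in simp)
  then show ?case by simp
qed

lemma occ_power_tendsto: "(\<lambda>n. expectation (\<lambda>\<omega>. occ n \<omega> ^ k)) \<longlonglongrightarrow> measure_pmf.expectation \<mu> (m k)"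
proof (rule tendstoI)
  fix e :: real assume "e > 0"
  then have "\<forall>\<^sub>F n in sequentially. error k n \<le> e / 2" by (intro eventually_error) simp
  then show "\<forall>\<^sub>F n in sequentially. dist (expectation (\<lambda>\<omega>. occ n \<omega> ^ k)) (measure_pmf.expectation \<mu> (m k)) < e"
  proof eventually_elim
    case (elim n)
    then show ?case using error_upper[of "\<lambda>_. 1" k n] \<open>e > 0\<close>
      by (simp add: occ_moment_def limit_moment_def dist_real_def)
  qed
qed

end

subsection \<open>Weak convergence of random probability vectors\<close>

text \<open>The Pasch-Hausdorff envelope, the inf-convolution of \<open>f\<close> with a multiple of
  the distance. Only the values of \<open>f\<close> on \<open>A\<close> enter, yet it is defined on
  the whole space.\<close>

definition lipschitz_regularization :: "'b::metric_space set \<Rightarrow> ('b \<Rightarrow> real) \<Rightarrow> nat \<Rightarrow> 'b \<Rightarrow> real" where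
  "lipschitz_regularization A f m p = (INF q\<in>A. f q + real m * dist p q)"

context
  fixes A :: "'b::metric_space set" and f :: "'b \<Rightarrow> real" and B :: real
  assumes A: "A \<noteq> {}" and cont: "continuous_on A f" and B: "\<And>q. q \<in> A \<Longrightarrow> \<bar>f q\<bar> \<le> B"
begin

private lemma bdd: "bdd_below ((\<lambda>q. f q + real m * dist p q) ` A)"
proof (rule bdd_belowI2)
  fix q assume "q \<in> A"
  then show "- B \<le> f q + real m * dist p q" using B[of q] by (simp add: add_increasing2 abs_le_iff)
qed

lemma lipschitz_regularization_ge: "- B \<le> lipschitz_regularization A f m p"
  unfolding lipschitz_regularization_def
proof (rule cINF_greatest[OF A])
  fix q assume "q \<in> A"
  then show "- B \<le> f q + real m * dist p q" using B[of q] by (simp add: add_increasing2 abs_le_iff)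
qed

lemma lipschitz_regularization_le: "p \<in> A \<Longrightarrow> lipschitz_regularization A f m p \<le> f p"
  unfolding lipschitz_regularization_def using cINF_lower[OF bdd[of m p], of p] by simp

lemma lipschitz_regularization_diff:
  "lipschitz_regularization A f m p \<le> lipschitz_regularization A f m p' + real m * dist p p'"
proof -
  have "lipschitz_regularization A f m p - real m * dist p p' \<le> lipschitz_regularization A f m p'"
    unfolding lipschitz_regularization_def[of A f m p']
  proof (rule cINF_greatest[OF A])
    fix q assume q: "q \<in> A"
    have "lipschitz_regularization A f m p \<le> f q + real m * dist p q"
      unfolding lipschitz_regularization_def by (rule cINF_lower[OF bdd q])
    also have "\<dots> \<le> f q + real m * (dist p p' + dist p' q)"
      by (intro add_left_mono mult_left_mono dist_triangle) auto
    finally show "lipschitz_regularization A f m p - real m * dist p p' \<le> f q + real m * dist p' q"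
      by (simp add: algebra_simps)
  qed
  then show ?thesis by simp
qed

lemma continuous_lipschitz_regularization: "continuous_on UNIV (lipschitz_regularization A f m)"
proof (rule lipschitz_on_continuous_on)
  show "(real m)-lipschitz_on UNIV (lipschitz_regularization A f m)"
  proof (rule lipschitz_onI)
    fix p p' show "dist (lipschitz_regularization A f m p) (lipschitz_regularization A f m p') \<le> real m * dist p p'"
      using lipschitz_regularization_diff[of m p p'] lipschitz_regularization_diff[of m p' p]
      by (auto simp: dist_real_def dist_commute abs_le_iff)
  qed simp
qed

text \<open>Points near \<open>p\<close> are controlled by continuity on \<open>A\<close>; for
  points at distance at least \<open>d\<close> the penalty \<open>m * d\<close> outweighs the
  oscillation \<open>2 * B\<close>.\<close>

lemma lipschitz_regularization_tendsto:
  assumes p: "p \<in> A" shows "(\<lambda>m. lipschitz_regularization A f m p) \<longlonglongrightarrow> f p"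
proof (rule LIMSEQ_I)
  fix e :: real assume "e > 0"
  then obtain d where d: "d > 0" "\<And>q. q \<in> A \<Longrightarrow> dist q p < d \<Longrightarrow> dist (f q) (f p) < e / 2"
    using cont p unfolding continuous_on_iff by (metis half_gt_zero)
  obtain m0 where m0: "2 * B \<le> real m0 * d"
    using reals_Archimedean3[OF d(1)] by (meson less_imp_le)
  show "\<exists>m0. \<forall>m\<ge>m0. norm (lipschitz_regularization A f m p - f p) < e"
  proof (intro exI allI impI)
    fix m assume m: "m0 \<le> m"
    have "f p - e / 2 \<le> lipschitz_regularization A f m p"
      unfolding lipschitz_regularization_def
    proof (rule cINF_greatest[OF A])
      fix q assume q: "q \<in> A"
      show "f p - e / 2 \<le> f q + real m * dist p q"
      proof (cases "dist q p < d")
        case True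
        then have "f p - e / 2 \<le> f q" using d(2)[OF q True] unfolding dist_real_def by linarith
        moreover have "0 \<le> real m * dist p q" by simp
        ultimately show ?thesis by linarith
      next
        case False
        have "real m0 * d \<le> real m * dist p q"
          using False m d(1) by (intro mult_mono) (auto simp: dist_commute)
        then show ?thesis using m0 B[OF q] B[OF p] \<open>e > 0\<close> by linarith
      qed
    qed
    then show "norm (lipschitz_regularization A f m p - f p) < e"
      using lipschitz_regularization_le[OF p, of m] \<open>e > 0\<close> by simp
  qed
qed

end

text \<open>One half of a portmanteau argument, by continuous minorants of \<open>f\<close>. That
  \<open>Z\<close> lies in \<open>A\<close> makes their means converge to that of \<open>f\<close>;
  that \<open>Y n\<close> lies in \<open>A\<close> makes them minorants along the sequence.\<close>

lemma eventually_expectation_ge: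
  fixes Y :: "nat \<Rightarrow> 'm \<Rightarrow> 'b::metric_space" and Z :: "'n \<Rightarrow> 'b" and f :: "'b \<Rightarrow> real"
  assumes "prob_space M" "prob_space N"
    and [measurable]: "\<And>n. Y n \<in> borel_measurable M" "Z \<in> borel_measurable N" "f \<in> borel_measurable borel"
    and Y: "\<forall>\<^sub>F n in sequentially. AE \<omega> in M. Y n \<omega> \<in> A" and Z: "AE \<omega> in N. Z \<omega> \<in> A"
    and f: "continuous_on A f" "\<And>q. q \<in> A \<Longrightarrow> \<bar>f q\<bar> \<le> B"
    and conv: "\<And>g. continuous_on UNIV g \<Longrightarrow> (\<And>q. \<bar>g q\<bar> \<le> B) \<Longrightarrow> (\<lambda>n. \<integral>\<omega>. g (Y n \<omega>) \<partial>M) \<longlonglongrightarrow> (\<integral>\<omega>. g (Z \<omega>) \<partial>N)"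
    and e: "e > 0"
  shows "\<forall>\<^sub>F n in sequentially. (\<integral>\<omega>. f (Z \<omega>) \<partial>N) - e \<le> (\<integral>\<omega>. f (Y n \<omega>) \<partial>M)"
proof -
  interpret M: prob_space M by fact
  interpret N: prob_space N by fact
  have A: "A \<noteq> {}"
  proof
    assume "A = {}"
    then have "AE \<omega> in N. False" using Z by simp
    then show False by simp
  qed
  obtain q0 where "q0 \<in> A" using A by blast
  then have B0: "0 \<le> B" using f(2)[of q0] by linarith
  \<comment> \<open>Away from \<open>A\<close> the envelope grows with the distance; the cap at
    \<open>B\<close> makes it bounded and changes nothing on \<open>A\<close>.\<close>
  define g where "g m q = min B (lipschitz_regularization A f m q)" for m q
  have g_cont: "continuous_on UNIV (g m)" for m
    unfolding g_def by (intro continuous_intros continuous_lipschitz_regularization[OF A f(1) f(2)])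
  have [measurable]: "g m \<in> borel_measurable borel" for m
    using g_cont by (rule borel_measurable_continuous_onI)
  have g_bound: "\<bar>g m q\<bar> \<le> B" for m q
    using lipschitz_regularization_ge[OF A f(1) f(2), of m q] B0 by (auto simp: g_def abs_le_iff)
  have g_le: "g m q \<le> f q" if "q \<in> A" for m q
    using lipschitz_regularization_le[OF A f(1) f(2) that, of m] by (simp add: g_def)
  have "(\<lambda>m. \<integral>\<omega>. g m (Z \<omega>) \<partial>N) \<longlonglongrightarrow> (\<integral>\<omega>. f (Z \<omega>) \<partial>N)"
  proof (rule integral_dominated_convergence[where w="\<lambda>_. B"])
    show "AE \<omega> in N. (\<lambda>m. g m (Z \<omega>)) \<longlonglongrightarrow> f (Z \<omega>)"
      using Z
    proof eventually_elim
      case (elim \<omega>)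
      have "(\<lambda>m. g m (Z \<omega>)) \<longlonglongrightarrow> min B (f (Z \<omega>))"
        unfolding g_def by (intro tendsto_intros lipschitz_regularization_tendsto[OF A f(1) f(2)] elim)
      then show ?case using f(2)[OF elim] by (simp add: min_absorb2 abs_le_iff)
    qed
  qed (use g_bound in auto)
  then have "\<forall>\<^sub>F m in sequentially. (\<integral>\<omega>. f (Z \<omega>) \<partial>N) - e / 2 < (\<integral>\<omega>. g m (Z \<omega>) \<partial>N)"
    using e by (intro order_tendstoD(1)) auto
  then obtain m where m: "(\<integral>\<omega>. f (Z \<omega>) \<partial>N) - e / 2 < (\<integral>\<omega>. g m (Z \<omega>) \<partial>N)"
    by (auto simp: eventually_sequentially)
  have "\<forall>\<^sub>F n in sequentially. (\<integral>\<omega>. g m (Z \<omega>) \<partial>N) - e / 2 < (\<integral>\<omega>. g m (Y n \<omega>) \<partial>M)"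
    using conv[OF g_cont g_bound] e by (intro order_tendstoD(1)) auto
  with Y show ?thesis
  proof eventually_elim
    case (elim n)
    have "(\<integral>\<omega>. g m (Y n \<omega>) \<partial>M) \<le> (\<integral>\<omega>. f (Y n \<omega>) \<partial>M)"
    proof (rule integral_mono_AE)
      show "integrable M (\<lambda>\<omega>. g m (Y n \<omega>))" using g_bound by (intro M.integrable_const_bound[where B=B]) auto
      show "integrable M (\<lambda>\<omega>. f (Y n \<omega>))"
        using elim(1) f(2) by (intro M.integrable_const_bound[where B=B]) (auto elim!: eventually_mono)
      show "AE \<omega> in M. g m (Y n \<omega>) \<le> f (Y n \<omega>)" using elim(1) by eventually_elim (rule g_le)
    qed
    then show ?case using elim(2) m by linarith
  qed
qed

text \<open>
  The set \<open>A\<close> need not be closed: bounded functions that are continuous on \<open>A\<close> only are approximated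
  from below by Lipschitz functions on the whole space.
\<close>

lemma expectation_tendsto_of_continuous_on:
  fixes Y :: "nat \<Rightarrow> 'm \<Rightarrow> 'b::metric_space" and Z :: "'n \<Rightarrow> 'b" and f :: "'b \<Rightarrow> real"
  assumes M: "prob_space M" and N: "prob_space N"
    and meas: "\<And>n. Y n \<in> borel_measurable M" "Z \<in> borel_measurable N" "f \<in> borel_measurable borel"
    and YZ: "\<forall>\<^sub>F n in sequentially. AE \<omega> in M. Y n \<omega> \<in> A" "AE \<omega> in N. Z \<omega> \<in> A"
    and f: "continuous_on A f" "\<And>q. q \<in> A \<Longrightarrow> \<bar>f q\<bar> \<le> B"
    and conv: "\<And>g. continuous_on UNIV g \<Longrightarrow> (\<And>q. \<bar>g q\<bar> \<le> B) \<Longrightarrow> (\<lambda>n. \<integral>\<omega>. g (Y n \<omega>) \<partial>M) \<longlonglongrightarrow> (\<integral>\<omega>. g (Z \<omega>) \<partial>N)"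
  shows "(\<lambda>n. \<integral>\<omega>. f (Y n \<omega>) \<partial>M) \<longlonglongrightarrow> (\<integral>\<omega>. f (Z \<omega>) \<partial>N)"
proof (rule tendstoI)
  fix e :: real assume e: "e > 0"
  have "\<forall>\<^sub>F n in sequentially. (\<integral>\<omega>. f (Z \<omega>) \<partial>N) - e / 2 \<le> (\<integral>\<omega>. f (Y n \<omega>) \<partial>M)"
    using e by (intro eventually_expectation_ge[OF M N meas YZ f conv]) auto
  moreover have "\<forall>\<^sub>F n in sequentially. (\<integral>\<omega>. - f (Z \<omega>) \<partial>N) - e / 2 \<le> (\<integral>\<omega>. - f (Y n \<omega>) \<partial>M)"
  proof (rule eventually_expectation_ge[OF M N meas(1,2) _ YZ])
    show "(\<lambda>x. - f x) \<in> borel_measurable borel" using meas(3) by measurable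
    show "continuous_on A (\<lambda>x. - f x)" using f(1) by (intro continuous_intros)
    show "\<bar>- f q\<bar> \<le> B" if "q \<in> A" for q using f(2)[OF that] by simp
  qed (use e conv in auto)
  ultimately show "\<forall>\<^sub>F n in sequentially. dist (\<integral>\<omega>. f (Y n \<omega>) \<partial>M) (\<integral>\<omega>. f (Z \<omega>) \<partial>N) < e"
    by eventually_elim (use e in \<open>auto simp: dist_real_def abs_less_iff\<close>)
qed

text \<open>The functions \<open>max 0 (1 - m * infdist q S)\<close> decrease to the indicator of a
  closed set \<open>S\<close>, and the closed sets form a generating pi-system.\<close>

lemma distr_eqI_continuous:
  fixes Y :: "'m \<Rightarrow> 'b::metric_space" and Z :: "'n \<Rightarrow> 'b"
  assumes M: "prob_space M" and N: "prob_space N"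
    and [measurable]: "Y \<in> borel_measurable M" "Z \<in> borel_measurable N"
    and eq: "\<And>g :: 'b \<Rightarrow> real. continuous_on UNIV g \<Longrightarrow> (\<And>q. \<bar>g q\<bar> \<le> 1) \<Longrightarrow> (\<integral>\<omega>. g (Y \<omega>) \<partial>M) = (\<integral>\<omega>. g (Z \<omega>) \<partial>N)"
  shows "distr M borel Y = distr N borel Z"
proof (rule measure_eqI_generator_eq[where E="Collect closed" and \<Omega>=UNIV and A="\<lambda>_. UNIV"])
  interpret M: prob_space M by fact
  interpret N: prob_space N by fact
  interpret DM: prob_space "distr M borel Y" by (rule M.prob_space_distr) simp
  interpret DN: prob_space "distr N borel Z" by (rule N.prob_space_distr) simp
  show "Int_stable (Collect closed :: 'b set set)" by (auto intro!: Int_stableI)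
  show "emeasure (distr M borel Y) UNIV \<noteq> \<infinity>" for i :: nat by simp
  fix S :: "'b set" assume "S \<in> Collect closed"
  then have S: "closed S" by simp
  then have [measurable]: "S \<in> sets borel" by simp
  show "emeasure (distr M borel Y) S = emeasure (distr N borel Z) S"
  \<comment> \<open>The empty set is separate because \<open>infdist\<close> to it is 0 by
    convention, so the approximating functions would be constantly 1.\<close>
  proof (cases "S = {}")
    case False
    define g where "g m q = max 0 (1 - real m * infdist q S)" for m q
    have g_cont: "continuous_on UNIV (g m)" for m
      unfolding g_def by (intro continuous_intros)
    have [measurable]: "g m \<in> borel_measurable borel" for m
      using g_cont by (rule borel_measurable_continuous_onI)
    have g_bound: "\<bar>g m q\<bar> \<le> 1" for m q
      using infdist_nonneg[of q S] by (auto simp: g_def)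
    have g_lim: "(\<lambda>m. g m q) \<longlonglongrightarrow> indicator S q" for q
    proof (cases "q \<in> S")
      case False
      then have d: "0 < infdist q S" using S \<open>S \<noteq> {}\<close> in_closed_iff_infdist_zero[of S q] infdist_nonneg[of q S] by force
      obtain m0 where m0: "1 < real m0 * infdist q S" using reals_Archimedean3[OF d] by blast
      have "g m q = 0" if "m0 \<le> m" for m
      proof -
        have "real m0 * infdist q S \<le> real m * infdist q S" using that d by (intro mult_right_mono) auto
        then show ?thesis using m0 by (simp add: g_def)
      qed
      then have "\<forall>\<^sub>F m in sequentially. g m q = 0" by (auto simp: eventually_sequentially)
      then show ?thesis using False by (simp add: tendsto_eventually)
    qed (simp add: g_def)
    have "(\<lambda>m. \<integral>\<omega>. g m (Y \<omega>) \<partial>M) \<longlonglongrightarrow> (\<integral>\<omega>. indicator S (Y \<omega>) \<partial>M)"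
      by (rule integral_dominated_convergence[where w="\<lambda>_. 1"]) (use g_lim g_bound in auto)
    moreover have "(\<lambda>m. \<integral>\<omega>. g m (Z \<omega>) \<partial>N) \<longlonglongrightarrow> (\<integral>\<omega>. indicator S (Z \<omega>) \<partial>N)"
      by (rule integral_dominated_convergence[where w="\<lambda>_. 1"]) (use g_lim g_bound in auto)
    ultimately have "(\<integral>\<omega>. indicator S (Y \<omega>) \<partial>M) = (\<integral>\<omega>. indicator S (Z \<omega>) \<partial>N :: real)"
      using eq[OF g_cont g_bound] LIMSEQ_unique by auto
    then have "(\<integral>q. indicator S q \<partial>distr M borel Y) = (\<integral>q. indicator S q \<partial>distr N borel Z :: real)"
      by (subst (1 2) integral_distr) auto
    then show ?thesis by (simp add: DM.emeasure_eq_measure DN.emeasure_eq_measure)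
  qed simp
qed (auto simp: borel_eq_closed)

text \<open>A compact set around \<open>prob_vecs\<close>, which is itself not closed in the product
  topology if the index type is infinite.\<close>

definition unit_cube :: "('a \<Rightarrow> real) set" where
  "unit_cube = {p. \<forall>l. p l \<in> {0..1}}"

lemma compact_unit_cube: "compact (unit_cube :: ('a \<Rightarrow> real) set)"
proof -
  have "(unit_cube :: ('a \<Rightarrow> real) set) = PiE UNIV (\<lambda>_. {0..1})" by (auto simp: unit_cube_def PiE_def Pi_def extensional_def)
  then show ?thesis
    using compactin_PiE[of "\<lambda>_ :: 'a. euclidean" UNIV "\<lambda>_. {0..1::real}"]
    by (simp add: euclidean_product_topology)
qed

lemma prob_vecs_subset_unit_cube: "prob_vecs \<subseteq> unit_cube"
proof
  fix p :: "'a \<Rightarrow> real" assume "p \<in> prob_vecs"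
  then obtain q where "pmf q = p" using prob_vec_obtain_pmf by (auto simp: prob_vecs_def)
  then show "p \<in> unit_cube" by (auto simp: unit_cube_def pmf_le_1)
qed

text \<open>The span of the exponentials is an algebra because products add exponents. Nonnegative
  coefficients allow each exponent to be written as a constant times a mass whose weights lie in the
  unit interval.\<close>

inductive exp_sum :: "(('a \<Rightarrow> real) \<Rightarrow> real) \<Rightarrow> bool" where
  exp_sum_exp: "finite F \<Longrightarrow> (\<And>l. 0 \<le> a l) \<Longrightarrow> exp_sum (\<lambda>p. b * exp (\<Sum>l\<in>F. a l * p l))"
| exp_sum_add: "exp_sum f \<Longrightarrow> exp_sum g \<Longrightarrow> exp_sum (\<lambda>p. f p + g p)"

lemma exp_sum_const: "exp_sum (\<lambda>_. b)"
  using exp_sum_exp[of "{}" "\<lambda>_. 0" b] by simp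

lemma exp_sum_mult_exp:
  assumes F: "finite F" "\<And>l. 0 \<le> a l" and g: "exp_sum g"
  shows "exp_sum (\<lambda>p. b * exp (\<Sum>l\<in>F. a l * p l) * g p)"
  using g
proof induction
  case (exp_sum_exp F' a' b')
  \<comment> \<open>Each coefficient function is cut off outside its own index set, where it may be
    nonzero and must not enter the merged sum.\<close>
  define a'' where "a'' l = (if l \<in> F then a l else 0) + (if l \<in> F' then a' l else 0)" for l
  have "(\<Sum>l\<in>F. a l * p l) + (\<Sum>l\<in>F'. a' l * p l) = (\<Sum>l\<in>F \<union> F'. a'' l * p l)" for p
  proof -
    have "(\<Sum>l\<in>F. a l * p l) = (\<Sum>l\<in>F \<union> F'. (if l \<in> F then a l else 0) * p l)"
      using F exp_sum_exp by (intro sum.mono_neutral_cong_left) auto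
    moreover have "(\<Sum>l\<in>F'. a' l * p l) = (\<Sum>l\<in>F \<union> F'. (if l \<in> F' then a' l else 0) * p l)"
      using F exp_sum_exp by (intro sum.mono_neutral_cong_left) auto
    ultimately show ?thesis by (simp add: a''_def distrib_right sum.distrib)
  qed
  then have "(\<lambda>p. b * exp (\<Sum>l\<in>F. a l * p l) * (b' * exp (\<Sum>l\<in>F'. a' l * p l))) = (\<lambda>p. (b * b') * exp (\<Sum>l\<in>F \<union> F'. a'' l * p l))"
    by (simp add: exp_add[symmetric] fun_eq_iff mult_ac)
  moreover have "exp_sum (\<lambda>p. (b * b') * exp (\<Sum>l\<in>F \<union> F'. a'' l * p l))"
    using F exp_sum_exp by (intro exp_sum.exp_sum_exp) (auto simp: a''_def)
  ultimately show ?case by (simp only:)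
next
  case (exp_sum_add f g)
  then show ?case using exp_sum.exp_sum_add by (fastforce simp: distrib_left)
qed

lemma exp_sum_mult: "exp_sum f \<Longrightarrow> exp_sum g \<Longrightarrow> exp_sum (\<lambda>p. f p * g p)"
proof (induction rule: exp_sum.induct)
  case (exp_sum_exp F a b)
  then show ?case by (intro exp_sum_mult_exp) auto
next
  case (exp_sum_add f f')
  then show ?case using exp_sum.exp_sum_add by (fastforce simp: distrib_right)
qed

lemma continuous_exp_sum: "exp_sum g \<Longrightarrow> continuous_on UNIV g"
  by (induction rule: exp_sum.induct)
    (auto intro!: continuous_intros continuous_on_product_coordinates intro: continuous_on_subset)

lemma exp_sum_dense:
  fixes g :: "('a::countable \<Rightarrow> real) \<Rightarrow> real"
  assumes "continuous_on unit_cube g" "e > 0"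
  obtains G where "exp_sum G" "\<And>p. p \<in> unit_cube \<Longrightarrow> \<bar>g p - G p\<bar> < e"
proof -
  interpret function_ring_on "Collect exp_sum" "unit_cube :: ('a \<Rightarrow> real) set"
  proof
    show "continuous_on unit_cube f" if "f \<in> Collect exp_sum" for f :: "('a \<Rightarrow> real) \<Rightarrow> real"
      using that continuous_exp_sum[of f] continuous_on_subset by blast
    show "\<exists>f\<in>Collect exp_sum. f x \<noteq> f y" if xy: "x \<in> unit_cube" "y \<in> unit_cube" "x \<noteq> y" for x y :: "'a \<Rightarrow> real"
    proof -
      obtain l where "x l \<noteq> y l" using xy by blast
      then show ?thesis using exp_sum_exp[of "{l}" "\<lambda>_. 1" 1] by (intro bexI[of _ "\<lambda>p. exp (p l)"]) simp_all
    qed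
  qed (auto intro: compact_unit_cube exp_sum_const exp_sum_add exp_sum_mult)
  show ?thesis using Stone_Weierstrass_basic[OF assms] that by blast
qed

section \<open>From exponential transforms to continuous test functions\<close>

lemma expectation_continuous_tendsto:
  fixes Y :: "nat \<Rightarrow> 'm \<Rightarrow> 'a::countable \<Rightarrow> real" and Z :: "'n \<Rightarrow> 'a \<Rightarrow> real"
    and g :: "('a \<Rightarrow> real) \<Rightarrow> real"
  assumes "prob_space M" "prob_space N"
    and [measurable]: "\<And>n. Y n \<in> borel_measurable M" "Z \<in> borel_measurable N"
    and Y: "\<forall>\<^sub>F n in sequentially. AE \<omega> in M. Y n \<omega> \<in> unit_cube" and Z: "AE \<omega> in N. Z \<omega> \<in> unit_cube"
    and exp_conv: "\<And>F a. finite F \<Longrightarrow> (\<And>l. 0 \<le> a l) \<Longrightarrow>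
      (\<lambda>n. \<integral>\<omega>. exp (\<Sum>l\<in>F. a l * Y n \<omega> l) \<partial>M) \<longlonglongrightarrow> (\<integral>\<omega>. exp (\<Sum>l\<in>F. a l * Z \<omega> l) \<partial>N)"
    and g: "continuous_on UNIV g"
  shows "(\<lambda>n. \<integral>\<omega>. g (Y n \<omega>) \<partial>M) \<longlonglongrightarrow> (\<integral>\<omega>. g (Z \<omega>) \<partial>N)"
proof (rule tendstoI)
  interpret M: prob_space M by fact
  interpret N: prob_space N by fact
  \<comment> \<open>Continuous functions may be unbounded on the whole space. Integrability comes
    from compactness of the cube, which carries \<open>Z\<close> almost surely, and
    \<open>Y n\<close> from some index on.\<close>
  have int: "(\<forall>n. (AE \<omega> in M. Y n \<omega> \<in> unit_cube) \<longrightarrow> integrable M (\<lambda>\<omega>. f (Y n \<omega>))) \<and> integrable N (\<lambda>\<omega>. f (Z \<omega>))"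
    if f: "continuous_on UNIV f" for f :: "('a \<Rightarrow> real) \<Rightarrow> real"
  proof -
    have [measurable]: "f \<in> borel_measurable borel" using f by (rule borel_measurable_continuous_onI)
    have "bounded (f ` unit_cube)"
      using f by (intro compact_imp_bounded compact_continuous_image compact_unit_cube) (rule continuous_on_subset, auto)
    then obtain B where B: "\<And>p. p \<in> unit_cube \<Longrightarrow> norm (f p) \<le> B" by (auto simp: bounded_iff)
    show ?thesis using B Z
      by (auto intro!: M.integrable_const_bound[where B=B] N.integrable_const_bound[where B=B] elim: eventually_mono)
  qed
  have conv: "(\<lambda>n. \<integral>\<omega>. G (Y n \<omega>) \<partial>M) \<longlonglongrightarrow> (\<integral>\<omega>. G (Z \<omega>) \<partial>N)" if "exp_sum G" for G
    using that
  proof induction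
    case (exp_sum_exp F a b)
    then show ?case by (simp add: tendsto_mult_left exp_conv)
  next
    case (exp_sum_add f f')
    note ifs = int[OF continuous_exp_sum[OF exp_sum_add(1)]] int[OF continuous_exp_sum[OF exp_sum_add(2)]]
    have "\<forall>\<^sub>F n in sequentially. (\<integral>\<omega>. f (Y n \<omega>) \<partial>M) + (\<integral>\<omega>. f' (Y n \<omega>) \<partial>M) = (\<integral>\<omega>. f (Y n \<omega>) + f' (Y n \<omega>) \<partial>M)"
      using Y by eventually_elim (use ifs in simp)
    moreover have "(\<lambda>n. (\<integral>\<omega>. f (Y n \<omega>) \<partial>M) + (\<integral>\<omega>. f' (Y n \<omega>) \<partial>M)) \<longlonglongrightarrow> (\<integral>\<omega>. f (Z \<omega>) \<partial>N) + (\<integral>\<omega>. f' (Z \<omega>) \<partial>N)"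
      by (intro tendsto_add exp_sum_add)
    ultimately show ?case using ifs by (simp add: Lim_transform_eventually)
  qed
  fix e :: real assume "e > 0"
  then have e: "e / 4 > 0" by simp
  obtain G where G: "exp_sum G" "\<And>p. p \<in> unit_cube \<Longrightarrow> \<bar>g p - G p\<bar> < e / 4"
    using exp_sum_dense[OF _ e, of g] g continuous_on_subset by blast
  have "\<forall>\<^sub>F n in sequentially. dist (\<integral>\<omega>. G (Y n \<omega>) \<partial>M) (\<integral>\<omega>. G (Z \<omega>) \<partial>N) < e / 4"
    using conv[OF G(1)] e by (rule tendstoD)
  with Y show "\<forall>\<^sub>F n in sequentially. dist (\<integral>\<omega>. g (Y n \<omega>) \<partial>M) (\<integral>\<omega>. g (Z \<omega>) \<partial>N) < e"
  proof eventually_elim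
    case (elim n)
    have i: "integrable M (\<lambda>\<omega>. g (Y n \<omega>))" "integrable M (\<lambda>\<omega>. G (Y n \<omega>))"
      "integrable N (\<lambda>\<omega>. g (Z \<omega>))" "integrable N (\<lambda>\<omega>. G (Z \<omega>))"
      using int[OF g] int[OF continuous_exp_sum[OF G(1)]] elim(1) by auto
    have "\<bar>(\<integral>\<omega>. g (Y n \<omega>) - G (Y n \<omega>) \<partial>M)\<bar> \<le> (\<integral>\<omega>. e / 4 \<partial>M)"
      using i elim(1) G(2) by (intro order_trans[OF integral_abs_bound] integral_mono_AE) (auto elim!: eventually_mono simp: less_imp_le)
    moreover have "\<bar>(\<integral>\<omega>. g (Z \<omega>) - G (Z \<omega>) \<partial>N)\<bar> \<le> (\<integral>\<omega>. e / 4 \<partial>N)"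
      using i Z G(2) by (intro order_trans[OF integral_abs_bound] integral_mono_AE) (auto elim!: eventually_mono simp: less_imp_le)
    ultimately have "dist (\<integral>\<omega>. g (Y n \<omega>) \<partial>M) (\<integral>\<omega>. G (Y n \<omega>) \<partial>M) \<le> e / 4"
      "dist (\<integral>\<omega>. G (Z \<omega>) \<partial>N) (\<integral>\<omega>. g (Z \<omega>) \<partial>N) \<le> e / 4"
      using i by (simp_all add: M.prob_space N.prob_space dist_real_def abs_minus_commute)
    then show ?case
      using elim(2) \<open>e > 0\<close> dist_triangle[of "\<integral>\<omega>. g (Y n \<omega>) \<partial>M" "\<integral>\<omega>. g (Z \<omega>) \<partial>N" "\<integral>\<omega>. G (Y n \<omega>) \<partial>M"]
        dist_triangle[of "\<integral>\<omega>. G (Y n \<omega>) \<partial>M" "\<integral>\<omega>. g (Z \<omega>) \<partial>N" "\<integral>\<omega>. G (Z \<omega>) \<partial>N"] by linarith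
  qed
qed

text \<open>Termwise integration of the exponential series, dominated by
  \<open>\<bar>t\<bar> ^ k / fact k\<close> because \<open>U\<close> has values in the unit
  interval. Equal moments therefore give equal transforms.\<close>

lemma expectation_exp_sums:
  fixes U :: "'m \<Rightarrow> real"
  assumes "prob_space M" and [measurable]: "U \<in> borel_measurable M" and U: "AE \<omega> in M. U \<omega> \<in> {0..1}"
  shows "(\<lambda>k. (t ^ k / fact k) * (\<integral>\<omega>. U \<omega> ^ k \<partial>M)) sums (\<integral>\<omega>. exp (t * U \<omega>) \<partial>M)"
    and "(\<integral>\<omega>. U \<omega> ^ k \<partial>M) \<in> {0..1}"
proof -
  interpret prob_space M by fact
  have pow: "AE \<omega> in M. U \<omega> ^ k \<in> {0..1}" for k
    using U by eventually_elim (auto intro: power_le_one)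
  have int: "integrable M (\<lambda>\<omega>. U \<omega> ^ k)" for k
    using pow[of k] by (intro integrable_const_bound[where B=1]) (auto elim: eventually_mono)
  have mom: "(\<integral>\<omega>. U \<omega> ^ k \<partial>M) \<in> {0..1}" for k
  proof -
    have "(\<integral>\<omega>. U \<omega> ^ k \<partial>M) \<le> (\<integral>\<omega>. 1 \<partial>M)"
      using pow[of k] int by (intro integral_mono_AE) (auto elim: eventually_mono)
    moreover have "0 \<le> (\<integral>\<omega>. U \<omega> ^ k \<partial>M)"
      using pow[of k] by (intro integral_nonneg_AE) (auto elim: eventually_mono)
    ultimately show ?thesis by (auto simp: prob_space)
  qed
  then show "(\<integral>\<omega>. U \<omega> ^ k \<partial>M) \<in> {0..1}" .
  let ?f = "\<lambda>k \<omega>. (t ^ k / fact k) * U \<omega> ^ k"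
  have exp: "(\<Sum>k. ?f k \<omega>) = exp (t * U \<omega>)" for \<omega>
    unfolding exp_def by (simp add: power_mult_distrib divide_inverse mult_ac)
  have s: "summable (\<lambda>k. \<bar>t\<bar> ^ k / fact k)"
    using summable_exp[of "\<bar>t\<bar>"] by (simp add: divide_inverse mult_ac)
  have norm: "(\<integral>\<omega>. norm (?f k \<omega>) \<partial>M) \<le> \<bar>t\<bar> ^ k / fact k" for k
  proof -
    have "(\<integral>\<omega>. norm (?f k \<omega>) \<partial>M) = \<bar>t\<bar> ^ k / fact k * (\<integral>\<omega>. U \<omega> ^ k \<partial>M)"
    proof -
      have "(\<integral>\<omega>. norm (?f k \<omega>) \<partial>M) = (\<integral>\<omega>. \<bar>t\<bar> ^ k / fact k * U \<omega> ^ k \<partial>M)"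
      proof (rule integral_cong_AE)
        show "AE \<omega> in M. norm (?f k \<omega>) = \<bar>t\<bar> ^ k / fact k * U \<omega> ^ k"
          using U by eventually_elim (simp add: abs_mult power_abs)
      qed auto
      then show ?thesis by simp
    qed
    also have "\<dots> \<le> \<bar>t\<bar> ^ k / fact k" using mom[of k] by (intro mult_left_le) auto
    finally show ?thesis .
  qed
  have "(\<lambda>k. integral\<^sup>L M (?f k)) sums (\<integral>\<omega>. (\<Sum>k. ?f k \<omega>) \<partial>M)"
  proof (rule sums_integral)
    show "summable (\<lambda>k. \<integral>\<omega>. norm (?f k \<omega>) \<partial>M)"
      by (rule summable_comparison_test'[OF s]) (use norm in auto)
    show "AE \<omega> in M. summable (\<lambda>k. norm (?f k \<omega>))"
      using summable_norm_exp[of "t * U _"]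
      by (simp add: abs_mult power_mult_distrib divide_inverse mult_ac)
  qed (use int in auto)
  then show "(\<lambda>k. (t ^ k / fact k) * (\<integral>\<omega>. U \<omega> ^ k \<partial>M)) sums (\<integral>\<omega>. exp (t * U \<omega>) \<partial>M)"
    unfolding exp by simp
qed

text \<open>Tannery's theorem for the exponential series: all moments lie in the unit interval, so
  one summable majorant serves every n.\<close>

lemma expectation_exp_tendsto:
  fixes U :: "nat \<Rightarrow> 'm \<Rightarrow> real" and W :: "'n \<Rightarrow> real"
  assumes M: "prob_space M" and N: "prob_space N"
    and U: "\<And>n. U n \<in> borel_measurable M" "\<And>n. AE \<omega> in M. U n \<omega> \<in> {0..1}"
    and W: "W \<in> borel_measurable N" "AE \<omega> in N. W \<omega> \<in> {0..1}"
    and conv: "\<And>k. (\<lambda>n. \<integral>\<omega>. U n \<omega> ^ k \<partial>M) \<longlonglongrightarrow> (\<integral>\<omega>. W \<omega> ^ k \<partial>N)"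
  shows "(\<lambda>n. \<integral>\<omega>. exp (t * U n \<omega>) \<partial>M) \<longlonglongrightarrow> (\<integral>\<omega>. exp (t * W \<omega>) \<partial>N)"
proof -
  note sU = expectation_exp_sums[OF M U]
  note sW = expectation_exp_sums[OF N W]
  have s: "summable (\<lambda>k. \<bar>t\<bar> ^ k / fact k)"
    using summable_exp[of "\<bar>t\<bar>"] by (simp add: divide_inverse mult_ac)
  have "(\<lambda>n. \<Sum>k. t ^ k / fact k * (\<integral>\<omega>. U n \<omega> ^ k \<partial>M)) \<longlonglongrightarrow> (\<Sum>k. t ^ k / fact k * (\<integral>\<omega>. W \<omega> ^ k \<partial>N))"
  proof (rule tannerys_theorem[THEN conjunct2, THEN conjunct2, OF _ _ s])
    show "\<forall>\<^sub>F (k, n) in at_top \<times>\<^sub>F sequentially. norm (t ^ k / fact k * (\<integral>\<omega>. U n \<omega> ^ k \<partial>M)) \<le> \<bar>t\<bar> ^ k / fact k"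
    proof (intro always_eventually allI, clarify)
      fix k n
      have "\<bar>\<integral>\<omega>. U n \<omega> ^ k \<partial>M\<bar> \<le> 1" using sU(2)[of n k] by auto
      then have "\<bar>t\<bar> ^ k / fact k * \<bar>\<integral>\<omega>. U n \<omega> ^ k \<partial>M\<bar> \<le> \<bar>t\<bar> ^ k / fact k" by (intro mult_left_le) auto
      then show "norm (t ^ k / fact k * (\<integral>\<omega>. U n \<omega> ^ k \<partial>M)) \<le> \<bar>t\<bar> ^ k / fact k"
        by (simp add: abs_mult power_abs)
    qed
  qed (auto intro!: tendsto_intros conv)
  then show ?thesis using sums_unique[OF sU(1)] sums_unique[OF sW(1)] by simp
qed

subsection \<open>Random probability vectors from sticks\<close>

lemma infsum_from_1: "infsum f {1..} = infsum (\<lambda>j. f (Suc j)) UNIV"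
proof -
  have "{1::nat..} = range Suc" by (auto simp: image_def Suc_le_eq gr0_conv_Suc)
  then show ?thesis using infsum_reindex[of Suc UNIV f] by (simp add: o_def)
qed

text \<open>\<open>infsum\<close> is 0 where the series does not converge absolutely, whereas
  \<open>suminf\<close> may differ there. The case distinction by an extended nonnegative series
  makes the switch measurable.\<close>

lemma borel_measurable_infsum_nat:
  fixes f :: "nat \<Rightarrow> 'm \<Rightarrow> real"
  assumes [measurable]: "\<And>j. f j \<in> borel_measurable M"
  shows "(\<lambda>\<omega>. infsum (\<lambda>j. f j \<omega>) UNIV) \<in> borel_measurable M"
proof -
  have "infsum (\<lambda>j. f j \<omega>) UNIV = (if (\<Sum>j. ennreal \<bar>f j \<omega>\<bar>) = \<top> then 0 else (\<Sum>j. f j \<omega>))" for \<omega>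
  proof (cases "summable (\<lambda>j. \<bar>f j \<omega>\<bar>)")
    case True
    then have "((\<lambda>j. f j \<omega>) has_sum (\<Sum>j. f j \<omega>)) UNIV"
      by (intro norm_summable_imp_has_sum[OF _ summable_sums[OF summable_rabs_cancel[OF True]]]) simp
    then show ?thesis using True by (simp add: infsumI ennreal_suminf_neq_top)
  next
    case False
    then have "\<not> (\<lambda>j. f j \<omega>) summable_on UNIV"
      using summable_on_iff_abs_summable_on_real[of "\<lambda>j. f j \<omega>" UNIV]
        summable_on_UNIV_nonneg_real_iff[of "\<lambda>j. \<bar>f j \<omega>\<bar>"] by simp
    moreover have "(\<Sum>j. ennreal \<bar>f j \<omega>\<bar>) = \<top>"
      using False summable_suminf_not_top[of "\<lambda>j. \<bar>f j \<omega>\<bar>", OF abs_ge_zero] by blast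
    ultimately show ?thesis by (simp add: infsum_not_exists)
  qed
  then show ?thesis by simp
qed

text \<open>Countability of the state type lets measurability be checked coordinatewise.\<close>

lemma borel_measurable_atom_vec:
  fixes Y :: "nat \<Rightarrow> 'm \<Rightarrow> 'a::countable"
  assumes [measurable]: "\<And>j. P j \<in> borel_measurable M" "\<And>j. Y j \<in> measurable M (count_space UNIV)"
  shows "(\<lambda>\<omega>. atom_vec (\<lambda>j. P j \<omega>) (\<lambda>j. Y j \<omega>)) \<in> borel_measurable M"
proof (rule measurable_coordinatewise_then_product)
  fix l
  show "(\<lambda>\<omega>. atom_vec (\<lambda>j. P j \<omega>) (\<lambda>j. Y j \<omega>) l) \<in> borel_measurable M"
    unfolding atom_vec_def infsum_from_1 by (rule borel_measurable_infsum_nat) measurable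
qed

lemma atom_vec_sums:
  assumes P: "\<And>j. 0 \<le> P (Suc j)" "summable (\<lambda>j. P (Suc j))"
  shows "(\<lambda>j. P (Suc j) * of_bool (Y (Suc j) = l)) sums atom_vec P Y l"
proof -
  have "summable (\<lambda>j. P (Suc j) * of_bool (Y (Suc j) = l))"
    by (rule summable_comparison_test'[OF P(2)]) (use P(1) in auto)
  then have "(\<lambda>j. P (Suc j) * of_bool (Y (Suc j) = l)) sums (\<Sum>j. P (Suc j) * of_bool (Y (Suc j) = l))"
    by (rule summable_sums)
  moreover from this have "((\<lambda>j. P (Suc j) * of_bool (Y (Suc j) = l)) has_sum (\<Sum>j. P (Suc j) * of_bool (Y (Suc j) = l))) UNIV"
    by (rule sums_nonneg_imp_has_sum) (use P(1) in auto)
  ultimately show ?thesis unfolding atom_vec_def infsum_from_1 by (simp add: infsumI)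
qed

lemma sum_atom_vec_sums:
  assumes P: "\<And>j. 0 \<le> P (Suc j)" "summable (\<lambda>j. P (Suc j))" and F: "finite F"
  shows "(\<lambda>j. P (Suc j) * (if Y (Suc j) \<in> F then a (Y (Suc j)) else 0)) sums (\<Sum>l\<in>F. a l * atom_vec P Y l)"
proof -
  have "(\<lambda>j. \<Sum>l\<in>F. a l * (P (Suc j) * of_bool (Y (Suc j) = l))) sums (\<Sum>l\<in>F. a l * atom_vec P Y l)"
    by (intro sums_sum sums_mult atom_vec_sums P)
  moreover have "(\<Sum>l\<in>F. a l * (P (Suc j) * of_bool (Y (Suc j) = l))) = P (Suc j) * (if Y (Suc j) \<in> F then a (Y (Suc j)) else 0)" for j
  proof -
    have "(\<Sum>l\<in>F. a l * (P (Suc j) * of_bool (Y (Suc j) = l))) = (\<Sum>l\<in>F. if Y (Suc j) = l then a l * P (Suc j) else 0)"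
      by (intro sum.cong) auto
    then show ?thesis using F by (simp add: sum.delta')
  qed
  ultimately show ?thesis by simp
qed

text \<open>The vector is the law of \<open>Y (Suc J)\<close> for a random index \<open>J\<close>
  with mass function \<open>\<lambda>j. P (Suc j)\<close>, so no sums have to be exchanged.\<close>

lemma atom_vec_in_prob_vecs:
  assumes P: "\<And>j. 0 \<le> P (Suc j)" "(\<lambda>j. P (Suc j)) sums 1"
  shows "atom_vec P Y \<in> prob_vecs"
proof -
  have "prob_vec (\<lambda>j. P (Suc j))"
    unfolding prob_vec_def using P sums_nonneg_imp_has_sum by blast
  then obtain p where p: "pmf p = (\<lambda>j. P (Suc j))" by (rule prob_vec_obtain_pmf)
  have "atom_vec P Y = pmf (map_pmf (\<lambda>j. Y (Suc j)) p)"
  proof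
    fix l
    have "pmf (map_pmf (\<lambda>j. Y (Suc j)) p) l = infsetsum (pmf p) ((\<lambda>j. Y (Suc j)) -` {l})"
      by (simp add: pmf_map measure_pmf_conv_infsetsum)
    also have "\<dots> = infsum (pmf p) ((\<lambda>j. Y (Suc j)) -` {l})"
      by (rule infsetsum_infsum[OF pmf_abs_summable])
    also have "\<dots> = infsum (\<lambda>j. P (Suc j) * of_bool (Y (Suc j) = l)) UNIV"
      unfolding p by (rule infsum_cong_neutral) auto
    finally show "atom_vec P Y l = pmf (map_pmf (\<lambda>j. Y (Suc j)) p) l"
      unfolding atom_vec_def infsum_from_1 by simp
  qed
  then show ?thesis by (simp add: prob_vecs_def prob_vec_pmf)
qed

section \<open>Stick-breaking vectors as random probability vectors\<close>

context stick_chain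
begin

abbreviation random_vec :: "'m \<Rightarrow> 'a \<Rightarrow> real" where
  "random_vec \<omega> \<equiv> atom_vec (\<lambda>j. stick (\<lambda>i. X i \<omega>) j) (\<lambda>j. T j \<omega>)"

lemma measurable_random_vec: "random_vec \<in> borel_measurable M"
proof (rule borel_measurable_atom_vec)
  show "(\<lambda>\<omega>. stick (\<lambda>i. X i \<omega>) j) \<in> borel_measurable M" for j unfolding stick_def by measurable
qed measurable

lemma stick_nonneg: "\<forall>j\<ge>1. X j \<omega> \<in> {0..1} \<Longrightarrow> 0 \<le> stick (\<lambda>i. X i \<omega>) (Suc j)"
  using residue_01[of \<omega> j] by (auto simp: stick_Suc)

lemma AE_sticks_sums:
  assumes "\<And>y. c y \<le> C"
  shows "AE \<omega> in M. (\<forall>j. 0 \<le> stick (\<lambda>i. X i \<omega>) (Suc j)) \<and> (\<lambda>j. stick (\<lambda>i. X i \<omega>) (Suc j)) sums 1"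
  using AE_X_01 AE_residue_tendsto_0[OF assms]
proof eventually_elim
  case (elim \<omega>)
  have "(\<lambda>n. 1 - residue n \<omega>) \<longlonglongrightarrow> 1 - 0" by (intro tendsto_intros elim)
  then show ?case using stick_nonneg[OF elim(1)] by (simp add: sums_def sum_stick)
qed

lemma AE_random_vec:
  assumes "\<And>y. c y \<le> C" shows "AE \<omega> in M. random_vec \<omega> \<in> prob_vecs"
  using AE_sticks_sums[OF assms] by eventually_elim (auto intro: atom_vec_in_prob_vecs)

end

context homogeneous_stick_chain
begin

lemma AE_total_mass_01: "AE \<omega> in M. total_mass \<omega> \<in> {0..1}"
  using AE_X_01
proof eventually_elim
  case (elim \<omega>)
  have "0 \<le> total_mass \<omega>" "total_mass \<omega> \<le> 1"
    using partial_mass_01[where h=h, OF elim h]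
    by (auto intro!: LIMSEQ_le_const[OF partial_mass_tendsto[OF elim]] LIMSEQ_le_const2[OF partial_mass_tendsto[OF elim]])
  then show ?case by simp
qed

lemma measurable_total_mass: "total_mass \<in> borel_measurable M"
  unfolding total_mass_def[abs_def] stick_def by measurable

lemma AE_sum_random_vec:
  assumes F: "finite F" and h_eq: "\<And>l. h l = (if l \<in> F then a l / t else 0)" and t: "t \<noteq> 0"
  shows "AE \<omega> in M. (\<Sum>l\<in>F. a l * random_vec \<omega> l) = t * total_mass \<omega>"
  using AE_sticks_sums[OF c_le]
proof eventually_elim
  case (elim \<omega>)
  have "(\<lambda>j. stick (\<lambda>i. X i \<omega>) (Suc j) * h (T (Suc j) \<omega>)) sums (\<Sum>l\<in>F. a l / t * random_vec \<omega> l)"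
    unfolding h_eq using elim by (intro sum_atom_vec_sums F) (auto simp: sums_iff)
  then have "total_mass \<omega> = (\<Sum>l\<in>F. a l / t * random_vec \<omega> l)"
    unfolding total_mass_def by (rule sums_unique[symmetric])
  then show ?case using t by (simp add: sum_distrib_left)
qed

end

subsection \<open>The moment equation\<close>

text \<open>Monotone iteration from 0: the affine map is increasing and preserves the unit interval,
  so its iterates increase to a limit, and dominated convergence passes the fixed-point equation to
  it.\<close>

lemma kernel_resolvent_exists:
  fixes \<kappa> :: "'a \<Rightarrow> 'a pmf"
  assumes r: "r \<in> {0..1}" and g: "\<And>y. g y \<in> {0..1}"
  shows "\<exists>f. (\<forall>y. f y \<in> {0..1}) \<and> (\<forall>y. f y = (1 - r) * g y + r * kexp \<kappa> f y)"
proof -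
  define S where "S f y = (1 - r) * g y + r * kexp \<kappa> f y" for f and y :: 'a
  define F where "F n = (S ^^ n) (\<lambda>_. 0)" for n
  have S01: "S f y \<in> {0..1}" if "\<And>y. f y \<in> {0..1}" for f y
  proof -
    have "S f y \<le> (1 - r) * 1 + r * 1"
      unfolding S_def using r g kexp_01[of f \<kappa> y, OF that] by (intro add_mono mult_left_mono) auto
    then show ?thesis unfolding S_def using r g kexp_01[of f \<kappa> y, OF that] by (auto intro!: add_nonneg_nonneg mult_nonneg_nonneg)
  qed
  have F01: "F n y \<in> {0..1}" for n y
    by (induction n arbitrary: y) (simp add: F_def, simp add: F_def, use S01 in simp)
  have F_Suc: "F (Suc n) = S (F n)" for n by (simp add: F_def)
  have mono: "F n y \<le> F (Suc n) y" for n y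
  proof (induction n arbitrary: y)
    case 0
    then show ?case using F01[of "Suc 0" y] by (simp add: F_def)
  next
    case (Suc n)
    have "kexp \<kappa> (F n) y \<le> kexp \<kappa> (F (Suc n)) y"
      unfolding kexp_def using Suc by (intro integral_mono integrable_pmf_01 F01)
    then have "S (F n) y \<le> S (F (Suc n)) y" unfolding S_def using r by (simp add: mult_left_mono)
    then show ?case by (simp only: F_Suc)
  qed
  define f where "f y = lim (\<lambda>n. F n y)" for y
  have lim: "(\<lambda>n. F n y) \<longlonglongrightarrow> f y" for y
  proof -
    have "incseq (\<lambda>n. F n y)" by (rule incseq_SucI) (rule mono)
    moreover have "\<forall>n. F n y \<le> 1" using F01 by simp
    ultimately obtain L where "(\<lambda>n. F n y) \<longlonglongrightarrow> L" by (rule incseq_convergent)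
    then show ?thesis by (simp add: f_def limI)
  qed
  have f01: "f y \<in> {0..1}" for y
    using F01 by (auto intro!: LIMSEQ_le_const[OF lim] LIMSEQ_le_const2[OF lim])
  have "f y = (1 - r) * g y + r * kexp \<kappa> f y" for y
  proof -
    have "(\<lambda>n. kexp \<kappa> (F n) y) \<longlonglongrightarrow> kexp \<kappa> f y"
      unfolding kexp_def
    proof (rule integral_dominated_convergence[where w="\<lambda>_. 1"])
      show "AE x in measure_pmf (\<kappa> y). norm (F n x) \<le> 1" for n using F01 by (intro AE_I2) auto
    qed (use lim in auto)
    then have "(\<lambda>n. F (Suc n) y) \<longlonglongrightarrow> (1 - r) * g y + r * kexp \<kappa> f y"
      unfolding F_Suc S_def by (intro tendsto_intros)
    then show ?thesis using LIMSEQ_Suc[OF lim] LIMSEQ_unique by blast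
  qed
  with f01 show ?thesis by blast
qed

lemma moments_exist:
  fixes \<kappa> :: "'a \<Rightarrow> 'a pmf"
  assumes h: "\<And>y. h y \<in> {0..1}" and \<theta>: "0 < \<theta>"
  obtains m where "\<And>y. m 0 y = 1" "\<And>k y. m k y \<in> {0..1::real}"
    "\<And>k y. (\<theta> + real (Suc k)) * m (Suc k) y = real (Suc k) * h y * m k y + \<theta> * kexp \<kappa> (m (Suc k)) y"
proof -
  \<comment> \<open>The clause for \<open>k = 0\<close> pins the start of the dependent choice to
    the constant 1.\<close>
  have "\<exists>m. \<forall>k. ((\<forall>y. m k y \<in> {0..1::real}) \<and> (k = 0 \<longrightarrow> m k = (\<lambda>_. 1))) \<and>
    (\<forall>y. (\<theta> + real (Suc k)) * m (Suc k) y = real (Suc k) * h y * m k y + \<theta> * kexp \<kappa> (m (Suc k)) y)"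
  proof (rule dependent_nat_choice)
    show "\<exists>f. (\<forall>y. f y \<in> {0..1::real}) \<and> (0 = 0 \<longrightarrow> f = (\<lambda>_. 1))" by auto
    fix f :: "'a \<Rightarrow> real" and k :: nat
    assume "(\<forall>y. f y \<in> {0..1}) \<and> (k = 0 \<longrightarrow> f = (\<lambda>_. 1))"
    then have hf: "h y * f y \<in> {0..1}" for y using h[of y] by (auto intro!: mult_le_one)
    \<comment> \<open>Dividing the moment equation by \<open>\<theta> + real (Suc k)\<close> turns
      it into the equation of \<open>kernel_resolvent_exists\<close> with source
      \<open>h y * f y\<close> and damping \<open>r\<close>.\<close>
    define r where "r = \<theta> / (\<theta> + real (Suc k))"
    have pos: "\<theta> + real (Suc k) > 0" using \<theta> by simp
    have r: "r \<in> {0..1}" "(\<theta> + real (Suc k)) * r = \<theta>" using \<theta> pos by (auto simp: r_def)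
    obtain f' where f': "\<And>y. f' y \<in> {0..1}" "\<And>y. f' y = (1 - r) * (h y * f y) + r * kexp \<kappa> f' y"
      using kernel_resolvent_exists[of r "\<lambda>y. h y * f y" \<kappa>, OF r(1) hf] by blast
    have "(\<theta> + real (Suc k)) * f' y = real (Suc k) * h y * f y + \<theta> * kexp \<kappa> f' y" for y
    proof -
      have "(\<theta> + real (Suc k)) * f' y = (\<theta> + real (Suc k)) * ((1 - r) * (h y * f y) + r * kexp \<kappa> f' y)"
        using f'(2)[of y] by simp
      also have "\<dots> = ((\<theta> + real (Suc k)) - (\<theta> + real (Suc k)) * r) * (h y * f y) + ((\<theta> + real (Suc k)) * r) * kexp \<kappa> f' y"
        by (simp only: algebra_simps)
      finally show ?thesis unfolding r(2) by simp
    qed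
    then show "\<exists>f'. ((\<forall>y. f' y \<in> {0..1}) \<and> (Suc k = 0 \<longrightarrow> f' = (\<lambda>_. 1))) \<and>
      (\<forall>y. (\<theta> + real (Suc k)) * f' y = real (Suc k) * h y * f y + \<theta> * kexp \<kappa> f' y)"
      using f'(1) by blast
  qed
  then obtain m where m: "\<forall>k. ((\<forall>y. m k y \<in> {0..1::real}) \<and> (k = 0 \<longrightarrow> m k = (\<lambda>_. 1))) \<and>
    (\<forall>y. (\<theta> + real (Suc k)) * m (Suc k) y = real (Suc k) * h y * m k y + \<theta> * kexp \<kappa> (m (Suc k)) y)" ..
  then have "m 0 = (\<lambda>_. 1)" by blast
  with m show ?thesis by (intro that[of m]) simp_all
qed

subsection \<open>Generators\<close>

lemma idm_eq_pmf: "idm i j = pmf (return_pmf i) j"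
  by (simp add: idm_def pmf_return indicator_def)

lemma idm_has_sum: "(idm i has_sum 1) UNIV"
proof -
  have "idm i = pmf (return_pmf i)" by (rule ext) (rule idm_eq_pmf)
  then show ?thesis using prob_vec_pmf[of "return_pmf i"] by (simp add: prob_vec_def)
qed

lemma generator_diag_le_0:
  assumes "generator G" shows "G i i \<le> 0"
proof -
  have "(G i has_sum - G i i) (UNIV - {i})" using assms by (simp add: generator_def)
  then have "0 \<le> - G i i" by (rule has_sum_nonneg) (use assms in \<open>auto simp: generator_def\<close>)
  then show ?thesis by simp
qed

lemma generator_row_has_sum:
  assumes "generator G" shows "(G i has_sum 0) UNIV"
proof -
  have "(G i has_sum - G i i) (UNIV - {i})" using assms by (simp add: generator_def)
  then have "(G i has_sum (G i i + - G i i)) (insert i (UNIV - {i}))" by (intro has_sum_insert) auto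
  then show ?thesis by (simp add: insert_UNIV)
qed

text \<open>The diagonal of a generator is nonpositive, so the admissible rates are closed upwards
  and contain everything strictly above their infimum. Boundedness of the diagonal makes the set
  nonempty, which \<open>Inf\<close> requires to be meaningful.\<close>

lemma unif_rate_less:
  assumes G: "generator G" and r: "unif_rate G < r"
  shows "0 < r" "0 \<le> idm i j + G i j / r"
proof -
  let ?S = "{r. r > 0 \<and> (\<forall>i j. idm i j + G i j / r \<ge> 0)}"
  obtain B where B: "\<And>i. \<bar>G i i\<bar> \<le> B" using G by (auto simp: generator_def bdd_above_def)
  have B0: "0 \<le> B" using B[of undefined] by linarith
  have "B + 1 \<in> ?S"
  proof -
    have "0 \<le> idm i j + G i j / (B + 1)" for i j
    proof (cases "i = j")
      case True
      have "- G i i \<le> B + 1" using B[of i] by linarith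
      then show ?thesis using True B0 by (simp add: idm_def field_simps)
    next
      case False
      then show ?thesis using G B0 by (simp add: idm_def generator_def)
    qed
    then show ?thesis using B0 by auto
  qed
  then have "?S \<noteq> {}" by blast
  then obtain s where s: "s \<in> ?S" "s < r" using r cInf_lessD[of ?S r] unfolding unif_rate_def by blast
  then show r0: "0 < r" by auto
  show "0 \<le> idm i j + G i j / r"
  proof (cases "i = j")
    case True
    have "0 \<le> idm i i + G i i / s" using s(1) by blast
    then have "0 \<le> 1 + G i i / s" by (simp add: idm_def)
    moreover have "G i i / s \<le> G i i / r"
      using generator_diag_le_0[OF G, of i] s by (intro divide_left_mono_neg) auto
    ultimately show ?thesis using True by (simp add: idm_def)
  next
    case False
    then show ?thesis using G r0 by (simp add: idm_def generator_def)
  qed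
qed

lemma prob_vec_uniformized_row:
  assumes G: "generator G" and r: "unif_rate G < r"
  shows "prob_vec (\<lambda>j. idm i j + G i j / r)"
proof -
  have "((\<lambda>j. idm i j + G i j * (1 / r)) has_sum (1 + 0 * (1 / r))) UNIV"
    by (intro has_sum_add has_sum_cmult_left idm_has_sum generator_row_has_sum G)
  then show ?thesis using unif_rate_less[OF assms] by (simp add: prob_vec_def)
qed

lemma prob_vec_kernel_exists:
  assumes "\<And>i. prob_vec (K i)"
  shows "\<exists>\<kappa>. \<forall>i j. pmf (\<kappa> i) j = K i j"
proof -
  have "\<forall>i. \<exists>q. pmf q = K i" using prob_vec_obtain_pmf[OF assms] by metis
  then obtain \<kappa> where "\<forall>i. pmf (\<kappa> i) = K i" by metis
  then show ?thesis by (intro exI[of _ \<kappa>]) simp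
qed

lemma expectation_pmf_has_sum:
  fixes f :: "'a \<Rightarrow> real"
  assumes f: "\<And>x. \<bar>f x\<bar> \<le> B"
  shows "((\<lambda>x. pmf p x * f x) has_sum measure_pmf.expectation p f) UNIV"
proof -
  have "integrable (count_space UNIV) (\<lambda>x. pmf p x * f x)"
    using integrable_pmf_bounded[OF f, of p] unfolding measure_pmf_eq_density
    by (subst (asm) integrable_density) simp_all
  then have as: "Infinite_Set_Sum.abs_summable_on (\<lambda>x. pmf p x * f x) UNIV"
    by (simp add: Infinite_Set_Sum.abs_summable_on_def)
  have "infsum (\<lambda>x. pmf p x * f x) UNIV = measure_pmf.expectation p f"
    unfolding expectation_pmf_count_space infsetsum_infsum[OF as, symmetric] infsetsum_def ..
  moreover have "(\<lambda>x. pmf p x * f x) summable_on UNIV"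
    using as unfolding abs_summable_equivalent[symmetric] by (rule abs_summable_summable)
  ultimately show ?thesis by (simp add: has_sum_iff)
qed

text \<open>Connects the matrix powers in which ergodicity is stated with iterated
  \<open>bind_pmf\<close>.\<close>

lemma vecmat_pmf:
  assumes "\<And>i j. pmf (\<kappa> i) j = K i j"
  shows "((\<lambda>v. vecmat v K) ^^ n) (pmf p) = pmf (((\<lambda>p. bind_pmf p \<kappa>) ^^ n) p)"
proof (induction n)
  case (Suc n)
  have "vecmat (pmf q) K = pmf (bind_pmf q \<kappa>)" for q
  proof
    fix j
    have "((\<lambda>i. pmf q i * pmf (\<kappa> i) j) has_sum pmf (bind_pmf q \<kappa>) j) UNIV"
      unfolding pmf_bind by (rule expectation_pmf_has_sum[where B=1]) (simp add: pmf_le_1)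
    then show "vecmat (pmf q) K j = pmf (bind_pmf q \<kappa>) j"
      by (simp add: vecmat_def assms infsumI)
  qed
  then show ?case using Suc by simp
qed simp

subsection \<open>The occupation law\<close>

lemma has_sum_nonneg_0D:
  fixes f :: "'a \<Rightarrow> real"
  assumes "(f has_sum 0) A" "\<And>x. x \<in> A \<Longrightarrow> 0 \<le> f x" "x \<in> A"
  shows "f x = 0"
  using nonneg_infsum_le_0D[of f A x] assms by (auto simp: has_sum_iff)

lemma pmf_eq_1_return:
  assumes "pmf p x = 1" shows "p = return_pmf x"
proof -
  have "measure_pmf.prob p {x} = 1" using assms by (simp add: pmf.rep_eq)
  then have "AE y in measure_pmf p. y \<in> {x}" by (subst (asm) measure_pmf.prob_eq_1) auto
  then have "set_pmf p \<subseteq> {x}" by (auto simp: AE_measure_pmf_iff)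
  then show ?thesis by (simp add: set_pmf_subset_singleton)
qed

lemma sum_occupation:
  assumes F: "finite F"
  shows "(\<Sum>l\<in>F. a l * occupation Y n l) = (\<Sum>j\<in>{1..n}. if Y j \<in> F then a (Y j) else 0) / real n"
proof -
  have "(\<Sum>l\<in>F. a l * occupation Y n l) = (\<Sum>l\<in>F. \<Sum>j\<in>{1..n}. if Y j = l then a l else 0) / real n"
    unfolding occupation_def sum_divide_distrib sum_distrib_left by (intro sum.cong) auto
  also have "(\<Sum>l\<in>F. \<Sum>j\<in>{1..n}. if Y j = l then a l else 0) = (\<Sum>j\<in>{1..n}. \<Sum>l\<in>F. if Y j = l then a l else 0)"
    by (rule sum.swap)
  also have "\<dots> = (\<Sum>j\<in>{1..n}. if Y j \<in> F then a (Y j) else 0)"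
    using F by (intro sum.cong refl) (simp add: sum.delta')
  finally show ?thesis .
qed

text \<open>The vector is the law of \<open>Y J\<close> with \<open>J\<close> uniform on
  \<open>{1..n}\<close>. At \<open>n = 0\<close> it is the zero vector.\<close>

lemma occupation_in_prob_vecs:
  assumes n: "1 \<le> n" shows "occupation Y n \<in> prob_vecs"
proof -
  have fin: "finite {1..n}" "{1..n} \<noteq> {}" using n by auto
  have "occupation Y n = pmf (map_pmf Y (pmf_of_set {1..n}))"
  proof
    fix l
    have "pmf (map_pmf Y (pmf_of_set {1..n})) l = real (card ({1..n} \<inter> Y -` {l})) / real n"
      using fin by (simp add: pmf_map measure_pmf_of_set)
    also have "real (card ({1..n} \<inter> Y -` {l})) = (\<Sum>j\<in>{1..n}. of_bool (Y j = l))"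
      by (simp add: sum.If_cases of_bool_def vimage_def Int_def)
    finally show "occupation Y n l = pmf (map_pmf Y (pmf_of_set {1..n})) l"
      by (simp add: occupation_def)
  qed
  then show ?thesis by (simp add: prob_vecs_def prob_vec_pmf)
qed

lemma borel_measurable_occupation:
  fixes Y :: "nat \<Rightarrow> 'm \<Rightarrow> 'a::countable"
  assumes [measurable]: "\<And>j. Y j \<in> measurable M (count_space UNIV)"
  shows "(\<lambda>\<omega>. occupation (\<lambda>j. Y j \<omega>) n) \<in> borel_measurable M"
  by (rule measurable_coordinatewise_then_product) (simp add: occupation_def)

theorem mainTheorem4:
  fixes G :: "'a::countable \<Rightarrow> 'a \<Rightarrow> real"
    and \<theta> :: real and M :: nat
    and \<pi> \<mu> :: "'a \<Rightarrow> real"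
    and Om :: "'m measure" and T :: "nat \<Rightarrow> 'm \<Rightarrow> 'a"
    and N :: "'n measure" and Y' :: "nat \<Rightarrow> 'n \<Rightarrow> 'a" and X' :: "nat \<Rightarrow> 'n \<Rightarrow> real"
    and L :: "'l measure" and T' :: "nat \<Rightarrow> 'l \<Rightarrow> 'a" and Xp :: "nat \<Rightarrow> 'l \<Rightarrow> real"
  defines "Q \<equiv> (\<lambda>i j. idm i j + G i j / \<theta>)"
    and "G' \<equiv> (\<lambda>i j. if \<mu> i \<noteq> 0 then \<mu> j / \<mu> i * G j i else 0)"
  defines "Q' \<equiv> (\<lambda>i j. idm i j + G' i j / \<theta>)"
  assumes gen: "generator G"
    and nonzero_rows: "\<forall>i. \<exists>j. G i j \<noteq> 0"
    and theta: "\<theta> > unif_rate G" and Mbig: "real M > unif_rate G"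
    and pi: "prob_vec \<pi>"
    and mu: "stationary_dist Q \<mu>"
    and conv: "\<forall>j. (\<lambda>n. ((\<lambda>v. vecmat v Q) ^^ n) \<pi> j) \<longlonglongrightarrow> \<mu> j"
    and T: "markov_chain Om \<pi> (\<lambda>n i j. idm i j + G i j / real n * of_bool (n > M)) T"
    and MCcGEM: "chain_with_sticks N \<mu> (\<lambda>_. jump_kernel G') (\<lambda>y. - G' y y) Y' X'"
    and TP: "chain_with_sticks L \<mu> (\<lambda>_. Q') (\<lambda>_. \<theta>) T' Xp"
  shows "stationary_dist Q' \<mu> \<and>
         (AE \<omega> in N. atom_vec (\<lambda>j. stick (\<lambda>i. X' i \<omega>) j) (\<lambda>j. Y' j \<omega>) \<in> prob_vecs) \<and>
         conv_distr Om (\<lambda>n \<omega>. occupation (\<lambda>j. T j \<omega>) n) N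
           (\<lambda>\<omega>. atom_vec (\<lambda>j. stick (\<lambda>i. X' i \<omega>) j) (\<lambda>j. Y' j \<omega>)) \<and>
         distr N borel (\<lambda>\<omega>. atom_vec (\<lambda>j. stick (\<lambda>i. X' i \<omega>) j) (\<lambda>j. Y' j \<omega>))
           = distr L borel (\<lambda>\<omega>. atom_vec (\<lambda>j. stick (\<lambda>i. Xp i \<omega>) j) (\<lambda>j. T' j \<omega>))"
proof -
  have th: "0 < \<theta>" using unif_rate_less(1)[OF gen theta] .
  obtain \<pi>p where \<pi>p: "pmf \<pi>p = \<pi>" using prob_vec_obtain_pmf[OF pi] .
  obtain \<mu>p where \<mu>p: "pmf \<mu>p = \<mu>" using prob_vec_obtain_pmf mu by (auto simp: stationary_dist_def)
  have Q_row: "prob_vec (Q i)" for i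
    unfolding Q_def by (rule prob_vec_uniformized_row[OF gen theta])
  obtain Qp where "\<forall>i j. pmf (Qp i) j = Q i j"
    using prob_vec_kernel_exists[of Q, OF Q_row] ..
  then have Qp: "\<And>i j. pmf (Qp i) j = Q i j" by blast
  have \<mu>_nonneg: "0 \<le> \<mu> i" for i unfolding \<mu>p[symmetric] by simp
  have Q_nonneg: "0 \<le> Q i j" for i j unfolding Qp[symmetric] by simp
  have \<mu>Q: "((\<lambda>i. \<mu> i * Q i j) has_sum \<mu> j) UNIV" for j using mu by (simp add: stationary_dist_def)

  \<comment> \<open>On the support of \<open>\<mu>\<close> this is the time reversal of
    \<open>Q\<close>; elsewhere the row of \<open>G'\<close> vanishes and \<open>Q'\<close> stays
    put.\<close>
  have Q'_eq: "Q' i j = (if \<mu> i \<noteq> 0 then \<mu> j / \<mu> i * Q j i else idm i j)" for i j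
    unfolding Q'_def G'_def Q_def by (auto simp: idm_def distrib_left)
  have reversal: "\<mu> i * Q i j = \<mu> j * Q' j i" for i j
  proof (cases "\<mu> j = 0")
    \<comment> \<open>Stationarity at \<open>j\<close> is here a vanishing sum of nonnegative terms,
      so \<open>\<mu> i * Q i j = 0\<close> for every \<open>i\<close> and both sides
      vanish.\<close>
    case True
    then show ?thesis
      using has_sum_nonneg_0D[of "\<lambda>i. \<mu> i * Q i j" UNIV i] \<mu>Q[of j] \<mu>_nonneg Q_nonneg by simp
  qed (simp add: Q'_eq)
  have Q'_row: "prob_vec (Q' i)" for i
  proof (cases "\<mu> i = 0")
    case True
    then have "Q' i = pmf (return_pmf i)" by (intro ext) (simp add: Q'_eq idm_eq_pmf)
    then show ?thesis by (simp add: prob_vec_pmf)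
  next
    case False
    have "((\<lambda>j. 1 / \<mu> i * (\<mu> j * Q j i)) has_sum 1 / \<mu> i * \<mu> i) UNIV"
      by (intro has_sum_cmult_right \<mu>Q)
    moreover have "(\<lambda>j. 1 / \<mu> i * (\<mu> j * Q j i)) = Q' i"
      using False by (intro ext) (simp add: Q'_eq)
    moreover have "0 \<le> Q' i j" for j using False \<mu>_nonneg Q_nonneg by (simp add: Q'_eq)
    ultimately show ?thesis using False by (simp add: prob_vec_def)
  qed
  obtain Q'p where "\<forall>i j. pmf (Q'p i) j = Q' i j"
    using prob_vec_kernel_exists[of Q', OF Q'_row] ..
  then have Q'p: "\<And>i j. pmf (Q'p i) j = Q' i j" by blast
  have stationary: "stationary_dist Q' \<mu>"
    unfolding stationary_dist_def
  proof (intro conjI allI)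
    fix j
    \<comment> \<open>By reversal, stationarity of \<open>\<mu>\<close> under \<open>Q'\<close> is
      nothing but the row sum of \<open>Q\<close>.\<close>
    have "(Q j has_sum 1) UNIV" using Q_row[of j] by (simp add: prob_vec_def)
    then have "((\<lambda>i. \<mu> j * Q j i) has_sum \<mu> j * 1) UNIV" by (rule has_sum_cmult_right)
    then show "((\<lambda>i. \<mu> i * Q' i j) has_sum \<mu> j) UNIV" unfolding reversal by simp
  qed (use mu in \<open>simp add: stationary_dist_def\<close>)

  define c where "c y = - G' y y" for y
  have c_Q': "Q' y y = 1 - c y / \<theta>" for y by (simp add: Q'_def c_def idm_def)
  have c_nonneg: "0 \<le> c y" for y
    using generator_diag_le_0[OF gen, of y] by (simp add: c_def G'_def)
  \<comment> \<open>The uniform bound on the jump rates, on which the decay of the residue rests,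
    comes from the nonnegative diagonal of \<open>Q'\<close>.\<close>
  have c_le: "c y \<le> \<theta>" for y
  proof -
    have "0 \<le> 1 - c y / \<theta>" unfolding c_Q'[symmetric] Q'p[symmetric] by simp
    then show ?thesis using th by (simp add: divide_le_eq)
  qed
  \<comment> \<open>\<open>Q'\<close> is the jump chain of \<open>G'\<close> slowed down: it holds
    with probability \<open>1 - c y / \<theta>\<close>. Where \<open>c y = 0\<close>, the diagonal
    entry 1 already determines the row.\<close>
  have Q'_jump: "Q' y z = (1 - c y / \<theta>) * idm y z + c y / \<theta> * jump_kernel G' y z" for y z
  proof (cases "c y = 0")
    case True
    then have "Q'p y = return_pmf y" by (intro pmf_eq_1_return) (simp add: Q'p c_Q')
    then show ?thesis using True Q'p[of y z] by (simp add: idm_eq_pmf)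
  next
    case False
    moreover have "Q' y z = G' y z / \<theta>" if "y \<noteq> z" using that by (simp add: Q'_def idm_def)
    ultimately show ?thesis using th c_Q'[of y]
      by (auto simp: jump_kernel_def c_def idm_def)
  qed
  have J_row: "prob_vec (jump_kernel G' y)" for y
  proof (cases "c y = 0")
    case True
    then have "jump_kernel G' y = pmf (return_pmf y)"
      by (auto simp: jump_kernel_def c_def idm_eq_pmf[symmetric] idm_def)
    then show ?thesis by (simp add: prob_vec_pmf)
  next
    case False
    \<comment> \<open>The mixture formula, solved for the jump kernel, gives its row sum.\<close>
    have "((\<lambda>z. \<theta> / c y * (Q' y z + - ((1 - c y / \<theta>) * idm y z))) has_sum \<theta> / c y * (1 + - ((1 - c y / \<theta>) * 1))) UNIV"
      using Q'_row[of y]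
      by (intro has_sum_cmult_right has_sum_add has_sum_uminusI idm_has_sum) (simp add: prob_vec_def)
    moreover have "(\<lambda>z. \<theta> / c y * (Q' y z + - ((1 - c y / \<theta>) * idm y z))) = jump_kernel G' y"
      using False th by (intro ext) (simp add: Q'_jump)
    moreover have "0 \<le> jump_kernel G' y z" for z
    proof -
      have "0 \<le> G' y z" if "y \<noteq> z"
        using that gen \<mu>_nonneg by (auto simp: G'_def generator_def)
      then show ?thesis using c_nonneg[of y] by (auto simp: jump_kernel_def c_def intro: divide_nonneg_nonpos)
    qed
    ultimately show ?thesis using False th by (simp add: prob_vec_def)
  qed
  obtain Jp where "\<forall>i j. pmf (Jp i) j = jump_kernel G' i j"
    using prob_vec_kernel_exists[of "jump_kernel G'", OF J_row] ..
  then have Jp: "\<And>i j. pmf (Jp i) j = jump_kernel G' i j" by blast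

  define K where "K n i j = idm i j + G i j / real n * of_bool (n > M)" for n i j
  have "prob_vec (K n i)" for n i
  proof (cases "n > M")
    case True
    then have "unif_rate G < real n" using Mbig by linarith
    from prob_vec_uniformized_row[OF gen this, of i] show ?thesis using True by (simp add: K_def[abs_def])
  next
    case False
    then have "K n i = pmf (return_pmf i)" by (intro ext) (simp add: K_def idm_eq_pmf)
    then show ?thesis by (simp add: prob_vec_pmf)
  qed
  then have "\<forall>n i. \<exists>q. pmf q = K n i" using prob_vec_obtain_pmf by metis
  then obtain \<kappa> where "\<forall>n i. pmf (\<kappa> n i) = K n i" by metis
  then have \<kappa>: "\<And>n i j. pmf (\<kappa> n i) j = K n i j" by simp

  have chain_T: "stick_chain Om \<pi>p \<kappa> (\<lambda>_. 0) T (\<lambda>_ _. 1)"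
    by (rule markov_chain_stick_chain) (use T in \<open>simp add: \<pi>p \<kappa> K_def\<close>)
  have chain_N: "stick_chain N \<mu>p (\<lambda>_. Jp) c Y' X'"
    unfolding stick_chain_def stick_chain_axioms_def
    using MCcGEM c_nonneg by (simp add: \<mu>p Jp c_def[abs_def] chain_with_sticks_def)
  have chain_L: "stick_chain L \<mu>p (\<lambda>_. Q'p) (\<lambda>_. \<theta>) T' Xp"
    unfolding stick_chain_def stick_chain_axioms_def
    using TP th by (simp add: \<mu>p Q'p chain_with_sticks_def)
  interpret SO: stick_chain Om \<pi>p \<kappa> "\<lambda>_. 0" T "\<lambda>_ _. 1" by (rule chain_T)
  interpret SN: stick_chain N \<mu>p "\<lambda>_. Jp" c Y' X' by (rule chain_N)
  interpret SL: stick_chain L \<mu>p "\<lambda>_. Q'p" "\<lambda>_. \<theta>" T' Xp by (rule chain_L)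
  let ?occ = "\<lambda>n \<omega>. occupation (\<lambda>j. T j \<omega>) n"

  have exp_moments:
    "(\<lambda>n. \<integral>\<omega>. exp (\<Sum>l\<in>F. a l * ?occ n \<omega> l) \<partial>Om) \<longlonglongrightarrow> (\<integral>\<omega>. exp (\<Sum>l\<in>F. a l * SN.random_vec \<omega> l) \<partial>N)
     \<and> (\<integral>\<omega>. exp (\<Sum>l\<in>F. a l * SN.random_vec \<omega> l) \<partial>N) = (\<integral>\<omega>. exp (\<Sum>l\<in>F. a l * SL.random_vec \<omega> l) \<partial>L)"
    if F: "finite F" and a: "\<And>l. 0 \<le> a l" for F and a :: "'a \<Rightarrow> real"
  proof -
    \<comment> \<open>The summand 1 keeps \<open>t\<close> positive when all coefficients vanish. As
      \<open>t\<close> exceeds every \<open>a l\<close> with \<open>l \<in> F\<close>, the weights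
      \<open>h\<close> lie in the unit interval and the exponent becomes \<open>t\<close> times an
      \<open>h\<close>-mass.\<close>
    define t where "t = 1 + sum a F"
    have t: "0 < t" using a by (simp add: t_def sum_nonneg add_pos_nonneg)
    define h where "h l = (if l \<in> F then a l / t else 0)" for l
    have h: "h l \<in> {0..1}" for l
    proof (cases "l \<in> F")
      case True
      then have "a l \<le> t" using member_le_sum[of l F a] a F by (simp add: t_def)
      then show ?thesis using a[of l] t by (simp add: h_def)
    qed (simp add: h_def)
    obtain m where m_0: "\<And>y. m 0 y = 1" and m: "\<And>k y. m k y \<in> {0..1::real}"
      and m_eq: "\<And>k y. (\<theta> + real (Suc k)) * m (Suc k) y = real (Suc k) * h y * m k y + \<theta> * kexp Q'p (m (Suc k)) y"
      using moments_exist[of h \<theta> Q'p, OF h th] by blast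
    \<comment> \<open>Here the two stick-breaking constructions meet:
      \<open>\<theta> (Q' - I)\<close> and \<open>c (J - I)\<close>, with \<open>J\<close> the jump
      kernel, are the same operator, so one \<open>m\<close> solves both moment equations.\<close>
    have m_eq_J: "(c y + real (Suc k)) * m (Suc k) y = real (Suc k) * h y * m k y + c y * kexp Jp (m (Suc k)) y" for k y
    proof -
      have "kexp Q'p (m (Suc k)) y = (1 - c y / \<theta>) * m (Suc k) y + c y / \<theta> * kexp Jp (m (Suc k)) y"
        by (rule kexp_mixture) (use m in \<open>auto simp: Q'p Jp Q'_jump idm_eq_pmf\<close>)
      then have "\<theta> * kexp Q'p (m (Suc k)) y = \<theta> * m (Suc k) y - c y * m (Suc k) y + c y * kexp Jp (m (Suc k)) y"
        using th by (simp add: field_simps)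
      then show ?thesis using m_eq[of k y] by (simp add: distrib_right)
    qed
    interpret O: occupation_chain Om \<pi>p \<kappa> "\<lambda>_. 0" T "\<lambda>_ _. 1" Qp Q'p \<mu>p \<theta> M h m
    proof
      show "pmf (\<kappa> n y) z = (1 - \<theta> / real n) * pmf (return_pmf y) z + \<theta> / real n * pmf (Qp y) z" if "M < n" for n y z
        using that th by (simp add: \<kappa> K_def Qp Q_def idm_eq_pmf field_simps)
      show "\<kappa> n y = return_pmf y" if "n \<le> M" for n y
        using that by (intro pmf_eqI) (simp add: \<kappa> K_def idm_eq_pmf)
      show "pmf \<mu>p i * pmf (Qp i) j = pmf \<mu>p j * pmf (Q'p j) i" for i j
        by (simp add: \<mu>p Qp Q'p reversal)
      show "(\<lambda>n. pmf (((\<lambda>p. bind_pmf p Qp) ^^ n) \<pi>p) j) \<longlonglongrightarrow> pmf \<mu>p j" for j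
        using conv by (simp add: vecmat_pmf[OF Qp, symmetric] \<pi>p \<mu>p)
    qed (fact th h m m_0 m_eq)+
    interpret HN: homogeneous_stick_chain N \<mu>p Jp c Y' X' h m \<theta>
      by unfold_locales (fact h m m_0 c_le m_eq_J)+
    interpret HL: homogeneous_stick_chain L \<mu>p Q'p "\<lambda>_. \<theta>" T' Xp h m \<theta>
      by unfold_locales (fact h m m_0 m_eq order_refl)+
    have occ: "(\<Sum>l\<in>F. a l * ?occ n \<omega> l) = t * O.occ n \<omega>" for n \<omega>
    proof -
      have "(if T j \<omega> \<in> F then a (T j \<omega>) else 0) = t * h (T j \<omega>)" for j
        using t by (simp add: h_def)
      then show ?thesis by (simp add: sum_occupation[OF F] O.occ_def sum_distrib_left)
    qed
    have N: "(\<integral>\<omega>. exp (\<Sum>l\<in>F. a l * SN.random_vec \<omega> l) \<partial>N) = (\<integral>\<omega>. exp (t * HN.total_mass \<omega>) \<partial>N)"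
    proof (rule integral_cong_AE)
      show "AE \<omega> in N. exp (\<Sum>l\<in>F. a l * SN.random_vec \<omega> l) = exp (t * HN.total_mass \<omega>)"
        using HN.AE_sum_random_vec[OF F h_def] t by auto
    qed (use measurable_product_then_coordinatewise[OF SN.measurable_random_vec] HN.measurable_total_mass in measurable)
    have L: "(\<integral>\<omega>. exp (\<Sum>l\<in>F. a l * SL.random_vec \<omega> l) \<partial>L) = (\<integral>\<omega>. exp (t * HL.total_mass \<omega>) \<partial>L)"
    proof (rule integral_cong_AE)
      show "AE \<omega> in L. exp (\<Sum>l\<in>F. a l * SL.random_vec \<omega> l) = exp (t * HL.total_mass \<omega>)"
        using HL.AE_sum_random_vec[OF F h_def] t by auto
    qed (use measurable_product_then_coordinatewise[OF SL.measurable_random_vec] HL.measurable_total_mass in measurable)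
    have "(\<lambda>n. \<integral>\<omega>. exp (t * O.occ n \<omega>) \<partial>Om) \<longlonglongrightarrow> (\<integral>\<omega>. exp (t * HN.total_mass \<omega>) \<partial>N)"
    proof (rule expectation_exp_tendsto[OF SO.prob_space_axioms SN.prob_space_axioms])
      show "AE \<omega> in Om. O.occ n \<omega> \<in> {0..1}" for n using O.occ_01 by (intro AE_I2)
      show "(\<lambda>n. \<integral>\<omega>. O.occ n \<omega> ^ k \<partial>Om) \<longlonglongrightarrow> (\<integral>\<omega>. HN.total_mass \<omega> ^ k \<partial>N)" for k
        unfolding HN.expectation_total_mass_power by (rule O.occ_power_tendsto)
    qed (fact O.measurable_occ HN.measurable_total_mass HN.AE_total_mass_01)+
    \<comment> \<open>Both total masses have the mean of \<open>m k\<close> under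
      \<open>\<mu>\<close> as their \<open>k\<close>-th moment, so the exponential series agree term
      by term.\<close>
    moreover have "(\<integral>\<omega>. exp (t * HN.total_mass \<omega>) \<partial>N) = (\<integral>\<omega>. exp (t * HL.total_mass \<omega>) \<partial>L)"
      using expectation_exp_sums(1)[OF SN.prob_space_axioms HN.measurable_total_mass HN.AE_total_mass_01, of t]
        expectation_exp_sums(1)[OF SL.prob_space_axioms HL.measurable_total_mass HL.AE_total_mass_01, of t]
      unfolding HN.expectation_total_mass_power HL.expectation_total_mass_power by (rule sums_unique2)
    ultimately show ?thesis unfolding occ N L by simp
  qed

  have AE_N: "AE \<omega> in N. SN.random_vec \<omega> \<in> prob_vecs" by (rule SN.AE_random_vec[OF c_le])
  have AE_L: "AE \<omega> in L. SL.random_vec \<omega> \<in> prob_vecs" by (rule SL.AE_random_vec[OF order_refl])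
  have AE_N': "AE \<omega> in N. SN.random_vec \<omega> \<in> unit_cube" and AE_L': "AE \<omega> in L. SL.random_vec \<omega> \<in> unit_cube"
    using AE_N AE_L prob_vecs_subset_unit_cube by (auto elim!: eventually_mono)
  \<comment> \<open>Only from \<open>n = 1\<close> on, since the occupation vector at time 0 is
    zero.\<close>
  have AE_occ: "\<forall>\<^sub>F n in sequentially. AE \<omega> in Om. ?occ n \<omega> \<in> prob_vecs"
    using eventually_ge_at_top[of 1] by eventually_elim (intro AE_I2 occupation_in_prob_vecs)
  have AE_occ': "\<forall>\<^sub>F n in sequentially. AE \<omega> in Om. ?occ n \<omega> \<in> unit_cube"
    using AE_occ by eventually_elim (use prob_vecs_subset_unit_cube in \<open>auto elim!: eventually_mono\<close>)
  note meas = borel_measurable_occupation[of T, OF SO.measurable_T] SN.measurable_random_vec SL.measurable_random_vec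

  have "conv_distr Om (\<lambda>n \<omega>. ?occ n \<omega>) N SN.random_vec"
    unfolding conv_distr_def
  proof (intro allI impI, elim conjE)
    fix f :: "('a \<Rightarrow> real) \<Rightarrow> real"
    assume f: "f \<in> borel_measurable borel" "continuous_on prob_vecs f" "bounded (f ` prob_vecs)"
    then obtain B where B: "\<And>q. q \<in> prob_vecs \<Longrightarrow> \<bar>f q\<bar> \<le> B" by (auto simp: bounded_iff)
    show "(\<lambda>n. \<integral>\<omega>. f (?occ n \<omega>) \<partial>Om) \<longlonglongrightarrow> (\<integral>\<omega>. f (SN.random_vec \<omega>) \<partial>N)"
    proof (rule expectation_tendsto_of_continuous_on[where Y = ?occ and Z = SN.random_vec and A = prob_vecs and B = B])
      fix g :: "('a \<Rightarrow> real) \<Rightarrow> real" assume g: "continuous_on UNIV g"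
      show "(\<lambda>n. \<integral>\<omega>. g (?occ n \<omega>) \<partial>Om) \<longlonglongrightarrow> (\<integral>\<omega>. g (SN.random_vec \<omega>) \<partial>N)"
      proof (rule expectation_continuous_tendsto[where Y = ?occ and Z = SN.random_vec])
        show "(\<lambda>n. \<integral>\<omega>. exp (\<Sum>l\<in>F. a l * ?occ n \<omega> l) \<partial>Om) \<longlonglongrightarrow> (\<integral>\<omega>. exp (\<Sum>l\<in>F. a l * SN.random_vec \<omega> l) \<partial>N)"
          if "finite F" "\<And>l. 0 \<le> a l" for F and a :: "'a \<Rightarrow> real"
          using exp_moments[of F a, OF that] by (rule conjunct1)
      qed (fact SO.prob_space_axioms SN.prob_space_axioms meas AE_occ' AE_N' g)+
    qed (fact SO.prob_space_axioms SN.prob_space_axioms meas f AE_occ AE_N B)+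
  qed
  moreover have "distr N borel SN.random_vec = distr L borel SL.random_vec"
  proof (rule distr_eqI_continuous)
    fix g :: "('a \<Rightarrow> real) \<Rightarrow> real" assume g: "continuous_on UNIV g"
    \<comment> \<open>Equality of the two laws is read off from the convergence of a constant
      sequence, so one criterion serves both claims.\<close>
    have "(\<lambda>_::nat. \<integral>\<omega>. g (SN.random_vec \<omega>) \<partial>N) \<longlonglongrightarrow> (\<integral>\<omega>. g (SL.random_vec \<omega>) \<partial>L)"
    proof (rule expectation_continuous_tendsto[where Y = "\<lambda>_. SN.random_vec" and Z = SL.random_vec])
      show "(\<lambda>_::nat. \<integral>\<omega>. exp (\<Sum>l\<in>F. a l * SN.random_vec \<omega> l) \<partial>N) \<longlonglongrightarrow> (\<integral>\<omega>. exp (\<Sum>l\<in>F. a l * SL.random_vec \<omega> l) \<partial>L)"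
        if "finite F" "\<And>l. 0 \<le> a l" for F and a :: "'a \<Rightarrow> real"
        unfolding conjunct2[OF exp_moments[of F a, OF that]] by (rule tendsto_const)
      show "\<forall>\<^sub>F n::nat in sequentially. AE \<omega> in N. SN.random_vec \<omega> \<in> unit_cube"
        by (rule always_eventually[OF allI[OF AE_N']])
    qed (fact SN.prob_space_axioms SL.prob_space_axioms meas AE_L' g)+
    then show "(\<integral>\<omega>. g (SN.random_vec \<omega>) \<partial>N) = (\<integral>\<omega>. g (SL.random_vec \<omega>) \<partial>L)"
      by (rule LIMSEQ_unique[OF tendsto_const])
  qed (fact SN.prob_space_axioms SL.prob_space_axioms meas)+
  ultimately show ?thesis using stationary AE_N by (intro conjI)
qed

end
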